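(* Fix a finite field $\mathbb{F}_q$ of odd cardinality $q$. There is a function $\varepsilon(d)$ with $\varepsilon(d)\to 0$ as $d\to\infty$ such that for every odd $d=2g+1$, every $D\in\mathcal{H}_d$ and every $\theta\in\mathbb{R}/\mathbb{Z}$, $$S(\theta,\chi_D)\le\left(\frac14+\varepsilon(d)\right)\frac{d}{\log_q d}.$$ (In other words, $S(\theta,\chi_D)\le(\tfrac14+o(1))\,d/\log_q d$ as $d\to\infty$.)
   Context: For a finite field $\mathbb{F}_q$ ($q$ odd) and a non-zero $f\in\mathbb{F}_q[x]$, $|f|=q^{\deg f}$. A prime is a monic irreducible polynomial of degree $\ge1$. For a prime $P$, $\left(\frac{f}{P}\right)$ is $0$ if $P\mid f$, $1$ if $P\nmid f$ and $f$ is a square mod $P$, and $-1$ otherwise; it is extended multiplicatively in the denominator to all monic $D$. For odd $d=2g+1$, $\mathcal{H}_d$ is the set of monic square-free $D\in\mathbb{F}_q[x]$ of degree $d$. For $D\in\mathcal{H}_d$, $\chi_D(f)=\left(\frac{D}{f}\right)$ and $\mathcal{L}(u,\chi_D)=\sum_{f\text{ monic}}\chi_D(f)u^{\deg f}=\prod_{P}(1-\chi_D(P)u^{\deg P})^{-1}$ for $|u|<1/q$; this is a polynomial of degree $2g$ whose zeros all lie on $|u|=q^{-1/2}$. When $q^{-1/2}e(\theta)$ (with $e(x)=e^{2\pi i x}$) is not a zero, $S(\theta,\chi_D):=-\frac1\pi\Delta_{\Gamma_\theta}\arg\mathcal{L}(u,\chi_D)$, where $\Gamma_\theta$ is the positively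 oriented circular arc from $q^{-2}$ to $q^{-2}e(\theta)$ followed by the radial segment from $q^{-2}e(\theta)$ to $q^{-1/2}e(\theta)$, and $\Delta_{\Gamma_\theta}\arg$ is the variation of the argument along this path; if $q^{-1/2}e(\theta)$ is a zero, $S(\theta,\chi_D):=\frac12\lim_{\varepsilon\to0}(S(\theta-\varepsilon,\chi_D)+S(\theta+\varepsilon,\chi_D))$. This is a $1$-periodic function of $\theta$. *)

theory Defs
  imports
    "HOL-Complex_Analysis.Complex_Analysis"
    "HOL-Computational_Algebra.Computational_Algebra"
begin

text \<open>
  The finite field is a type of sort \<open>{field, finite}\<close>, so that its cardinality \<open>q\<close> is
  \<open>CARD('a)\<close>.
\<close>

definition monic_irreducible :: "'a::field poly \<Rightarrow> bool" where
  "monic_irreducible P \<longleftrightarrow> lead_coeff P = 1 \<and> degree P \<ge> 1 \<and> irreducible P"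

definition legendre_symbol :: "'a::field poly \<Rightarrow> 'a poly \<Rightarrow> int" where
  "legendre_symbol f P =
     (if P dvd f then 0 else if \<exists>h. P dvd (h ^ 2 - f) then 1 else -1)"

text \<open>
  The library's \<open>multiplicity\<close> is not available for polynomials over a field that is only of
  sort \<open>field\<close>. For \<open>D \<noteq> 0\<close> and \<open>degree P \<ge> 1\<close> the set below is finite and contains 0.
\<close>

definition poly_multiplicity :: "'a::field poly \<Rightarrow> 'a poly \<Rightarrow> nat" where
  "poly_multiplicity P D = Max {k. P ^ k dvd D}"

definition jacobi_symbol :: "'a::field poly \<Rightarrow> 'a poly \<Rightarrow> int" where
  "jacobi_symbol f D =
     (\<Prod>P | monic_irreducible P \<and> P dvd D. legendre_symbol f P ^ poly_multiplicity P D)"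

definition quad_char :: "'a::field poly \<Rightarrow> 'a poly \<Rightarrow> int" where
  "quad_char D f = jacobi_symbol D f"

definition hyperelliptic_ensemble :: "nat \<Rightarrow> 'a::field poly set" where
  "hyperelliptic_ensemble d = {D. lead_coeff D = 1 \<and> squarefree D \<and> degree D = d}"

definition monic_polys :: "nat \<Rightarrow> 'a::field poly set" where
  "monic_polys n = {f. lead_coeff f = 1 \<and> degree f = n}"

text \<open>
  The \<open>L\<close>-function is the power series obtained by grouping the sum over monic \<open>f\<close> by degree.
  It agrees with that sum for \<open>\<bar>u\<bar> < 1/q\<close> (lemma \<open>has_sum_L_function\<close> below). For \<open>D\<close> in
  \<open>hyperelliptic_ensemble d\<close> with \<open>d\<close> odd, only finitely many of its coefficients are non-zero,
  so that the series is the polynomial continuing the sum to all complex \<open>u\<close>.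
\<close>

definition L_coeff :: "'a::{field,finite} poly \<Rightarrow> nat \<Rightarrow> int" where
  "L_coeff D n = (\<Sum>f\<in>monic_polys n. quad_char D f)"

definition L_function :: "'a::{field,finite} poly \<Rightarrow> complex \<Rightarrow> complex" where
  "L_function D u = (\<Sum>n. of_int (L_coeff D n) * u ^ n)"

text \<open>
  The variation of the argument along a continuous curve \<open>w\<close> (parametrised by \<open>[0,1]\<close>) that
  avoids the origin: the increment of any continuous choice of argument.
\<close>

definition arg_variation :: "(real \<Rightarrow> complex) \<Rightarrow> real" where
  "arg_variation w =
     (THE v. \<exists>\<phi>. continuous_on {0..1} \<phi> \<and>
                 (\<forall>t\<in>{0..1}. w t = of_real (cmod (w t)) * cis (\<phi> t)) \<and>
                 v = \<phi> 1 - \<phi> 0)"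

definition unit_exp :: "real \<Rightarrow> complex" where
  "unit_exp x = exp (2 * of_real pi * \<i> * of_real x)"

text \<open>
  The fractional part makes the arc positively oriented for every real representative of a
  class in \<open>\<real>/\<int>\<close>.
\<close>

definition arc_then_ray :: "real \<Rightarrow> real \<Rightarrow> real \<Rightarrow> complex" where
  "arc_then_ray q \<theta> =
     part_circlepath 0 (q powr (-2)) 0 (2 * pi * frac \<theta>) +++
     linepath (of_real (q powr (-2)) * unit_exp \<theta>) (of_real (q powr (-1/2)) * unit_exp \<theta>)"

definition S_regular :: "real \<Rightarrow> 'a::{field,finite} poly \<Rightarrow> real" where
  "S_regular \<theta> D =
     - (1 / pi) * arg_variation (L_function D \<circ> arc_then_ray (real CARD('a)) \<theta>)"

text \<open>
  In the second case the limit is over points where \<open>S_regular\<close> is the relevant value, because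
  the zeros of \<open>L_function D\<close> are isolated.
\<close>

definition S_chi :: "real \<Rightarrow> 'a::{field,finite} poly \<Rightarrow> real" where
  "S_chi \<theta> D =
     (if L_function D (of_real (real CARD('a) powr (-1/2)) * unit_exp \<theta>) \<noteq> 0
      then S_regular \<theta> D
      else 1 / 2 * Lim (at 0) (\<lambda>\<epsilon>. S_regular (\<theta> - \<epsilon>) D + S_regular (\<theta> + \<epsilon>) D))"

lemma
  fixes n :: nat
  shows finite_monic_polys: "finite (monic_polys n :: 'a::{field,finite} poly set)"
    and card_monic_polys_le: "card (monic_polys n :: 'a poly set) \<le> CARD('a) ^ n"
proof -
  let ?c = "\<lambda>f::'a poly. map (coeff f) [0..<n]"
  let ?X = "{xs::'a list. set xs \<subseteq> UNIV \<and> length xs = n}"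
  have inj: "inj_on ?c (monic_polys n)"
  proof (rule inj_onI, rule poly_eqI)
    fix f g :: "'a poly" and k
    assume fg: "f \<in> monic_polys n" "g \<in> monic_polys n" "?c f = ?c g"
    show "coeff f k = coeff g k"
    proof (cases k n rule: linorder_cases)
      case less
      then show ?thesis using fg(3) by (auto simp: map_eq_conv)
    next
      case equal
      then show ?thesis using fg(1,2) by (auto simp: monic_polys_def)
    next
      case greater
      then show ?thesis using fg(1,2) by (auto simp: monic_polys_def coeff_eq_0)
    qed
  qed
  have sub: "?c ` monic_polys n \<subseteq> ?X"
    by auto
  have fin: "finite ?X"
    by (rule finite_lists_length_eq) simp
  show "finite (monic_polys n :: 'a poly set)"
    using inj sub fin by (meson inj_on_finite)
  have "card (monic_polys n :: 'a poly set) \<le> card ?X"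
    using inj sub fin by (rule card_inj_on_le)
  then show "card (monic_polys n :: 'a poly set) \<le> CARD('a) ^ n"
    using card_lists_length_eq[of "UNIV :: 'a set" n] by simp
qed

lemma abs_quad_char_le: "\<bar>quad_char D f\<bar> \<le> 1"
proof -
  have "\<bar>legendre_symbol D P ^ m\<bar> \<le> 1" for P m
    by (auto simp: legendre_symbol_def power_abs power_le_one)
  then show ?thesis
    unfolding quad_char_def jacobi_symbol_def abs_prod
    by (intro prod_le_1) auto
qed

lemma has_sum_L_function:
  fixes D :: "'a::{field,finite} poly"
  assumes u: "norm u < 1 / real CARD('a)"
  shows "((\<lambda>f. of_int (quad_char D f) * u ^ degree f) has_sum L_function D u)
           {f. lead_coeff f = 1}"
proof -
  let ?q = "real CARD('a)"
  let ?t = "\<lambda>f::'a poly. of_int (quad_char D f) * u ^ degree f"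
  let ?M = "monic_polys :: nat \<Rightarrow> 'a poly set"
  have q: "?q > 0"
    by simp
  have qu: "?q * norm u < 1"
    using u q by (simp add: field_simps)
  have t: "norm (?t f) \<le> norm u ^ degree f" for f
  proof -
    have "\<bar>of_int (quad_char D f) :: real\<bar> \<le> 1"
      using abs_quad_char_le[of D f] by linarith
    then show ?thesis
      by (simp add: norm_mult norm_power mult_left_le_one_le)
  qed
  have le: "(\<Sum>f\<in>?M n. norm (?t f)) \<le> (?q * norm u) ^ n" for n
  proof -
    have "(\<Sum>f\<in>?M n. norm (?t f)) \<le> (\<Sum>f\<in>?M n. norm u ^ n)"
      by (rule sum_mono) (use t in \<open>auto simp: monic_polys_def\<close>)
    also have "\<dots> = real (card (?M n)) * norm u ^ n"
      by simp
    also have "\<dots> \<le> ?q ^ n * norm u ^ n"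
      using card_monic_polys_le[where ?'a = 'a, of n]
      by (intro mult_right_mono) (simp_all flip: of_nat_power)
    finally show ?thesis
      by (simp add: power_mult_distrib)
  qed
  have summ: "summable (\<lambda>n. \<Sum>f\<in>?M n. norm (?t f))"
    by (rule summable_comparison_test'[OF summable_geometric[of "?q * norm u"]])
       (use le qu in \<open>auto simp: sum_nonneg\<close>)
  have "(\<lambda>n. \<Sum>f\<in>?M n. norm (?t f)) summable_on UNIV"
    using summ by (intro norm_summable_imp_summable_on) (simp add: sum_nonneg)
  then have "(\<lambda>n. \<Sum>\<^sub>\<infinity>f\<in>?M n. norm (?t f)) summable_on UNIV"
    by (simp add: finite_monic_polys)
  moreover have abs_sum_nonneg: "\<bar>\<Sum>f\<in>A. norm (?t f)\<bar> = (\<Sum>f\<in>A. norm (?t f))" for A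
    by (simp add: sum_nonneg)
  ultimately have "(\<lambda>p. norm (?t (snd p))) summable_on Sigma UNIV ?M"
    by (subst Infinite_Sum.abs_summable_on_Sigma_iff)
       (auto simp: finite_monic_polys abs_sum_nonneg)
  then have "(\<lambda>p. ?t (snd p)) summable_on Sigma UNIV ?M"
    by (rule abs_summable_summable)
  then obtain s where s: "((\<lambda>p. ?t (snd p)) has_sum s) (Sigma UNIV ?M)"
    by (auto simp: summable_on_def)
  have "((\<lambda>n. \<Sum>f\<in>?M n. ?t f) has_sum s) UNIV"
    by (rule has_sum_SigmaD[OF s]) (auto intro!: has_sum_finite finite_monic_polys)
  then have "(\<lambda>n. \<Sum>f\<in>?M n. ?t f) sums s"
    by (rule has_sum_imp_sums)
  moreover have "(\<Sum>f\<in>?M n. ?t f) = of_int (L_coeff D n) * u ^ n" for n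
  proof -
    have "(\<Sum>f\<in>?M n. ?t f) = (\<Sum>f\<in>?M n. of_int (quad_char D f) * u ^ n)"
      by (rule sum.cong) (auto simp: monic_polys_def)
    then show ?thesis
      by (simp add: L_coeff_def sum_distrib_right)
  qed
  ultimately have "s = L_function D u"
    by (simp add: L_function_def sums_iff)
  moreover have "(?t has_sum s) {f. lead_coeff f = 1}"
  proof -
    have "bij_betw snd (Sigma UNIV ?M) {f. lead_coeff f = 1}"
      by (rule bij_betwI[where g = "\<lambda>f. (degree f, f)"]) (auto simp: monic_polys_def)
    then show ?thesis
      using s has_sum_reindex_bij_betw[of snd "Sigma UNIV ?M" "{f. lead_coeff f = 1}" ?t s]
      by blast
  qed
  ultimately show ?thesis
    by simp
qed

end

theory Submission
  imports
    "HOL-Algebra.Algebraic_Closure_Type"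
    "HOL-Real_Asymp.Real_Asymp"
    Defs
begin

text \<open>
  The bound rests on the Riemann hypothesis for \<open>L(u, \<chi>\<^sub>D)\<close>, proved here by Stepanov's method.
  The symbol \<open>(D/f)\<close> is the \<open>(q-1)/2\<close>-th power of the resultant of \<open>f\<close> and \<open>D\<close>, so replacing
  \<open>f = D h + r\<close> by \<open>D h + c r\<close> with a non-square \<open>c\<close> changes its sign. Hence \<open>L\<close> is a polynomial
  \<open>\<Prod> (1 - \<alpha>\<^sub>i u)\<close> of degree less than \<open>d\<close>. The power sums \<open>\<Sum> \<alpha>\<^sub>i^n\<close> are, up to sign, the sums
  of \<open>\<Lambda>(f) \<chi>\<^sub>D(f)\<close> over \<open>f\<close> of degree \<open>n\<close>. An auxiliary polynomial that vanishes to high order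
  at all primes modulo which \<open>D^((q^n-1)/2)\<close> is \<open>1\<close> (or \<open>-1\<close>) bounds these sums by a constant
  times \<open>q^(n/2)\<close>, whence \<open>\<bar>\<alpha>\<^sub>i\<bar> \<le> q^(1/2)\<close>.

  Consequently \<open>1 - \<alpha>\<^sub>i u\<close> has positive real part along the path, and \<open>S(\<theta>, \<chi>\<^sub>D)\<close> is the sum over
  \<open>i\<close> of \<open>- Arg (1 - z\<^sub>i) / \<pi>\<close> with \<open>z\<^sub>i = \<alpha>\<^sub>i q^(-1/2) e(\<theta>)\<close>. On the unit circle this function is
  the sawtooth, which has a trigonometric majorant of degree less than \<open>M\<close> and mean \<open>1/(2M)\<close>, and
  the majorant persists inside the disc. The mean contributes at most \<open>d/(2M)\<close>, the other
  frequencies at most a constant times \<open>M q^(M/2)\<close>, and \<open>M\<close> is chosen slightly below \<open>2 log\<^sub>q d\<close>.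
\<close>

section \<open>The algebraic closure of a finite field\<close>

text \<open>The closure is used because there the resultant is a product of differences of roots, so
  that exchanging \<open>D\<close> and \<open>f\<close> (the role of quadratic reciprocity) only
  costs an explicit sign. Stepanov's method yields only upper bounds for the primes with a given
  value of the character; lower bounds follow because the values 1 and -1 together account for all
  primes of degree dividing n except divisors of \<open>D\<close>.

  The power sums are estimated twice. The square-root bound has a constant that grows with d; it
  serves to locate the zeros, where only the radius of convergence of log L matters. In the final
  estimate it would cost a multiple of d per frequency. There the trivial bound q^j is taken
  instead: after scaling by q^(-j/2) it gives q^(j/2), free of d. The requirement M q^(M/2) = o(d /
  log d) allows M close to 2 log_q d, and d/(2M) then produces the constant 1/4. What is proved
  about the zeros is an inequality, so the majorant has to hold in the closed disc and not just on
  the circle.\<close>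

definition ac_eval :: "'a::field alg_closure \<Rightarrow> 'a poly \<Rightarrow> 'a alg_closure" where
  "ac_eval x f = poly (map_poly to_ac f) x"

lemma ac_eval_0 [simp]: "ac_eval x 0 = 0"
  and ac_eval_1 [simp]: "ac_eval x 1 = 1"
  and ac_eval_pCons [simp]: "ac_eval x (pCons a f) = to_ac a + x * ac_eval x f"
  by (simp_all add: ac_eval_def map_poly_pCons)

lemma ac_eval_add [simp]: "ac_eval x (f + g) = ac_eval x f + ac_eval x g"
proof (induction f arbitrary: g)
  case (pCons a f g)
  show ?case by (cases g) (simp add: pCons.IH distrib_left add.assoc add.left_commute)
qed simp

lemma ac_eval_smult [simp]: "ac_eval x (smult c f) = to_ac c * ac_eval x f"
  by (induction f) (simp_all add: algebra_simps)

lemma ac_eval_mult [simp]: "ac_eval x (f * g) = ac_eval x f * ac_eval x g"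
  by (induction f) (simp_all add: algebra_simps)

lemma ac_eval_minus [simp]: "ac_eval x (- f) = - ac_eval x f"
  using ac_eval_smult[of x "-1" f] by (simp del: ac_eval_smult)

lemma ac_eval_diff [simp]: "ac_eval x (f - g) = ac_eval x f - ac_eval x g"
  using ac_eval_add[of x f "- g"] by (simp del: ac_eval_add)

lemma ac_eval_power [simp]: "ac_eval x (f ^ n) = ac_eval x f ^ n"
  by (induction n) simp_all

section \<open>Fermat's theorem and the Frobenius map\<close>

text \<open>Multiplication by a nonzero \<open>x\<close> permutes \<open>F - {0}\<close>; compare
  the products of all elements. The set version serves both the finite field itself and the copies
  of residue fields inside the closure.\<close>

lemma power_card_group:
  fixes F :: "'b::field set"
  assumes F: "finite F" "0 \<in> F" and mult: "\<And>x y. x \<in> F \<Longrightarrow> y \<in> F \<Longrightarrow> x * y \<in> F" and x: "x \<in> F"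
  shows "x ^ card F = x"
proof (cases "x = 0")
  case False
  let ?G = "F - {0}"
  have fin: "finite ?G" using F by simp
  have "(\<lambda>y. x * y) ` ?G \<subseteq> ?G"
    using False mult[OF x] by auto
  moreover have inj: "inj_on (\<lambda>y. x * y) ?G"
    using False by (auto intro: inj_onI)
  ultimately have img: "(\<lambda>y. x * y) ` ?G = ?G"
    using fin by (simp add: endo_inj_surj)
  have "prod id ?G = prod id ((\<lambda>y. x * y) ` ?G)"
    using img by simp
  also have "\<dots> = (\<Prod>y\<in>?G. x * y)"
    using inj by (simp add: prod.reindex)
  also have "\<dots> = x ^ card ?G * prod id ?G"
    by (simp add: prod.distrib)
  finally have "x ^ card ?G = 1"
    using fin by auto
  moreover have "card F = Suc (card ?G)"
    using F by (metis card_Suc_Diff1)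
  ultimately show ?thesis by simp
qed (use F in \<open>auto simp: card_gt_0_iff\<close>)

lemma field_power_card [simp]: "x ^ CARD('a) = x" for x :: "'a::{field,finite}"
  using power_card_group[of "UNIV :: 'a set" x] by simp

lemma field_power_card_power [simp]: "x ^ (CARD('a) ^ n) = x" for x :: "'a::{field,finite}"
  by (induction n) (simp_all add: power_mult)

text \<open>The polynomial \<open>(x + 1)^q - x^q - 1\<close> has degree less than \<open>q\<close> and vanishes on the whole field.\<close>
lemma of_nat_binomial_card_eq_0:
  assumes "0 < k" "k < CARD('a::{field,finite})"
  shows "of_nat (CARD('a) choose k) = (0 :: 'a)"
proof -
  let ?q = "CARD('a)"
  define g :: "'a poly" where "g = [:1, 1:] ^ ?q - [:0, 1:] ^ ?q - 1"
  have coeff_g: "coeff g i = (if 0 < i \<and> i < ?q then of_nat (?q choose i) else 0)" for i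
  proof -
    have "[:0, 1:] ^ ?q = (monom 1 ?q :: 'a poly)"
      by (simp add: monom_altdef)
    then show ?thesis
      by (cases "i \<le> ?q") (auto simp: g_def coeff_linear_poly_power coeff_eq_0 degree_linear_power)
  qed
  have "g = 0"
  proof (rule ccontr)
    assume "g \<noteq> 0"
    then have "card {x. poly g x = 0} \<le> degree g"
      by (rule card_poly_roots_bound)
    moreover have "poly g x = 0" for x
      by (simp add: g_def)
    moreover have "degree g \<le> ?q - 1"
      by (rule degree_le) (use coeff_g in auto)
    moreover have "?q > 0" by simp
    ultimately show False
      by (simp del: zero_less_card_finite)
  qed
  with coeff_g[of k] assms show ?thesis by simp
qed

lemma binomial_power_add:
  fixes x y :: "'b::comm_ring_1"
  assumes "q > 0" and "\<And>k. 0 < k \<Longrightarrow> k < q \<Longrightarrow> of_nat (q choose k) = (0 :: 'b)"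
  shows "(x + y) ^ q = x ^ q + y ^ q"
proof -
  have "(x + y) ^ q = (\<Sum>k\<le>q. of_nat (q choose k) * x ^ k * y ^ (q - k))"
    by (rule binomial_ring)
  also have "\<dots> = (\<Sum>k\<in>{0, q}. of_nat (q choose k) * x ^ k * y ^ (q - k))"
    using assms by (intro sum.mono_neutral_right) auto
  finally show ?thesis
    using assms(1) by (simp add: add.commute)
qed

lemma poly_power_card_power_add:
  fixes f g :: "'a::{field,finite} poly"
  shows "(f + g) ^ (CARD('a) ^ n) = f ^ (CARD('a) ^ n) + g ^ (CARD('a) ^ n)"
proof (induction n)
  case (Suc n)
  have "(f + g) ^ CARD('a) = f ^ CARD('a) + g ^ CARD('a)" for f g :: "'a poly"
    by (rule binomial_power_add) (simp_all add: of_nat_poly of_nat_binomial_card_eq_0)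
  with Suc show ?case
    by (simp add: power_mult power_Suc2 del: power_Suc)
qed simp

lemma ac_power_card_power_add:
  fixes x y :: "'a::{field,finite} alg_closure"
  shows "(x + y) ^ (CARD('a) ^ n) = x ^ (CARD('a) ^ n) + y ^ (CARD('a) ^ n)"
proof (induction n)
  case (Suc n)
  have "(x + y) ^ CARD('a) = x ^ CARD('a) + y ^ CARD('a)" for x y :: "'a alg_closure"
    by (rule binomial_power_add)
       (simp_all add: of_nat_binomial_card_eq_0 flip: to_ac_of_nat)
  with Suc show ?case
    by (simp add: power_mult power_Suc2 del: power_Suc)
qed simp

lemma ac_eval_power_card:
  fixes f :: "'a::{field,finite} poly"
  shows "ac_eval x f ^ (CARD('a) ^ n) = ac_eval (x ^ (CARD('a) ^ n)) f"
  by (induction f)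
     (simp_all add: ac_power_card_power_add power_mult_distrib
        zero_power flip: to_ac_power)

text \<open>The Frobenius map is additive and fixes the coefficients. In Stepanov's method this
  makes every polynomial in x^Q a Q-th power.\<close>

lemma poly_power_card:
  fixes f :: "'a::{field,finite} poly"
  shows "f ^ (CARD('a) ^ n) = f \<circ>\<^sub>p [:0, 1:] ^ (CARD('a) ^ n)"
proof (induction f)
  case (pCons a f)
  let ?Q = "CARD('a) ^ n"
  have "pCons a f = [:a:] + [:0, 1:] * f"
    by simp
  then have "pCons a f ^ ?Q = [:a:] ^ ?Q + [:0, 1:] ^ ?Q * f ^ ?Q"
    by (simp only: poly_power_card_power_add power_mult_distrib)
  also have "[:a:] ^ ?Q = [:a:]"
    by (simp add: poly_const_pow)
  finally show ?case
    by (simp add: pcompose_pCons pCons.IH)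
qed (simp add: zero_power)

text \<open>A condition on coefficients, unlike \<open>degree f < n\<close>, admits the zero
  polynomial for n = 0 as well, so the set has q^n elements without exception.\<close>

definition polys_below :: "nat \<Rightarrow> 'a::zero poly set" where
  "polys_below n = {f. \<forall>i\<ge>n. coeff f i = 0}"

lemma polys_below_iff_degree: "n > 0 \<Longrightarrow> f \<in> polys_below n \<longleftrightarrow> degree f < n"
  using degree_lessI[of f n] by (auto simp: polys_below_def coeff_eq_0)

lemma bij_betw_polys_below:
  "bij_betw (\<lambda>f. restrict (coeff f) {..<n}) (polys_below n) ({..<n} \<rightarrow>\<^sub>E (UNIV :: 'a::zero set))"
proof (rule bij_betwI[where g = "\<lambda>c. Abs_poly (\<lambda>i. if i < n then c i else 0)"])
  have c: "coeff (Abs_poly (\<lambda>i. if i < n then c i else 0)) = (\<lambda>i. if i < n then c i else 0)"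
    for c :: "nat \<Rightarrow> 'a"
    by (rule Abs_poly_inverse) (auto simp: MOST_nat intro!: exI[of _ n])
  show "(\<lambda>c. Abs_poly (\<lambda>i. if i < n then c i else 0)) \<in> ({..<n} \<rightarrow>\<^sub>E UNIV) \<rightarrow> (polys_below n :: 'a poly
      set)"
    by (auto simp: polys_below_def c)
  show "Abs_poly (\<lambda>i. if i < n then restrict (coeff f) {..<n} i else 0) = f"
    if "f \<in> polys_below n" for f :: "'a poly"
    using that by (intro poly_eqI) (auto simp: c polys_below_def)
  show "restrict (coeff (Abs_poly (\<lambda>i. if i < n then g i else 0))) {..<n} = g"
    if "g \<in> {..<n} \<rightarrow>\<^sub>E UNIV" for g :: "nat \<Rightarrow> 'a"
    using that by (auto simp: c restrict_def PiE_def extensional_def fun_eq_iff)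
qed auto

lemma finite_polys_below: "finite (polys_below n :: 'a::{zero,finite} poly set)"
  using bij_betw_finite[OF bij_betw_polys_below[of n, where ?'a = 'a]]
  by (simp add: finite_PiE)

lemma card_polys_below: "card (polys_below n :: 'a::{zero,finite} poly set) = CARD('a) ^ n"
  using bij_betw_same_card[OF bij_betw_polys_below[of n, where ?'a = 'a]]
  by (simp add: card_PiE)

lemma card_monic_polys: "card (monic_polys n :: 'a::{field,finite} poly set) = CARD('a) ^ n"
proof -
  have "bij_betw (\<lambda>f. monom 1 n + f) (polys_below n) (monic_polys n :: 'a poly set)"
  proof (rule bij_betwI[where g = "\<lambda>f. f - monom 1 n"])
    show "(\<lambda>f. monom 1 n + f) \<in> polys_below n \<rightarrow> (monic_polys n :: 'a poly set)"
    proof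
      fix f :: "'a poly" assume f: "f \<in> polys_below n"
      have "degree (monom 1 n + f) = n"
      proof (rule antisym)
        show "degree (monom 1 n + f) \<le> n"
          by (rule degree_le) (use f in \<open>auto simp: polys_below_def\<close>)
        show "n \<le> degree (monom 1 n + f)"
          by (rule le_degree) (use f in \<open>auto simp: polys_below_def\<close>)
      qed
      then show "monom 1 n + f \<in> monic_polys n"
        using f by (auto simp: monic_polys_def polys_below_def)
    qed
    show "(\<lambda>f. f - monom 1 n) \<in> monic_polys n \<rightarrow> (polys_below n :: 'a poly set)"
      by (auto simp: monic_polys_def polys_below_def coeff_eq_0)
  qed auto
  from bij_betw_same_card[OF this] show ?thesis
    by (simp add: card_polys_below)
qed

section \<open>Residue fields inside the closure and Euler's criterion\<close>

text \<open>A nonzero polynomial \<open>m\<close> of least degree that vanishes at \<alpha> divides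
  all others, in particular \<open>P\<close>. It is not a unit, so irreducibility makes
  \<open>P\<close> an associate of \<open>m\<close>.\<close>

lemma ac_eval_eq_0_iff_dvd:
  assumes P: "monic_irreducible P" and a: "ac_eval \<alpha> P = 0"
  shows "ac_eval \<alpha> f = 0 \<longleftrightarrow> P dvd f"
proof
  assume f: "ac_eval \<alpha> f = 0"
  define m where "m = arg_min degree (\<lambda>m. m \<noteq> 0 \<and> ac_eval \<alpha> m = 0)"
  have P0: "P \<noteq> 0" using P by (auto simp: monic_irreducible_def)
  have m: "m \<noteq> 0 \<and> ac_eval \<alpha> m = 0"
    unfolding m_def by (rule arg_min_natI[of _ P]) (use a P0 in auto)
  have m_le: "degree m \<le> degree g" if "g \<noteq> 0" "ac_eval \<alpha> g = 0" for g
    unfolding m_def by (rule arg_min_nat_le) (use that in auto)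
  have m_dvd: "m dvd g" if g: "ac_eval \<alpha> g = 0" for g
  proof (rule ccontr)
    assume nd: "\<not> m dvd g"
    have "ac_eval \<alpha> (g - m * (g div m)) = 0"
      using g m by simp
    then have "ac_eval \<alpha> (g mod m) = 0"
      by (simp add: minus_mult_div_eq_mod)
    moreover have "g mod m \<noteq> 0" using nd by (simp add: mod_eq_0_iff_dvd)
    ultimately have "degree m \<le> degree (g mod m)" by (rule m_le[rotated])
    with degree_mod_less_degree[of m g] m nd show False by simp
  qed
  have "m dvd P" by (rule m_dvd[OF a])
  then obtain c where c: "P = m * c" by (elim dvdE)
  have "\<not> m dvd 1"
  proof
    assume "m dvd 1"
    then obtain k where "1 = m * k" by (elim dvdE)
    then have "ac_eval \<alpha> 1 = ac_eval \<alpha> m * ac_eval \<alpha> k" by (metis ac_eval_mult)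
    with m show False by simp
  qed
  then have "c dvd 1"
    using P c by (auto simp: monic_irreducible_def irreducible_def)
  then have "P dvd m" using c by (metis dvd_refl mult_dvd_mono mult.right_neutral)
  then show "P dvd f" using m_dvd[OF f] by (rule dvd_trans)
next
  assume "P dvd f"
  then show "ac_eval \<alpha> f = 0" using a by (auto elim!: dvdE)
qed

lemma monic_irreducible_root_exists:
  assumes "monic_irreducible P"
  obtains \<alpha> where "ac_eval \<alpha> P = 0"
proof -
  have "degree (map_poly to_ac P) = degree P"
    by (rule degree_map_poly) (use assms in \<open>auto simp: monic_irreducible_def\<close>)
  with assms show ?thesis
    using alg_closed_imp_poly_has_root[of "map_poly to_ac P"] that
    by (auto simp: monic_irreducible_def ac_eval_def)
qed

lemma monic_irreducible_nonzero [simp]: "monic_irreducible P \<Longrightarrow> P \<noteq> 0"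
  and monic_irreducible_degree_pos: "monic_irreducible P \<Longrightarrow> degree P > 0"
  by (auto simp: monic_irreducible_def)

lemma card_field_gt_1: "CARD('a::{field,finite}) > 1"
  using card_mono[of UNIV "{0, 1 :: 'a}"] by auto

lemma power_fixed_points:
  assumes "m > 1"
  shows finite_power_fixed_points: "finite {x :: 'b::field. x ^ m = x}"
    and card_power_fixed_points_le: "card {x :: 'b. x ^ m = x} \<le> m"
proof -
  define p :: "'b poly" where "p = monom 1 m - [:0, 1:]"
  have "coeff p m = 1"
    using assms by (cases m) (auto simp: p_def coeff_pCons split: nat.split)
  then have p0: "p \<noteq> 0" by auto
  have roots: "{x. poly p x = 0} = {x. x ^ m = x}"
    by (auto simp: p_def poly_monom)
  have "degree p \<le> m"
    unfolding p_def using assms by (intro degree_diff_le) (auto simp: degree_monom_eq)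
  then show "card {x :: 'b. x ^ m = x} \<le> m"
    using card_poly_roots_bound[OF p0] by (simp add: roots)
  show "finite {x :: 'b. x ^ m = x}"
    using poly_roots_finite[OF p0] by (simp add: roots)
qed

text \<open>Reduction modulo \<open>P\<close> shows that the remainders already give all values at
  \<alpha>, and distinct remainders give distinct values. The resulting q^n elements (n the degree
  of \<open>P\<close>) satisfy x^(q^n) = x, an equation with at most q^n solutions; so they are all
  of them.\<close>

lemma residue_field:
  fixes P :: "'a::{field,finite} poly"
  assumes P: "monic_irreducible P" and \<alpha>: "ac_eval \<alpha> P = 0"
  defines "F \<equiv> ac_eval \<alpha> ` polys_below (degree P)"
  shows range_ac_eval: "range (ac_eval \<alpha>) = F"
    and card_residue_field: "card F = CARD('a) ^ degree P"
    and residue_field_eq: "F = {x. x ^ (CARD('a) ^ degree P) = x}"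
proof -
  let ?Q = "CARD('a) ^ degree P"
  note d = monic_irreducible_degree_pos[OF P]
  have "ac_eval \<alpha> f \<in> F" for f
  proof -
    have "ac_eval \<alpha> (f - P * (f div P)) = ac_eval \<alpha> f"
      using \<alpha> by simp
    then have "ac_eval \<alpha> (f mod P) = ac_eval \<alpha> f"
      by (simp add: minus_mult_div_eq_mod)
    moreover have "f mod P \<in> polys_below (degree P)"
      using degree_mod_less[of P f] P d by (auto simp: polys_below_iff_degree)
    ultimately show ?thesis unfolding F_def by (metis image_eqI)
  qed
  then show range: "range (ac_eval \<alpha>) = F"
    by (auto simp: F_def)
  have "inj_on (ac_eval \<alpha>) (polys_below (degree P))"
  proof (rule inj_onI)
    fix f g assume fg: "f \<in> polys_below (degree P)" "g \<in> polys_below (degree P)"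
      "ac_eval \<alpha> f = ac_eval \<alpha> g"
    then have "P dvd f - g"
      using ac_eval_eq_0_iff_dvd[OF P \<alpha>, of "f - g"] by simp
    moreover have "degree (f - g) < degree P"
      using fg d by (simp add: polys_below_iff_degree degree_diff_less)
    ultimately show "f = g"
      by (metis dvd_imp_degree_le eq_iff_diff_eq_0 linorder_not_le)
  qed
  then show card: "card F = ?Q"
    unfolding F_def by (simp add: card_image card_polys_below)
  have fin: "finite F"
    by (simp add: F_def finite_polys_below)
  have mult: "x * y \<in> F" if "x \<in> F" "y \<in> F" for x y
    using that unfolding range[symmetric] by (auto simp flip: ac_eval_mult)
  have "0 \<in> F"
    unfolding range[symmetric] by (rule range_eqI[of _ _ 0]) simp
  then have sub: "F \<subseteq> {x. x ^ ?Q = x}"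
    using power_card_group[OF fin _ mult] card by auto
  have "?Q > 1"
    using d card_field_gt_1[where ?'a = 'a] by (intro one_less_power)
  from power_fixed_points[OF this, where ?'b = "'a alg_closure"]
  show "F = {x. x ^ ?Q = x}"
    using sub card by (intro card_seteq) auto
qed

lemma root_power_card_power:
  fixes P :: "'a::{field,finite} poly"
  assumes P: "monic_irreducible P" and \<alpha>: "ac_eval \<alpha> P = 0" and n: "degree P dvd n"
  shows "\<alpha> ^ (CARD('a) ^ n) = \<alpha>"
proof -
  let ?Q = "CARD('a) ^ degree P"
  have "\<alpha> = ac_eval \<alpha> [:0, 1:]" by simp
  then have "\<alpha> \<in> range (ac_eval \<alpha>)" by blast
  then have *: "\<alpha> ^ ?Q = \<alpha>"
    using residue_field[OF P \<alpha>] by auto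
  obtain k where n: "n = degree P * k" using n by (elim dvdE)
  have "\<alpha> ^ (?Q ^ k) = \<alpha>"
    by (induction k) (simp_all add: power_mult *)
  then show ?thesis by (simp add: n power_mult)
qed

lemma monic_irreducible_dvd_power_card:
  fixes P :: "'a::{field,finite} poly"
  assumes P: "monic_irreducible P" and n: "degree P dvd n"
  shows "P dvd [:0, 1:] - [:0, 1:] ^ (CARD('a) ^ n)"
proof -
  obtain \<alpha> where \<alpha>: "ac_eval \<alpha> P = 0" using monic_irreducible_root_exists[OF P] .
  show ?thesis
    using root_power_card_power[OF P \<alpha> n] by (simp flip: ac_eval_eq_0_iff_dvd[OF P \<alpha>])
qed

lemma odd_card_two_neq_0:
  assumes "odd CARD('a::{field,finite})"
  shows "(2 :: 'a) \<noteq> 0"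
proof
  assume t: "(2 :: 'a) = 0"
  have "of_nat (CARD('a) choose 1) = (0 :: 'a)"
    using card_field_gt_1 by (intro of_nat_binomial_card_eq_0) auto
  moreover obtain k where "CARD('a) = 2 * k + 1" using assms by (elim oddE)
  ultimately show False using t by simp
qed

text \<open>The closure supplies a square root z of y = D(\<alpha>). It lies in the residue field
  exactly when z^Q = z, that is, when y^((Q-1)/2) = 1; hence cyclicity of the unit group does not
  enter.\<close>

lemma euler_criterion:
  fixes P :: "'a::{field,finite} poly"
  assumes P: "monic_irreducible P" and \<alpha>: "ac_eval \<alpha> P = 0" and odd: "odd CARD('a)"
  shows "ac_eval \<alpha> D ^ ((CARD('a) ^ degree P - 1) div 2) = of_int (legendre_symbol D P)"
proof -
  let ?Q = "CARD('a) ^ degree P"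
  note F = residue_field[OF P \<alpha>]
  note dvd = ac_eval_eq_0_iff_dvd[OF P \<alpha>]
  have d: "degree P > 0" using P by (rule monic_irreducible_degree_pos)
  obtain h where h: "?Q = 2 * h + 1"
    using odd by (metis even_power oddE)
  have "?Q > 1"
    using d card_field_gt_1[where ?'a = 'a] by (intro one_less_power)
  then have h0: "h > 0" using h by (cases h) auto
  define y where "y = ac_eval \<alpha> D"
  have yQ: "y ^ ?Q = y"
    using F unfolding y_def by blast
  show ?thesis
  proof (cases "P dvd D")
    case True
    then show ?thesis using h0 h dvd by (simp add: legendre_symbol_def zero_power)
  next
    case False
    then have y0: "y \<noteq> 0" by (simp add: y_def dvd)
    have "y ^ (2 * h) = 1" using yQ y0 by (simp add: h)
    then have pm: "y ^ h = 1 \<or> y ^ h = -1"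
      by (simp add: power_mult power2_eq_1_iff mult.commute[of 2])
    have two: "(1 :: 'a alg_closure) \<noteq> -1"
      using odd_card_two_neq_0[OF odd]
      by (metis add.right_inverse one_add_one to_ac_eq_0_iff to_ac_numeral)
    have "(\<exists>g. P dvd (g ^ 2 - D)) \<longleftrightarrow> y ^ h = 1"
    proof
      assume "\<exists>g. P dvd (g ^ 2 - D)"
      then obtain g where "P dvd (g ^ 2 - D)" ..
      then have "y = ac_eval \<alpha> g ^ 2"
        by (simp add: y_def flip: dvd)
      moreover have "ac_eval \<alpha> g ^ ?Q = ac_eval \<alpha> g" using F by blast
      moreover have "ac_eval \<alpha> g \<noteq> 0" using y0 calculation by auto
      ultimately show "y ^ h = 1"
        by (simp add: h flip: power_mult)
    next
      assume y1: "y ^ h = 1"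
      obtain z where z: "z ^ 2 = y"
        using nth_root_exists[of 2 y] by auto
      have "z ^ ?Q = z * (z ^ 2) ^ h" by (simp add: h power_mult)
      also have "\<dots> = z" by (simp add: z y1)
      finally have "z \<in> range (ac_eval \<alpha>)" using F by blast
      then obtain g where "z = ac_eval \<alpha> g" by blast
      with z have "ac_eval \<alpha> (g ^ 2 - D) = 0" by (simp add: y_def)
      then have "P dvd g ^ 2 - D" unfolding dvd .
      then show "\<exists>g. P dvd (g ^ 2 - D)" ..
    qed
    then show ?thesis
      using False pm by (auto simp: legendre_symbol_def h simp flip: y_def)
  qed
qed

section \<open>Roots with multiplicity\<close>

definition ac_roots :: "'a::field poly \<Rightarrow> 'a alg_closure multiset" where
  "ac_roots f = proots (map_poly to_ac f)"

lemma map_poly_to_ac_mult: "map_poly to_ac (f * g) = map_poly to_ac f * map_poly to_ac g"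
  by (rule poly_eqI) (simp add: coeff_map_poly coeff_mult to_ac_sum)

lemma map_poly_to_ac_eq_0_iff [simp]: "map_poly to_ac f = 0 \<longleftrightarrow> f = 0"
  by (auto simp: poly_eq_iff coeff_map_poly)

lemma degree_map_poly_to_ac [simp]: "degree (map_poly to_ac f) = degree f"
  by (rule degree_map_poly) auto

lemma ac_roots_mult: "f \<noteq> 0 \<Longrightarrow> g \<noteq> 0 \<Longrightarrow> ac_roots (f * g) = ac_roots f + ac_roots g"
  by (simp add: ac_roots_def map_poly_to_ac_mult proots_mult)

lemma ac_roots_1 [simp]: "ac_roots 1 = {#}"
  by (simp add: ac_roots_def)

lemma proots_linear_factors: "proots (\<Prod>x\<in>#A. [:- x, 1 :: 'b::field:]) = A"
proof (induction A)
  case (add x A)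
  have "(\<Prod>x\<in>#A. [:- x, 1 :: 'b:]) \<noteq> 0"
    by (auto simp: prod_mset_zero_iff)
  with add show ?case by (simp add: proots_mult del: mult_pCons_left)
qed simp

lemma ac_roots_factorization:
  fixes f :: "'a::field poly"
  assumes "lead_coeff f = 1"
  shows "map_poly to_ac f = (\<Prod>x\<in>#ac_roots f. [:-x, 1:])" and "size (ac_roots f) = degree f"
proof -
  have f0: "map_poly to_ac f \<noteq> 0" using assms by auto
  obtain A where A: "size A = degree f" "map_poly to_ac f = (\<Prod>x\<in>#A. [:-x, 1:])"
    using alg_closed_imp_factorization[OF f0] assms
    by (auto simp: coeff_map_poly)
  have "ac_roots f = A"
    unfolding ac_roots_def A(2) by (rule proots_linear_factors)
  with A show "map_poly to_ac f = (\<Prod>x\<in>#ac_roots f. [:-x, 1:])" "size (ac_roots f) = degree f"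
    by simp_all
qed

lemma ac_eval_prod_ac_roots:
  assumes "lead_coeff f = 1"
  shows "ac_eval x f = (\<Prod>y\<in>#ac_roots f. x - y)"
  unfolding ac_eval_def ac_roots_factorization(1)[OF assms]
  by (simp add: poly_prod_mset image_mset.compositionality o_def)

lemma set_ac_roots: "f \<noteq> 0 \<Longrightarrow> set_mset (ac_roots f) = {x. ac_eval x f = 0}"
  by (simp add: ac_roots_def ac_eval_def)

text \<open>The conjugates are distinct: equality of two of them, raised to a suitable power of q,
  makes \<alpha> a fixed point of the q^m-th power with 0 < m < n. Then all q^n elements of the
  residue field are fixed points, more than the equation x^(q^m) = x permits. Being n in number, the
  conjugates exhaust the roots.\<close>

lemma ac_roots_monic_irreducible:
  fixes P :: "'a::{field,finite} poly"
  assumes P: "monic_irreducible P" and \<alpha>: "ac_eval \<alpha> P = 0"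
  shows "ac_roots P = image_mset (\<lambda>i. \<alpha> ^ (CARD('a) ^ i)) (mset_set {..<degree P})"
proof -
  let ?q = "CARD('a)" and ?n = "degree P"
  let ?r = "\<lambda>i. \<alpha> ^ (?q ^ i)"
  note F = residue_field[OF P \<alpha>]
  have q1: "?q > 1" by (rule card_field_gt_1)
  have inj: "inj_on ?r {..<?n}"
  proof (rule linorder_inj_onI)
    fix i j assume ij: "i < j" "i \<in> {..<?n}" "j \<in> {..<?n}"
    show "?r i \<noteq> ?r j"
    proof
      assume eq: "?r i = ?r j"
      let ?m = "?n + i - j"
      have "?r i ^ (?q ^ (?n - j)) = \<alpha> ^ (?q ^ ?m)"
        using ij by (simp add: add.commute flip: power_mult power_add)
      moreover have "?r j ^ (?q ^ (?n - j)) = \<alpha> ^ (?q ^ ?n)"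
        using ij by (simp flip: power_mult power_add)
      ultimately have am: "\<alpha> ^ (?q ^ ?m) = \<alpha>"
        using eq root_power_card_power[OF P \<alpha>, of ?n] by simp
      have "x ^ (?q ^ ?m) = x" if "x ^ (?q ^ ?n) = x" for x :: "'a alg_closure"
      proof -
        from that obtain f where "x = ac_eval \<alpha> f" using F by blast
        then show ?thesis by (simp add: ac_eval_power_card am)
      qed
      then have sub: "{x :: 'a alg_closure. x ^ (?q ^ ?n) = x} \<subseteq> {x. x ^ (?q ^ ?m) = x}" by blast
      have "?m > 0" using ij by auto
      then have "?q ^ ?m > 1" using q1 by (rule one_less_power[rotated])
      from power_fixed_points[OF this, where ?'b = "'a alg_closure"]
      have "?q ^ ?n \<le> ?q ^ ?m"
        using card_mono[OF _ sub] F by auto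
      moreover have "?q ^ ?m < ?q ^ ?n"
        using ij q1 by (intro power_strict_increasing) auto
      ultimately show False by simp
    qed
  qed auto
  have "ac_eval (?r i) P = 0" for i
    by (simp add: \<alpha> zero_power flip: ac_eval_power_card)
  then have "?r ` {..<?n} \<subseteq> set_mset (ac_roots P)"
    using P by (auto simp: set_ac_roots)
  then have sub: "mset_set (?r ` {..<?n}) \<subseteq># ac_roots P"
    by (meson finite_set_mset mset_set_set_mset_msubset msubset_mset_set_iff subset_mset.order_trans
      finite_subset)
  moreover have "size (mset_set (?r ` {..<?n})) = size (ac_roots P)"
    using inj P by (simp add: ac_roots_factorization(2) monic_irreducible_def card_image)
  ultimately have "mset_set (?r ` {..<?n}) = ac_roots P"
    by (metis mset_subset_size nless_le subset_mset.nless_le)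
  then show ?thesis
    using inj by (simp add: image_mset_mset_set)
qed

section \<open>Factorization into monic irreducibles\<close>

lemma monic_irreducible_prime_elem: "monic_irreducible P \<Longrightarrow> prime_elem P"
  by (simp add: monic_irreducible_def field_poly_irreducible_imp_prime)

lemma monic_irreducible_dvd_eq:
  assumes P: "monic_irreducible P" and Q: "monic_irreducible Q" and "P dvd Q"
  shows "P = Q"
proof -
  obtain c where c: "Q = P * c" using assms(3) by (elim dvdE)
  have "\<not> P dvd 1" using P by (auto simp: monic_irreducible_def irreducible_def)
  then have "c dvd 1" using Q c by (auto simp: monic_irreducible_def irreducible_def)
  then obtain k where k: "c = [:k:]" by (auto simp: is_unit_poly_iff)
  have "lead_coeff Q = lead_coeff P * k"
    by (simp add: c k lead_coeff_mult)
  then have "k = 1" using P Q by (simp add: monic_irreducible_def)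
  then show ?thesis by (simp add: c k one_pCons)
qed

lemma poly_multiplicity_eqI:
  assumes P: "monic_irreducible P" and h: "\<not> P dvd h"
  shows "poly_multiplicity P (P ^ a * h) = a"
proof -
  have "{k. P ^ k dvd P ^ a * h} = {..a}"
  proof safe
    fix k assume k: "P ^ k dvd P ^ a * h"
    show "k \<le> a"
    proof (rule ccontr)
      assume "\<not> k \<le> a"
      then have "P ^ Suc a dvd P ^ a * h"
        using k by (meson dvd_trans le_imp_power_dvd not_less_eq_eq)
      then have "P ^ a * P dvd P ^ a * h" by (simp add: mult.commute)
      with P h show False by simp
    qed
  next
    fix k assume "k \<le> a"
    then show "P ^ k dvd P ^ a * h"
      by (intro dvd_mult2 le_imp_power_dvd)
  qed
  moreover have "Max {..a} = a" by (rule Max_eqI) auto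
  ultimately show ?thesis by (simp add: poly_multiplicity_def)
qed

lemma poly_multiplicity_decompose:
  assumes P: "monic_irreducible P" and f: "f \<noteq> 0"
  obtains h where "f = P ^ poly_multiplicity P f * h" "\<not> P dvd h"
proof -
  have "\<exists>a h. f = P ^ a * h \<and> \<not> P dvd h"
    using f
  proof (induction "degree f" arbitrary: f rule: less_induct)
    case less
    show ?case
    proof (cases "P dvd f")
      case True
      then obtain g where g: "f = P * g" by (elim dvdE)
      with less.prems have "g \<noteq> 0" by auto
      then have "degree g < degree f"
        using P monic_irreducible_degree_pos[OF P] by (simp add: g degree_mult_eq)
      with less.hyps[of g] \<open>g \<noteq> 0\<close> obtain a h where "g = P ^ a * h" "\<not> P dvd h" by blast
      then show ?thesis by (intro exI[of _ "Suc a"] exI[of _ h]) (simp add: g mult.assoc)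
    next
      case False
      then show ?thesis by (intro exI[of _ 0] exI[of _ f]) simp
    qed
  qed
  then show ?thesis using that poly_multiplicity_eqI[OF P] by metis
qed

lemma power_dvd_iff_le_poly_multiplicity:
  assumes P: "monic_irreducible P" and f: "f \<noteq> 0"
  shows "P ^ k dvd f \<longleftrightarrow> k \<le> poly_multiplicity P f"
proof -
  obtain h where h: "f = P ^ poly_multiplicity P f * h" "\<not> P dvd h"
    using poly_multiplicity_decompose[OF P f] .
  show ?thesis
  proof
    assume k: "P ^ k dvd f"
    show "k \<le> poly_multiplicity P f"
    proof (rule ccontr)
      assume *: "\<not> k \<le> poly_multiplicity P f"
      have "P ^ Suc (poly_multiplicity P f) dvd f"
        using k * by (meson dvd_trans le_imp_power_dvd not_less_eq_eq)
      then have "P ^ poly_multiplicity P f * P dvd P ^ poly_multiplicity P f * h"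
        using h(1) by (simp add: mult.commute)
      with P h(2) show False by simp
    qed
  next
    assume "k \<le> poly_multiplicity P f"
    then show "P ^ k dvd f" by (subst h(1)) (intro dvd_mult2 le_imp_power_dvd)
  qed
qed

lemma poly_multiplicity_mult:
  assumes P: "monic_irreducible P" and "f \<noteq> 0" "g \<noteq> 0"
  shows "poly_multiplicity P (f * g) = poly_multiplicity P f + poly_multiplicity P g"
proof -
  obtain h where h: "f = P ^ poly_multiplicity P f * h" "\<not> P dvd h"
    using poly_multiplicity_decompose[OF P \<open>f \<noteq> 0\<close>] .
  obtain k where k: "g = P ^ poly_multiplicity P g * k" "\<not> P dvd k"
    using poly_multiplicity_decompose[OF P \<open>g \<noteq> 0\<close>] .
  have "f * g = P ^ (poly_multiplicity P f + poly_multiplicity P g) * (h * k)"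
    by (subst h(1), subst k(1)) (simp add: power_add mult_ac)
  moreover have "\<not> P dvd h * k"
    using h k monic_irreducible_prime_elem[OF P] by (simp add: prime_elem_dvd_mult_iff)
  ultimately show ?thesis using poly_multiplicity_eqI[OF P] by metis
qed

lemma poly_multiplicity_eq_0_iff:
  assumes "monic_irreducible P" "f \<noteq> 0"
  shows "poly_multiplicity P f = 0 \<longleftrightarrow> \<not> P dvd f"
  using power_dvd_iff_le_poly_multiplicity[OF assms, of 1] by auto

lemma monic_irreducible_factor_exists:
  fixes f :: "'a::field poly"
  assumes "degree f > 0"
  obtains P where "monic_irreducible P" "P dvd f"
proof -
  define P where "P = arg_min degree (\<lambda>g. lead_coeff g = 1 \<and> degree g > 0 \<and> g dvd f)"
  have f0: "f \<noteq> 0" using assms by auto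
  have "lead_coeff P = 1 \<and> degree P > 0 \<and> P dvd f"
    unfolding P_def
    by (rule arg_min_natI[of _ "smult (inverse (lead_coeff f)) f"])
       (use assms f0 in \<open>auto simp: smult_dvd_iff\<close>)
  moreover have min: "degree P \<le> degree g" if "lead_coeff g = 1" "degree g > 0" "g dvd f" for g
    unfolding P_def by (rule arg_min_nat_le) (use that in auto)
  have "irreducible P"
  proof (rule irreducibleI)
    show P0: "P \<noteq> 0" using calculation by auto
    then show "\<not> P dvd 1" using calculation is_unit_iff_degree[of P] by auto
    fix a b assume ab: "P = a * b"
    then have ab0: "a \<noteq> 0" "b \<noteq> 0" using P0 by auto
    show "a dvd 1 \<or> b dvd 1"
    proof (rule ccontr)
      assume "\<not> (a dvd 1 \<or> b dvd 1)"
      then have deg: "degree a > 0" "degree b > 0"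
        using ab0 by (auto simp: is_unit_iff_degree)
      have "degree P \<le> degree (smult (inverse (lead_coeff a)) a)"
        by (rule min) (use ab ab0 deg calculation in \<open>auto simp: smult_dvd_iff\<close>)
      then show False using ab ab0 deg by (simp add: degree_mult_eq)
    qed
  qed
  ultimately show ?thesis by (intro that[of P]) (auto simp: monic_irreducible_def)
qed

definition monic_factors :: "'a::field poly \<Rightarrow> 'a poly set" where
  "monic_factors f = {P. monic_irreducible P \<and> P dvd f}"

text \<open>The induction removes the full power of one prime factor at a time, so the
  multiplicities of the remaining primes do not change.\<close>

lemma monic_factorization:
  fixes f :: "'a::field poly"
  assumes "lead_coeff f = 1"
  shows finite_monic_factors: "finite (monic_factors f)"
    and prod_monic_factors: "f = (\<Prod>P\<in>monic_factors f. P ^ poly_multiplicity P f)"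
proof -
  have "finite (monic_factors f) \<and> f = (\<Prod>P\<in>monic_factors f. P ^ poly_multiplicity P f)"
    using assms
  proof (induction "degree f" arbitrary: f rule: less_induct)
    case less
    have f0: "f \<noteq> 0" using less.prems by auto
    show ?case
    proof (cases "degree f = 0")
      case True
      then have f1: "f = 1" using less.prems
        by (metis degree_0_id lead_coeff_1 monom_0 one_pCons degree_eq_zeroE coeff_pCons_0)
      have "monic_factors f = {}"
        unfolding f1 by (auto simp: monic_factors_def monic_irreducible_def irreducible_def)
      with f1 show ?thesis by simp
    next
      case False
      then obtain P where P: "monic_irreducible P" "P dvd f"
        using monic_irreducible_factor_exists by blast
      obtain g where g: "f = P ^ poly_multiplicity P f * g" "\<not> P dvd g"
        using poly_multiplicity_decompose[OF P(1) f0] .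
      let ?e = "poly_multiplicity P f"
      have e0: "?e > 0" using P f0 by (metis poly_multiplicity_eq_0_iff gr0I)
      have g0: "g \<noteq> 0" using f0 g by auto
      have lg: "lead_coeff g = 1"
      proof -
        have "lead_coeff f = lead_coeff P ^ ?e * lead_coeff g"
          using arg_cong[OF g(1), of lead_coeff] by (simp only: lead_coeff_mult lead_coeff_power)
        then show ?thesis using less.prems P by (simp add: monic_irreducible_def)
      qed
      have "degree f = ?e * degree P + degree g"
        by (subst g(1)) (use P g0 in \<open>simp add: degree_mult_eq degree_power_eq\<close>)
      then have "degree g < degree f"
        using e0 monic_irreducible_degree_pos[OF P(1)] by simp
      with less.hyps lg have IH: "finite (monic_factors g)"
        "g = (\<Prod>P\<in>monic_factors g. P ^ poly_multiplicity P g)" by blast+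
      have dvd: "Q dvd f \<longleftrightarrow> Q = P \<or> Q dvd g" if Q: "monic_irreducible Q" for Q
      proof -
        have "Q dvd f \<longleftrightarrow> Q dvd P ^ ?e \<or> Q dvd g"
          by (subst g(1)) (rule prime_elem_dvd_mult_iff[OF monic_irreducible_prime_elem[OF Q]])
        also have "Q dvd P ^ ?e \<longleftrightarrow> Q dvd P"
          using prime_elem_dvd_power_iff[OF monic_irreducible_prime_elem[OF Q]] e0 by blast
        also have "Q dvd P \<longleftrightarrow> Q = P" using monic_irreducible_dvd_eq[OF Q P(1)] by auto
        finally show ?thesis .
      qed
      have fac: "monic_factors f = insert P (monic_factors g)"
        using P dvd by (auto simp: monic_factors_def)
      have "poly_multiplicity Q f = poly_multiplicity Q g" if "Q \<in> monic_factors g" for Q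
      proof -
        have Q: "monic_irreducible Q" using that by (simp add: monic_factors_def)
        have "\<not> Q dvd P ^ ?e"
          using that g(2) monic_irreducible_dvd_eq[OF Q P(1)]
            prime_elem_dvd_power_iff[OF monic_irreducible_prime_elem[OF Q], of P]
          by (auto simp: monic_factors_def)
        then have "poly_multiplicity Q (P ^ ?e) = 0"
          using Q P by (subst poly_multiplicity_eq_0_iff) auto
        then show ?thesis
          by (subst g(1)) (use Q P g0 in \<open>simp add: poly_multiplicity_mult\<close>)
      qed
      moreover have P_notin: "P \<notin> monic_factors g"
        using g(2) by (simp add: monic_factors_def)
      ultimately have "(\<Prod>P\<in>monic_factors f. P ^ poly_multiplicity P f)
          = P ^ ?e * (\<Prod>P\<in>monic_factors g. P ^ poly_multiplicity P g)"
        unfolding fac using IH(1) P_notin by simp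
      also have "\<dots> = f" using IH(2) g(1) by simp
      finally show ?thesis using fac IH(1) by simp
    qed
  qed
  then show "finite (monic_factors f)" "f = (\<Prod>P\<in>monic_factors f. P ^ poly_multiplicity P f)"
    by blast+
qed

lemma degree_eq_sum_monic_factors:
  fixes f :: "'a::field poly"
  assumes "lead_coeff f = 1"
  shows "degree f = (\<Sum>P\<in>monic_factors f. degree P * poly_multiplicity P f)"
proof -
  have "degree f = degree (\<Prod>P\<in>monic_factors f. P ^ poly_multiplicity P f)"
    using prod_monic_factors[OF assms] by simp
  also have "\<dots> = (\<Sum>P\<in>monic_factors f. degree (P ^ poly_multiplicity P f))"
    by (rule degree_prod_eq_sum_degree) (auto simp: monic_factors_def)
  also have "\<dots> = (\<Sum>P\<in>monic_factors f. degree P * poly_multiplicity P f)"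
    by (rule sum.cong) (auto simp: monic_factors_def degree_power_eq)
  finally show ?thesis .
qed

section \<open>Resultants and the vanishing of high coefficients\<close>

text \<open>For monic \<open>f\<close> this is the resultant of \<open>f\<close> and
  \<open>g\<close>.\<close>

definition ac_res :: "'a::field poly \<Rightarrow> 'a poly \<Rightarrow> 'a alg_closure" where
  "ac_res f g = (\<Prod>x\<in>#ac_roots f. ac_eval x g)"

lemma ac_res_1 [simp]: "ac_res 1 g = 1"
  by (simp add: ac_res_def)

lemma ac_res_mult: "f \<noteq> 0 \<Longrightarrow> g \<noteq> 0 \<Longrightarrow> ac_res (f * g) h = ac_res f h * ac_res g h"
  by (simp add: ac_res_def ac_roots_mult)

lemma ac_res_power: "f \<noteq> 0 \<Longrightarrow> ac_res (f ^ n) h = ac_res f h ^ n"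
  by (induction n) (simp_all add: ac_res_mult)

lemma ac_res_prod:
  "finite A \<Longrightarrow> (\<And>x. x \<in> A \<Longrightarrow> f x \<noteq> 0) \<Longrightarrow> ac_res (prod f A) h = (\<Prod>x\<in>A. ac_res (f x) h)"
  by (induction A rule: finite_induct) (simp_all add: ac_res_mult)

lemma geometric_sum_nat: "(\<Sum>i<n. (Suc k) ^ i) * k + 1 = Suc k ^ n"
  by (induction n) (simp_all add: algebra_simps)

text \<open>The roots of \<open>P\<close> are conjugate, so the resultant is the norm D(\<alpha>)^(1
  + q + ... + q^(n-1)). Its (q-1)/2-th power has exponent (q^n - 1)/2, to which Euler's criterion
  applies.\<close>

lemma ac_res_monic_irreducible:
  fixes P :: "'a::{field,finite} poly"
  assumes P: "monic_irreducible P" and odd: "odd CARD('a)"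
  shows "ac_res P D ^ (CARD('a) div 2) = of_int (legendre_symbol D P)"
proof -
  let ?q = "CARD('a)" and ?n = "degree P"
  obtain \<alpha> where \<alpha>: "ac_eval \<alpha> P = 0" using monic_irreducible_root_exists[OF P] .
  obtain h where h: "?q = 2 * h + 1" using odd by (elim oddE)
  have "ac_res P D = (\<Prod>i<?n. ac_eval (\<alpha> ^ (?q ^ i)) D)"
    by (simp add: ac_res_def ac_roots_monic_irreducible[OF P \<alpha>] image_mset.compositionality o_def
        prod_unfold_prod_mset)
  also have "\<dots> = ac_eval \<alpha> D ^ (\<Sum>i<?n. ?q ^ i)"
    by (simp add: power_sum flip: ac_eval_power_card)
  finally have "ac_res P D ^ h = ac_eval \<alpha> D ^ ((\<Sum>i<?n. ?q ^ i) * h)"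
    by (simp add: power_mult)
  also have "(\<Sum>i<?n. ?q ^ i) * h = (?q ^ ?n - 1) div 2"
    using geometric_sum_nat[of "2 * h" ?n] by (simp add: h)
  finally show ?thesis
    using euler_criterion[OF P \<alpha> odd, of D] by (simp add: h)
qed

lemma quad_char_eq_ac_res:
  fixes f :: "'a::{field,finite} poly"
  assumes odd: "odd CARD('a)" and f: "lead_coeff f = 1"
  shows "of_int (quad_char D f) = ac_res f D ^ (CARD('a) div 2)"
proof -
  have "ac_res f D = ac_res (\<Prod>P\<in>monic_factors f. P ^ poly_multiplicity P f) D"
    using prod_monic_factors[OF f] by simp
  also have "\<dots> = (\<Prod>P\<in>monic_factors f. ac_res P D ^ poly_multiplicity P f)"
    using finite_monic_factors[OF f]
    by (subst ac_res_prod) (auto simp: monic_factors_def ac_res_power intro!: prod.cong)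
  finally have "ac_res f D ^ (CARD('a) div 2) =
      (\<Prod>P\<in>monic_factors f. (ac_res P D ^ (CARD('a) div 2)) ^ poly_multiplicity P f)"
    by (simp add: prod_power_distrib mult.commute flip: power_mult)
  also have "\<dots> = (\<Prod>P\<in>monic_factors f. of_int (legendre_symbol D P) ^ poly_multiplicity P f)"
    by (rule prod.cong) (simp_all add: ac_res_monic_irreducible odd monic_factors_def)
  also have "\<dots> = of_int (quad_char D f)"
    by (simp add: quad_char_def jacobi_symbol_def monic_factors_def)
  finally show ?thesis by simp
qed

text \<open>In odd characteristic -1, 0 and 1 stay distinct, so identities between symbols may be
  checked in the closure.\<close>

lemma of_int_alg_closure_eq_imp:
  assumes odd: "odd CARD('a::{field,finite})"
    and eq: "of_int a = (of_int b :: 'a alg_closure)" and "\<bar>a\<bar> \<le> 1" "\<bar>b\<bar> \<le> 1"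
  shows "a = b"
proof -
  have two: "(2 :: 'a alg_closure) \<noteq> 0"
    using odd_card_two_neq_0[OF odd] by (metis to_ac_eq_0_iff to_ac_numeral)
  have ne: "(1 :: 'a alg_closure) \<noteq> -1" "(-1 :: 'a alg_closure) \<noteq> 1"
    using two by (metis add.right_inverse one_add_one)+
  have "a \<in> {-1, 0, 1}" "b \<in> {-1, 0, 1}" using assms by auto
  with eq ne show ?thesis by auto
qed

lemma quad_char_mult:
  fixes f g :: "'a::{field,finite} poly"
  assumes odd: "odd CARD('a)" and "lead_coeff f = 1" "lead_coeff g = 1"
  shows "quad_char D (f * g) = quad_char D f * quad_char D g"
proof (rule of_int_alg_closure_eq_imp[OF odd])
  have "f \<noteq> 0" "g \<noteq> 0" using assms by auto
  moreover have "lead_coeff (f * g) = 1" using assms by (simp only: lead_coeff_mult) simp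
  ultimately show "of_int (quad_char D (f * g))
      = (of_int (quad_char D f * quad_char D g) :: 'a alg_closure)"
    using assms by (simp add: quad_char_eq_ac_res ac_res_mult power_mult_distrib)
  show "\<bar>quad_char D (f * g)\<bar> \<le> 1" "\<bar>quad_char D f * quad_char D g\<bar> \<le> 1"
    using abs_quad_char_le[of D f] abs_quad_char_le[of D g]
    by (auto simp: abs_quad_char_le abs_mult mult_le_one)
qed

text \<open>Both sides are products over pairs of roots of differences with opposite signs. This
  takes the place of quadratic reciprocity.\<close>

lemma ac_res_swap:
  assumes "lead_coeff f = 1" "lead_coeff g = 1"
  shows "ac_res f g = (-1) ^ (degree f * degree g) * ac_res g f"
proof -
  have "ac_res f g = (\<Prod>x\<in>#ac_roots f. \<Prod>y\<in>#ac_roots g. x - y)"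
    by (simp add: ac_res_def ac_eval_prod_ac_roots[OF assms(2)])
  also have "\<dots> = (\<Prod>x\<in>#ac_roots f. \<Prod>y\<in>#ac_roots g. -1 * (y - x))"
    by simp
  also have "\<dots> = (\<Prod>x\<in>#ac_roots f. (-1) ^ degree g * (\<Prod>y\<in>#ac_roots g. y - x))"
    by (simp only: prod_mset.distrib prod_mset_constant ac_roots_factorization(2)[OF assms(2)])
  also have "\<dots> = ((-1) ^ degree g) ^ degree f * (\<Prod>x\<in>#ac_roots f. \<Prod>y\<in>#ac_roots g. y - x)"
    by (simp only: prod_mset.distrib prod_mset_constant ac_roots_factorization(2)[OF assms(1)])
  also have "(\<Prod>x\<in>#ac_roots f. \<Prod>y\<in>#ac_roots g. y - x) = (\<Prod>y\<in>#ac_roots g. \<Prod>x\<in>#ac_roots f. y - x)"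
    by (rule prod_mset.swap)
  also have "\<dots> = ac_res g f"
    by (simp add: ac_res_def ac_eval_prod_ac_roots[OF assms(1)])
  finally show ?thesis by (simp add: mult.commute flip: power_mult)
qed

text \<open>With h = (q-1)/2 the equation x^(h+1) = x has at most h + 1 < q solutions, so some
  \<open>c\<close> violates it.\<close>

lemma nonsquare_exists:
  assumes odd: "odd CARD('a::{field,finite})"
  obtains c :: "'a::{field,finite}" where "c \<noteq> 0" "c ^ (CARD('a) div 2) = -1"
proof -
  obtain h where h: "CARD('a) = 2 * h + 1" using odd by (elim oddE)
  then have h0: "h > 0" using card_field_gt_1[where ?'a = 'a] by auto
  have "\<exists>c::'a. c ^ Suc h \<noteq> c"
  proof (rule ccontr)
    assume "\<nexists>c::'a. c ^ Suc h \<noteq> c"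
    then have "{x::'a. x ^ Suc h = x} = UNIV" by auto
    with card_power_fixed_points_le[of "Suc h", where ?'b = 'a] h h0 show False by simp
  qed
  then obtain c :: 'a where c: "c ^ Suc h \<noteq> c" by blast
  then have "c \<noteq> 0" "c ^ h \<noteq> 1" by auto
  moreover have "c * c ^ (h * 2) = c" using field_power_card[of c]
    by (simp add: h mult.commute del: field_power_card)
  ultimately have "c ^ h = -1"
    by (simp add: power_mult power2_eq_1_iff)
  with h that \<open>c \<noteq> 0\<close> show ?thesis by simp
qed

text \<open>The map \<open>T\<close> is an involution-like permutation only in its effect on the
  sum: it multiplies the values of f at the roots of \<open>D\<close> by \<open>c\<close>, hence the
  resultant by c^d, and c^(d(q-1)/2) = (-1)^d = -1 because d is odd. Since n is at least d, changing
  the remainder leaves the leading term alone.\<close>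

lemma L_coeff_eq_0:
  fixes D :: "'a::{field,finite} poly"
  assumes odd: "odd CARD('a)" and D: "lead_coeff D = 1" and d: "odd (degree D)" and n: "degree D \<le> n"
  shows "L_coeff D n = 0"
proof -
  obtain c :: 'a where c0: "c \<noteq> 0" and c: "c ^ (CARD('a) div 2) = -1"
    using nonsquare_exists[OF odd] .
  have D0: "D \<noteq> 0" "degree D > 0" using D d by (auto intro: odd_pos)
  define T where "T f = f + smult (c - 1) (f mod D)" for f
  have T_mod: "T f mod D = smult c (f mod D)" for f
  proof -
    have "T f mod D = f mod D + smult (c - 1) (f mod D)"
      by (simp add: T_def poly_mod_add_left mod_smult_left)
    then show ?thesis by (simp add: smult_diff_left)
  qed
  have T_in: "T f \<in> monic_polys n" if f: "f \<in> monic_polys n" for f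
  proof -
    have "degree (f mod D) < n"
      using degree_mod_less[of D f] D0 n by auto
    moreover have "degree f = n" "coeff f n = 1" using f by (auto simp: monic_polys_def)
    ultimately show ?thesis
      by (simp add: T_def monic_polys_def degree_add_eq_left coeff_eq_0)
  qed
  have T_inj: "inj_on T (monic_polys n)"
  proof (rule inj_onI)
    fix f g assume "T f = T g"
    moreover from this have "smult c (f mod D) = smult c (g mod D)"
      by (metis T_mod)
    from arg_cong[OF this, of "smult (inverse c)"] have "f mod D = g mod D" using c0 by simp
    ultimately show "f = g" by (simp add: T_def)
  qed
  have bij: "bij_betw T (monic_polys n) (monic_polys n)"
    using T_inj T_in by (simp add: bij_betw_def endo_inj_surj finite_monic_polys image_subset_iff)
  have T_char: "quad_char D (T f) = - quad_char D f" if f: "f \<in> monic_polys n" for f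
  proof (rule of_int_alg_closure_eq_imp[OF odd])
    have f1: "lead_coeff f = 1" "lead_coeff (T f) = 1" and deg: "degree (T f) = degree f"
      using f T_in[OF f] by (auto simp: monic_polys_def)
    have ev: "ac_eval x (T f) = to_ac c * ac_eval x f" if "x \<in># ac_roots D" for x
    proof -
      have x: "ac_eval x D = 0" using that D0 by (simp add: set_ac_roots)
      have "ac_eval x (f mod D) = ac_eval x (f - D * (f div D))"
        by (simp add: minus_mult_div_eq_mod)
      then have "ac_eval x (f mod D) = ac_eval x f" using x by simp
      then show ?thesis by (simp add: T_def algebra_simps)
    qed
    have "ac_res D (T f) = (\<Prod>x\<in>#ac_roots D. to_ac c * ac_eval x f)"
      unfolding ac_res_def by (rule arg_cong[of _ _ prod_mset]) (rule image_mset_cong, rule ev)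
    also have "\<dots> = to_ac c ^ degree D * ac_res D f"
      by (simp only: prod_mset.distrib prod_mset_constant ac_roots_factorization(2)[OF D] ac_res_def)
    finally have "ac_res (T f) D = to_ac c ^ degree D * ac_res f D"
      using ac_res_swap[OF f1(1) D] ac_res_swap[OF f1(2) D] by (simp add: deg)
    then have "ac_res (T f) D ^ (CARD('a) div 2) =
        to_ac (c ^ (CARD('a) div 2)) ^ degree D * ac_res f D ^ (CARD('a) div 2)"
      by (simp add: power_mult_distrib mult.commute flip: power_mult)
    then show "of_int (quad_char D (T f)) = (of_int (- quad_char D f) :: 'a alg_closure)"
      using f1 odd d by (simp add: quad_char_eq_ac_res c)
  qed (use abs_quad_char_le[of D] in auto)
  have "L_coeff D n = (\<Sum>f\<in>monic_polys n. quad_char D (T f))"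
    unfolding L_coeff_def using sum.reindex_bij_betw[OF bij, of "quad_char D"] by simp
  also have "\<dots> = - L_coeff D n"
    by (simp add: T_char L_coeff_def sum_negf)
  finally show ?thesis by simp
qed

section \<open>Prime power sums\<close>

definition irreducibles_dividing :: "nat \<Rightarrow> 'a::field poly set" where
  "irreducibles_dividing n = {P. monic_irreducible P \<and> degree P dvd n}"

lemma finite_irreducibles_dividing:
  assumes "n > 0"
  shows "finite (irreducibles_dividing n :: 'a::{field,finite} poly set)"
proof (rule finite_subset)
  show "irreducibles_dividing n \<subseteq> (\<Union>k\<le>n. monic_polys k :: 'a poly set)"
    using assms by (auto simp: irreducibles_dividing_def monic_irreducible_def monic_polys_def dest:
      dvd_imp_le)
qed (simp add: finite_monic_polys)

text \<open>This is the identity log f = sum of \<Lambda> over the divisors of f. A prime power of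
  degree k is encoded by the pair of k and its prime \<open>P\<close>, its exponent being
  \<open>k div degree P\<close>.\<close>

lemma sum_over_prime_powers:
  fixes f :: "'a::{field,finite} poly"
  assumes f: "f \<in> monic_polys n"
  shows "(\<Sum>k=1..n. \<Sum>P | P \<in> irreducibles_dividing k \<and> P ^ (k div degree P) dvd f. degree P) = n"
proof -
  have f1: "lead_coeff f = 1" "degree f = n" and f0: "f \<noteq> 0" using f by (auto simp: monic_polys_def)
  let ?A = "\<lambda>k. {P. P \<in> irreducibles_dividing k \<and> P ^ (k div degree P) dvd f}"
  have "n = (\<Sum>P\<in>monic_factors f. degree P * poly_multiplicity P f)"
    using degree_eq_sum_monic_factors[OF f1(1)] f1 by simp
  also have "\<dots> = (\<Sum>P\<in>monic_factors f. \<Sum>j=1..poly_multiplicity P f. degree P)"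
    by (simp add: mult.commute)
  also have "\<dots> = (\<Sum>(P, j)\<in>Sigma (monic_factors f) (\<lambda>P. {1..poly_multiplicity P f}). degree P)"
    by (rule sum.Sigma) (use finite_monic_factors[OF f1(1)] in auto)
  also have "\<dots> = (\<Sum>(k, P)\<in>Sigma {1..n} ?A. degree P)"
  proof (rule sum.reindex_bij_witness[where
        j = "\<lambda>(P, j). (j * degree P, P)" and i = "\<lambda>(k, P). (P, k div degree P)"], goal_cases)
    case (1 a)
    then show ?case
      by (auto simp: monic_factors_def dest: monic_irreducible_degree_pos)
  next
    case (2 a)
    obtain P j where a: "a = (P, j)" by (cases a)
    with 2 have P: "monic_irreducible P" and j: "1 \<le> j" "j \<le> poly_multiplicity P f"
      by (auto simp: monic_factors_def)
    note d = monic_irreducible_degree_pos[OF P]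
    have dvd: "P ^ j dvd f" using P f0 j by (simp add: power_dvd_iff_le_poly_multiplicity)
    then have "degree (P ^ j) \<le> degree f" using f0 by (rule dvd_imp_degree_le)
    then show ?case
      using P j d dvd f1 by (simp add: a irreducibles_dividing_def degree_power_eq)
  next
    case (3 b)
    then show ?case
      by (auto simp: irreducibles_dividing_def)
  next
    case (4 b)
    obtain k P where b: "b = (k, P)" by (cases b)
    with 4 have P: "monic_irreducible P" and k: "1 \<le> k" "degree P dvd k" "P ^ (k div degree P) dvd f"
      by (auto simp: irreducibles_dividing_def)
    have "k div degree P > 0" using k by (auto simp: dvd_div_eq_0_iff)
    moreover have "k div degree P \<le> poly_multiplicity P f"
      using k P f0 by (simp add: power_dvd_iff_le_poly_multiplicity)
    moreover have "P dvd f"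
      using calculation P f0 power_dvd_iff_le_poly_multiplicity[OF P f0, of 1] by simp
    ultimately show ?case using P by (simp add: b monic_factors_def)
  qed auto
  also have "\<dots> = (\<Sum>k=1..n. \<Sum>P\<in>?A k. degree P)"
    by (rule sum.Sigma[symmetric]) (auto intro!: finite_subset[OF _ finite_irreducibles_dividing])
  finally show ?thesis by simp
qed

text \<open>The coefficient form of u L' = (u L'/L) L, valid without any convergence: weight the
  previous identity by \<open>w f\<close>, sum over f and write f = P^j h. It is used for the
  constant weight 1 and for \<open>quad_char D\<close>.\<close>

lemma monic_multiplicative_recurrence:
  fixes w :: "'a::{field,finite} poly \<Rightarrow> 'b::comm_ring_1"
  assumes w1: "w 1 = 1"
    and w: "\<And>f g. lead_coeff f = 1 \<Longrightarrow> lead_coeff g = 1 \<Longrightarrow> w (f * g) = w f * w g"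
  shows "of_nat n * (\<Sum>f\<in>monic_polys n. w f) =
    (\<Sum>k=1..n. (\<Sum>P\<in>irreducibles_dividing k. of_nat (degree P) * w P ^ (k div degree P)) *
       (\<Sum>f\<in>monic_polys (n - k). w f))"
proof -
  let ?I = "irreducibles_dividing :: nat \<Rightarrow> 'a poly set"
  let ?M = "monic_polys :: nat \<Rightarrow> 'a poly set"
  have w_pow: "w (f ^ j) = w f ^ j" if "lead_coeff f = 1" for f j
  proof (induction j)
    case (Suc j)
    have "lead_coeff (f ^ j) = 1" using that by (simp add: lead_coeff_power)
    with Suc that show ?case by (simp add: w)
  qed (simp add: w1)
  have *: "(\<Sum>f\<in>?M n. if P ^ (k div degree P) dvd f then w f else 0) =
      w P ^ (k div degree P) * (\<Sum>f\<in>?M (n - k). w f)" if k: "k \<in> {1..n}" and P: "P \<in> ?I k" for k P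
  proof -
    let ?j = "k div degree P"
    have Pi: "monic_irreducible P" "degree P dvd k" using P by (auto simp: irreducibles_dividing_def)
    then have P1: "lead_coeff (P ^ ?j) = 1"
      by (simp only: lead_coeff_power) (simp add: monic_irreducible_def)
    have degP: "degree (P ^ ?j) = k"
      using Pi by (simp add: degree_power_eq)
    have P0: "P ^ ?j \<noteq> 0" using Pi by simp
    have bij: "bij_betw (\<lambda>h. P ^ ?j * h) (?M (n - k)) {f\<in>?M n. P ^ ?j dvd f}"
    proof (rule bij_betwI')
      fix h g assume "h \<in> ?M (n - k)" "g \<in> ?M (n - k)"
      show "(P ^ ?j * h = P ^ ?j * g) = (h = g)" using Pi by simp
    next
      fix h assume h: "h \<in> ?M (n - k)"
      then have lh: "lead_coeff h = 1" unfolding monic_polys_def by blast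
      then have h0: "h \<noteq> 0" by auto
      have "lead_coeff (P ^ ?j * h) = 1"
        unfolding lead_coeff_mult P1 lh by simp
      moreover have "degree (P ^ ?j * h) = n"
        using h k degP degree_mult_eq[OF P0 h0] by (simp add: monic_polys_def)
      ultimately show "P ^ ?j * h \<in> {f\<in>?M n. P ^ ?j dvd f}"
        by (simp add: monic_polys_def)
    next
      fix f assume "f \<in> {f\<in>?M n. P ^ ?j dvd f}"
      then have f: "lead_coeff f = 1" "degree f = n" and "P ^ ?j dvd f"
        by (auto simp: monic_polys_def)
      then obtain h where h: "f = P ^ ?j * h" by (elim dvdE)
      then have h0: "h \<noteq> 0" using f by auto
      have "lead_coeff h = 1"
        using f(1) P1 unfolding h lead_coeff_mult by simp
      moreover have "degree h = n - k"
        using f(2) degP degree_mult_eq[OF P0 h0] by (simp add: h)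
      ultimately have "h \<in> ?M (n - k)" unfolding monic_polys_def by blast
      with h show "\<exists>h\<in>?M (n - k). f = P ^ ?j * h" by blast
    qed
    have "(\<Sum>f\<in>?M n. if P ^ ?j dvd f then w f else 0) = (\<Sum>f | f \<in> ?M n \<and> P ^ ?j dvd f. w f)"
      by (simp add: sum.inter_filter finite_monic_polys)
    also have "\<dots> = (\<Sum>h\<in>?M (n - k). w (P ^ ?j * h))"
      using sum.reindex_bij_betw[OF bij, of w] by simp
    also have "\<dots> = (\<Sum>h\<in>?M (n - k). w P ^ ?j * w h)"
      using P1 Pi by (intro sum.cong) (auto simp: w w_pow monic_polys_def monic_irreducible_def)
    finally show ?thesis by (simp add: sum_distrib_left)
  qed
  have "of_nat n * (\<Sum>f\<in>?M n. w f) = (\<Sum>f\<in>?M n. of_nat n * w f)"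
    by (rule sum_distrib_left)
  also have "\<dots> = (\<Sum>f\<in>?M n. \<Sum>k=1..n. \<Sum>P\<in>?I k.
      of_nat (degree P) * (if P ^ (k div degree P) dvd f then w f else 0))"
  proof (rule sum.cong[OF refl])
    fix f assume "f \<in> ?M n"
    from arg_cong[OF sum_over_prime_powers[OF this], of "of_nat :: nat \<Rightarrow> 'b", symmetric]
    have "of_nat n * w f = (\<Sum>k=1..n. \<Sum>P | P \<in> ?I k
        \<and> P ^ (k div degree P) dvd f. of_nat (degree P)) * w f"
      by (simp only: of_nat_sum)
    also have "\<dots> = (\<Sum>k=1..n. \<Sum>P | P \<in> ?I k \<and> P ^ (k div degree P) dvd f. of_nat (degree P) * w f)"
      by (simp only: sum_distrib_right)
    also have "\<dots> = (\<Sum>k=1..n. \<Sum>P\<in>?I k.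
      if P ^ (k div degree P) dvd f then of_nat (degree P) * w f else 0)"
      by (intro sum.cong sum.inter_filter refl finite_irreducibles_dividing) auto
    finally show "of_nat n * w f = (\<Sum>k=1..n. \<Sum>P\<in>?I k.
      of_nat (degree P) * (if P ^ (k div degree P) dvd f then w f else 0))"
      by (simp add: if_distrib cong: if_cong)
  qed
  also have "\<dots> = (\<Sum>k=1..n. \<Sum>P\<in>?I k. \<Sum>f\<in>?M n.
      of_nat (degree P) * (if P ^ (k div degree P) dvd f then w f else 0))"
    by (subst sum.swap, rule sum.cong[OF refl], rule sum.swap)
  also have "\<dots> = (\<Sum>k=1..n. \<Sum>P\<in>?I k. of_nat (degree P) *
      (w P ^ (k div degree P) * (\<Sum>f\<in>?M (n - k). w f)))"
    by (intro sum.cong refl) (simp only: * flip: sum_distrib_left)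
  finally show ?thesis
    by (simp add: sum_distrib_right mult.assoc)
qed

text \<open>Take the recurrence with weight 1. By induction the terms k < n contribute (n - 1) q^n
  to the total n q^n.\<close>

lemma sum_degree_irreducibles_dividing:
  assumes "n > 0"
  shows "(\<Sum>P\<in>(irreducibles_dividing n :: 'a::{field,finite} poly set). degree P) = CARD('a) ^ n"
  using assms
proof (induction n rule: less_induct)
  case (less n)
  let ?q = "int CARD('a)"
  let ?C = "\<lambda>k. \<Sum>P\<in>(irreducibles_dividing k :: 'a poly set). int (degree P)"
  have "int n * ?q ^ n = (\<Sum>k=1..n. ?C k * ?q ^ (n - k))"
    using monic_multiplicative_recurrence[of "\<lambda>f :: 'a poly. 1 :: int" n]
    by (simp add: card_monic_polys)
  also have "{1..n} = insert n {1..<n}" using less.prems by auto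
  also have "(\<Sum>k\<in>insert n {1..<n}. ?C k * ?q ^ (n - k)) = ?C n + (\<Sum>k=1..<n. ?C k * ?q ^ (n - k))"
    by simp
  also have "(\<Sum>k=1..<n. ?C k * ?q ^ (n - k)) = (\<Sum>k=1..<n. ?q ^ n)"
  proof (rule sum.cong[OF refl])
    fix k assume k: "k \<in> {1..<n}"
    then have "?C k = ?q ^ k"
      using arg_cong[OF less.IH[of k], of int] by simp
    then show "?C k * ?q ^ (n - k) = ?q ^ n" using k by (simp flip: power_add)
  qed
  finally have "?C n = ?q ^ n"
    using less.prems by (simp add: of_nat_diff algebra_simps)
  then have "int (\<Sum>P\<in>(irreducibles_dividing n :: 'a poly set). degree P) = int (CARD('a) ^ n)"
    by simp
  then show ?case by (simp only: of_nat_eq_iff)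
qed

text \<open>These are the coefficients of \<open>u L'(u) / L(u)\<close>; \<open>P\<close> stands for its power of degree \<open>n\<close>.\<close>
definition prime_power_sum :: "'a::{field,finite} poly \<Rightarrow> nat \<Rightarrow> int" where
  "prime_power_sum D n =
     (\<Sum>P\<in>irreducibles_dividing n. int (degree P) * quad_char D P ^ (n div degree P))"

lemma quad_char_1 [simp]:
  fixes D :: "'a::field poly"
  shows "quad_char D 1 = 1"
proof -
  have "{P :: 'a poly. monic_irreducible P \<and> P dvd 1} = {}"
    by (auto simp: monic_irreducible_def irreducible_def)
  then show ?thesis
    unfolding quad_char_def jacobi_symbol_def by (simp only: prod.empty)
qed

lemma L_coeff_recurrence:
  fixes D :: "'a::{field,finite} poly"
  assumes odd: "odd CARD('a)"
  shows "int n * L_coeff D n = (\<Sum>k=1..n. prime_power_sum D k * L_coeff D (n - k))"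
  unfolding L_coeff_def prime_power_sum_def
  by (rule monic_multiplicative_recurrence) (simp_all add: quad_char_mult odd)

lemma L_coeff_0 [simp]:
  fixes D :: "'a::{field,finite} poly"
  shows "L_coeff D 0 = 1"
proof -
  have "monic_polys 0 = {1 :: 'a poly}"
    by (auto simp: monic_polys_def one_pCons elim!: degree_eq_zeroE)
  then show ?thesis by (simp add: L_coeff_def)
qed

text \<open>The trivial bound. Its independence of \<open>D\<close> is what the final estimate
  exploits.\<close>

lemma abs_prime_power_sum_le:
  fixes D :: "'a::{field,finite} poly"
  assumes "n > 0"
  shows "\<bar>prime_power_sum D n\<bar> \<le> int CARD('a) ^ n"
proof -
  have "\<bar>prime_power_sum D n\<bar> \<le> (\<Sum>P\<in>(irreducibles_dividing n :: 'a poly set). \<bar>int (degree P)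
      * quad_char D P ^ (n div degree P)\<bar>)"
    unfolding prime_power_sum_def by (rule sum_abs)
  also have "\<dots> \<le> (\<Sum>P\<in>(irreducibles_dividing n :: 'a poly set). int (degree P))"
    by (rule sum_mono) (simp add: abs_mult power_abs mult_left_le power_le_one abs_quad_char_le)
  also have "\<dots> = int CARD('a) ^ n"
    using arg_cong[OF sum_degree_irreducibles_dividing[OF assms, where ?'a = 'a], of int] by simp
  finally show ?thesis .
qed

section \<open>Stepanov's method\<close>

text \<open>
  \<open>taylor p\<close> is \<open>p(x + z)\<close> as a polynomial in \<open>z\<close> over the polynomials in \<open>x\<close>, so that its
  coefficients are the Hasse derivatives of \<open>p\<close>.
\<close>
definition taylor :: "'a::comm_ring_1 poly \<Rightarrow> 'a poly poly" where
  "taylor p = poly (map_poly (\<lambda>c. [:[:c:]:]) p) [:[:0, 1:], 1:]"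

lemma taylor_0 [simp]: "taylor 0 = 0"
  by (simp add: taylor_def)

lemma taylor_pCons: "taylor (pCons a p) = [:[:a:]:] + [:[:0, 1:], 1:] * taylor p"
  by (simp add: taylor_def map_poly_pCons del: mult_pCons_left)

lemma taylor_1 [simp]: "taylor 1 = 1"
  by (simp add: one_pCons taylor_pCons)

lemma taylor_add [simp]: "taylor (p + q) = taylor p + taylor q"
proof (induction p arbitrary: q)
  case (pCons a p q)
  obtain b r where q: "q = pCons b r" by (cases q)
  have "[:[:a + b:]:] = [:[:a:]:] + [:[:b:]:]" by simp
  moreover have "taylor (pCons a p + q) = [:[:a + b:]:] + [:[:0, 1:], 1:] * (taylor p + taylor r)"
    by (simp only: q add_pCons taylor_pCons pCons.IH)
  ultimately show ?case by (simp only: q taylor_pCons distrib_left add_ac)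
qed simp

lemma taylor_smult [simp]: "taylor (smult c p) = [:[:c:]:] * taylor p"
  by (induction p) (simp_all add: taylor_pCons distrib_left mult.left_commute del: mult_pCons_left)

lemma taylor_mult: "taylor (p * q) = taylor p * taylor q"
proof (induction p)
  case (pCons a p)
  have "pCons a p * q = smult a q + pCons 0 (p * q)" by simp
  then have "taylor (pCons a p * q) = [:[:a:]:] * taylor q + [:[:0, 1:], 1:] * (taylor p * taylor q)"
    by (simp only: taylor_add taylor_smult taylor_pCons pCons.IH) simp
  then show ?case by (simp only: taylor_pCons distrib_right mult.assoc)
qed simp

lemma taylor_diff [simp]: "taylor (p - q) = taylor p - taylor q"
  using taylor_add[of "p - q" q] by (simp del: taylor_add add: eq_diff_eq)

lemma taylor_power: "taylor (p ^ n) = taylor p ^ n"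
  by (induction n) (simp_all add: taylor_mult)

lemma coeff_taylor_pCons:
  "coeff (taylor (pCons a p)) k =
     (if k = 0 then [:a:] else 0) + pCons 0 (coeff (taylor p) k) +
     (if k = 0 then 0 else coeff (taylor p) (k - 1))"
  by (cases k) (simp_all add: taylor_pCons)

lemma coeff_0_taylor [simp]: "coeff (taylor p) 0 = p"
  by (induction p) (simp_all add: coeff_taylor_pCons)

lemma coeff_coeff_taylor_eq_0:
  "degree p < i + k \<Longrightarrow> coeff (coeff (taylor p) k) i = 0"
proof (induction p arbitrary: i k)
  case (pCons a p)
  show ?case
  proof (cases "p = 0")
    case True
    with pCons.prems show ?thesis
      by (auto simp: coeff_taylor_pCons coeff_pCons split: nat.split)
  next
    case False
    with pCons show ?thesis
      by (auto simp: coeff_taylor_pCons coeff_pCons coeff_eq_0 split: nat.split)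
  qed
qed simp

definition eval2 :: "'a::comm_ring_1 poly \<Rightarrow> 'a poly \<Rightarrow> 'a poly poly \<Rightarrow> 'a poly" where
  "eval2 y z F = poly (map_poly (\<lambda>c. c \<circ>\<^sub>p y) F) z"

lemma eval2_0 [simp]: "eval2 y z 0 = 0"
  and eval2_pCons [simp]: "eval2 y z (pCons c F) = (c \<circ>\<^sub>p y) + z * eval2 y z F"
  by (simp_all add: eval2_def map_poly_pCons)

lemma eval2_add [simp]: "eval2 y z (F + G) = eval2 y z F + eval2 y z G"
proof (induction F arbitrary: G)
  case (pCons a F G)
  show ?case
    by (cases G) (simp add: pCons.IH pcompose_add distrib_left add.assoc add.left_commute)
qed simp

lemma eval2_smult [simp]: "eval2 y z (smult c F) = (c \<circ>\<^sub>p y) * eval2 y z F"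
  by (induction F) (simp_all add: pcompose_mult algebra_simps)

lemma eval2_sum: "eval2 y z (sum F A) = (\<Sum>i\<in>A. eval2 y z (F i))"
  by (induction A rule: infinite_finite_induct) simp_all

lemma eval2_taylor: "eval2 y z (taylor p) = p \<circ>\<^sub>p (y + z)"
  by (induction p) (simp_all add: taylor_pCons pcompose_pCons algebra_simps)

lemma eval2_altdef: "eval2 y z F = (\<Sum>k\<le>degree F. (coeff F k \<circ>\<^sub>p y) * z ^ k)"
proof -
  let ?G = "map_poly (\<lambda>c. c \<circ>\<^sub>p y) F"
  have "degree ?G \<le> degree F"
    by (rule degree_le) (simp add: coeff_map_poly coeff_eq_0)
  then have "(\<Sum>k\<le>degree ?G. coeff ?G k * z ^ k) = (\<Sum>k\<le>degree F. coeff ?G k * z ^ k)"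
    by (intro sum.mono_neutral_left) (auto simp: coeff_eq_0)
  then show ?thesis by (simp add: eval2_def poly_altdef coeff_map_poly)
qed

text \<open>
  For \<open>U = taylor G\<close> the right-hand side is \<open>G\<close> itself, expanded in powers of \<open>x - x^Q\<close>. Its coefficients
  are \<open>Q\<close>-th powers, so that divisibility by \<open>P\<close> is enough, and \<open>P\<close> divides \<open>x - x^Q\<close>.
\<close>
lemma power_dvd_eval2_taylor:
  fixes P :: "'a::{field,finite} poly" and n
  defines "Q \<equiv> CARD('a) ^ n"
  assumes P: "P dvd [:0, 1:] - [:0, 1:] ^ Q" and U: "\<And>k. k < l \<Longrightarrow> P dvd coeff U k" and l: "l \<le> Q"
  shows "P ^ l dvd eval2 ([:0, 1:] ^ Q) ([:0, 1:] - [:0, 1:] ^ Q) U"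
proof -
  have "P ^ l dvd (coeff U k \<circ>\<^sub>p [:0, 1:] ^ Q) * ([:0, 1:] - [:0, 1:] ^ Q) ^ k" for k
  proof (cases "k < l")
    case True
    have "P ^ l dvd P ^ Q" using l by (rule le_imp_power_dvd)
    also have "\<dots> dvd coeff U k ^ Q" using U[OF True] by (rule dvd_power_same)
    also have "\<dots> = coeff U k \<circ>\<^sub>p [:0, 1:] ^ Q" unfolding Q_def by (rule poly_power_card)
    finally show ?thesis by (rule dvd_mult2)
  next
    case False
    then have "P ^ l dvd P ^ k" by (intro le_imp_power_dvd) simp
    also have "\<dots> dvd ([:0, 1:] - [:0, 1:] ^ Q) ^ k" using P by (rule dvd_power_same)
    finally show ?thesis by (rule dvd_mult)
  qed
  then show ?thesis unfolding eval2_altdef by (intro dvd_sum) auto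
qed

text \<open>In (f + z g)^e each factor z uses up at most one factor f: a k-th derivative of f^e H
  keeps f^(e-k). For k \<ge> e the truncated exponent makes the claim trivial.\<close>

lemma power_dvd_coeff_pCons_power_mult:
  "f ^ (e - k) dvd coeff (pCons f g ^ e * H) k" for f :: "'a::comm_ring_1"
proof (induction e arbitrary: k)
  case (Suc e)
  let ?M = "pCons f g ^ e * H"
  have "pCons f g ^ Suc e * H = smult f ?M + pCons 0 (g * ?M)"
    by (simp add: algebra_simps)
  moreover have "f ^ (Suc e - k) dvd f * coeff ?M k"
  proof -
    have "f ^ (Suc e - k) dvd f ^ Suc (e - k)" by (rule le_imp_power_dvd) simp
    also have "\<dots> dvd f * coeff ?M k" using Suc.IH[of k] by (simp add: mult_dvd_mono)
    finally show ?thesis .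
  qed
  moreover have "f ^ (Suc e - k) dvd coeff (pCons 0 (g * ?M)) k"
  proof (cases k)
    case (Suc k')
    have "f ^ (e - k') dvd coeff (g * ?M) k'"
      unfolding coeff_mult[of g]
    proof (intro dvd_sum dvd_mult)
      fix i assume "i \<in> {..k'}"
      have "f ^ (e - k') dvd f ^ (e - (k' - i))" by (rule le_imp_power_dvd) simp
      also have "\<dots> dvd coeff ?M (k' - i)" by (rule Suc.IH)
      finally show "f ^ (e - k') dvd coeff ?M (k' - i)" .
    qed
    with Suc show ?thesis by simp
  qed simp
  ultimately show ?case by (simp only: coeff_add coeff_smult dvd_add)
qed simp

lemma power_dvd_coeff_taylor:
  fixes f r :: "'a::comm_ring_1 poly"
  shows "f ^ (e - k) dvd coeff (taylor (f ^ e * r)) k"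
proof -
  obtain c g where "taylor f = pCons c g" by (cases "taylor f")
  moreover from this have "c = f" by (metis coeff_0_taylor coeff_pCons_0)
  ultimately show ?thesis by (simp add: taylor_mult taylor_power power_dvd_coeff_pCons_power_mult)
qed

section \<open>The auxiliary polynomial\<close>

text \<open>The blocks act like digits in base x^Q: their degrees lie in the disjoint intervals [jQ,
  jQ + m), so nothing cancels and the top nonzero block determines the degree.\<close>

lemma degree_digit_sum:
  fixes r :: "nat \<Rightarrow> 'a::field poly"
  assumes m: "m \<le> Q" and r: "\<And>j. j < J \<Longrightarrow> r j \<in> polys_below m"
  defines "A \<equiv> (\<Sum>j<J. monom 1 (j * Q) * r j)"
  shows "(A = 0 \<and> (\<forall>j<J. r j = 0)) \<or> (A \<noteq> 0 \<and> (\<exists>j<J. \<exists>e<m. degree A = j * Q + e))"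
  unfolding A_def using r
proof (induction J)
  case (Suc J)
  let ?A = "\<Sum>j<J. monom 1 (j * Q) * r j"
  have IH: "(?A = 0 \<and> (\<forall>j<J. r j = 0)) \<or> (?A \<noteq> 0 \<and> (\<exists>j<J. \<exists>e<m. degree ?A = j * Q + e))"
    using Suc.IH Suc.prems by auto
  show ?case
  proof (cases "r J = 0")
    case True
    with IH show ?thesis by (auto simp: less_Suc_eq)
  next
    case False
    have dr: "degree (r J) < m"
    proof (cases "m = 0")
      case True
      then show ?thesis using Suc.prems[of J] False by (simp add: polys_below_def poly_eq_iff)
    next
      case False
      then show ?thesis using Suc.prems[of J] by (simp add: polys_below_iff_degree)
    qed
    have deg: "degree (monom 1 (J * Q) * r J) = J * Q + degree (r J)"
      using False by (simp add: degree_mult_eq degree_monom_eq)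
    have nz: "monom 1 (J * Q) * r J \<noteq> 0" using False by simp
    show ?thesis
    proof (cases "?A = 0")
      case True
      then show ?thesis using deg dr nz by (auto simp: less_Suc_eq)
    next
      case A0: False
      then obtain j e where je: "j < J" "e < m" "degree ?A = j * Q + e" using IH by blast
      have "degree ?A < (j + 1) * Q" using je m by simp
      also have "\<dots> \<le> J * Q" using je by (intro mult_right_mono) auto
      also have "\<dots> \<le> degree (monom 1 (J * Q) * r J)" by (simp add: deg)
      finally have *: "degree ?A < degree (monom 1 (J * Q) * r J)" .
      then have "degree (?A + monom 1 (J * Q) * r J) = J * Q + degree (r J)"
        by (simp add: degree_add_eq_right deg)
      moreover have "?A + monom 1 (J * Q) * r J \<noteq> 0"
      proof
        assume "?A + monom 1 (J * Q) * r J = 0"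
        then have "degree ?A = degree (- (monom 1 (J * Q) * r J))"
          by (simp only: eq_neg_iff_add_eq_0[symmetric])
        with * show False by (simp only: degree_minus less_irrefl)
      qed
      ultimately show ?thesis using dr by auto
    qed
  qed
qed simp

text \<open>
  For the two sums \<open>A\<close> and \<open>B\<close>, a zero would give \<open>A\<^sup>2 D = B\<^sup>2 D^Q\<close>; but the quotients of the degrees
  of both sides by \<open>Q\<close> have different parity.
\<close>
lemma stepanov_nonzero:
  fixes D :: "'a::field poly" and r s :: "nat \<Rightarrow> 'a poly"
  assumes D: "odd (degree D)" and Q: "Q = 2 * h + 1" and m: "2 * m + degree D \<le> Q"
    and r: "\<And>j. j < J \<Longrightarrow> r j \<in> polys_below m" and s: "\<And>j. j < J \<Longrightarrow> s j \<in> polys_below m"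
    and zero: "(\<Sum>j<J. monom 1 (j * Q) * r j) + D ^ h * (\<Sum>j<J. monom 1 (j * Q) * s j) = 0"
    and j: "j < J"
  shows "r j = 0 \<and> s j = 0"
proof -
  define A where "A = (\<Sum>j<J. monom 1 (j * Q) * r j)"
  define B where "B = (\<Sum>j<J. monom 1 (j * Q) * s j)"
  have D0: "D \<noteq> 0" using D by auto
  have mQ: "m \<le> Q" using m by simp
  have A: "(A = 0 \<and> (\<forall>j<J. r j = 0)) \<or> (A \<noteq> 0 \<and> (\<exists>j<J. \<exists>e<m. degree A = j * Q + e))"
    unfolding A_def by (rule degree_digit_sum[OF mQ r])
  have B: "(B = 0 \<and> (\<forall>j<J. s j = 0)) \<or> (B \<noteq> 0 \<and> (\<exists>j<J. \<exists>e<m. degree B = j * Q + e))"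
    unfolding B_def by (rule degree_digit_sum[OF mQ s])
  have AB: "A = - (D ^ h * B)" using zero by (simp add: A_def B_def eq_neg_iff_add_eq_0)
  show ?thesis
  proof (cases "B = 0")
    case True
    with AB have "A = 0" by simp
    with A B True j show ?thesis by blast
  next
    case B0: False
    then have A0: "A \<noteq> 0" using AB D0 by simp
    obtain i e where ie: "e < m" "degree A = i * Q + e" using A A0 by blast
    obtain k f where kf: "f < m" "degree B = k * Q + f" using B B0 by blast
    have "degree A = h * degree D + degree B"
      using AB D0 B0 by (simp add: degree_mult_eq degree_power_eq)
    then have "2 * (i * Q + e) + degree D = (2 * h + 1) * degree D + 2 * (k * Q + f)"
      using ie kf by (simp add: algebra_simps)
    then have eq: "(2 * e + degree D) + (2 * i) * Q = 2 * f + (degree D + 2 * k) * Q"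
      unfolding Q by (simp add: algebra_simps)
    have div: "(x + y * Q) div Q = y" if "x < Q" for x y
      using that by simp
    have "((2 * e + degree D) + (2 * i) * Q) div Q = 2 * i"
      using ie m by (intro div) linarith
    moreover have "(2 * f + (degree D + 2 * k) * Q) div Q = degree D + 2 * k"
      using kf m by (intro div) linarith
    ultimately have "2 * i = degree D + 2 * k" using eq by simp
    then have "even (degree D)" by presburger
    with D show ?thesis by simp
  qed
qed

text \<open>Dividing out D^(e-k) leaves degree at most k d + deg r, with d the degree of
  \<open>D\<close>. The point is that \<open>e\<close> has disappeared: for e = l + h the large
  exponent h costs nothing in the number of conditions.\<close>

lemma stepanov_coeff_in_polys_below:
  fixes D r :: "'a::field poly"
  assumes D: "lead_coeff D = 1" "degree D > 0" and k: "k < l" "l \<le> e" and r: "r \<in> polys_below m"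
    and m: "m > 0"
  shows "coeff (taylor (D ^ e * r)) k div D ^ (e - k) \<in> polys_below (m + l * degree D)"
proof (cases "coeff (taylor (D ^ e * r)) k = 0")
  case True
  then show ?thesis by (simp add: polys_below_def)
next
  case False
  let ?H = "coeff (taylor (D ^ e * r)) k"
  have D0: "D \<noteq> 0" using D by auto
  have "coeff ?H (degree ?H) \<noteq> 0" using False by simp
  then have "degree ?H + k \<le> degree (D ^ e * r)"
    using coeff_coeff_taylor_eq_0[of "D ^ e * r" "degree ?H" k] by force
  also have "\<dots> \<le> e * degree D + degree r"
    by (rule order.trans[OF degree_mult_le]) (simp add: D0 degree_power_eq)
  finally have 1: "degree ?H + k \<le> e * degree D + degree r" .
  obtain g where g: "?H = D ^ (e - k) * g"
    using power_dvd_coeff_taylor[of D e k r] by (elim dvdE)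
  then have g0: "g \<noteq> 0" using False by auto
  have 2: "degree ?H = (e - k) * degree D + degree g"
    unfolding g using D0 g0 by (simp add: degree_mult_eq degree_power_eq)
  have 3: "e * degree D = (e - k) * degree D + k * degree D"
    using k by (simp flip: distrib_right)
  have "degree g \<le> k * degree D + degree r"
    using 1 2 3 by linarith
  also have "\<dots> < m + l * degree D"
  proof -
    have "degree r < m" using r m by (simp add: polys_below_iff_degree)
    moreover have "k * degree D \<le> l * degree D" using k by simp
    ultimately show ?thesis by linarith
  qed
  finally have "degree g < m + l * degree D" .
  moreover have "?H div D ^ (e - k) = g" unfolding g using D0 by simp
  ultimately show ?thesis using m by (simp add: polys_below_iff_degree)
qed

lemma polys_below_diff: "f \<in> polys_below n \<Longrightarrow> g \<in> polys_below n \<Longrightarrow> f - g \<in> polys_below n"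
  for f :: "'a::ab_group_add poly"
  by (simp add: polys_below_def)

lemma sum_monom_in_polys_below:
  fixes f :: "nat \<Rightarrow> 'a::field poly"
  assumes "\<And>j. j < J \<Longrightarrow> f j \<in> polys_below n"
  shows "(\<Sum>j<J. monom 1 j * f j) \<in> polys_below (n + J)"
  using assms
  by (auto simp: polys_below_def coeff_sum coeff_monom_mult intro!: sum.neutral)

text \<open>The unknowns have 2 J m coefficients, and each of the l relations takes values in a
  space of dimension m + l d + J. The relations are additive, so the difference of two colliding
  pairs satisfies them. The constant \<open>a\<close> stands for the residue of D^h modulo the
  primes to be counted.\<close>

lemma stepanov_pigeonhole:
  fixes D a :: "'a::{field,finite} poly"
  assumes D: "lead_coeff D = 1" "degree D > 0" and m: "m > 0" and a: "a \<in> {1, -1}"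
    and count: "l * (m + l * degree D + J) < 2 * J * m"
  obtains r s :: "nat \<Rightarrow> 'a poly" where
    "\<forall>j<J. r j \<in> polys_below m" "\<forall>j<J. s j \<in> polys_below m"
    "\<exists>j<J. r j \<noteq> 0 \<or> s j \<noteq> 0"
    "\<forall>k<l. (\<Sum>j<J. monom 1 j * (coeff (taylor (D ^ l * r j)) k div D ^ (l - k))) +
       a * (\<Sum>j<J. monom 1 j * (coeff (taylor (D ^ (l + h) * s j)) k div D ^ (l + h - k))) = 0"
proof -
  let ?n = "m + l * degree D + J"
  define V :: "(nat \<Rightarrow> 'a poly) set" where "V = ({..<J} \<rightarrow>\<^sub>E polys_below m)"
  define W :: "(nat \<Rightarrow> 'a poly) set" where "W = ({..<l} \<rightarrow>\<^sub>E polys_below ?n)"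
  define c where "c r s k = (\<Sum>j<J. monom 1 j * (coeff (taylor (D ^ l * r j)) k div D ^ (l - k))) +
       a * (\<Sum>j<J. monom 1 j * (coeff (taylor (D ^ (l + h) * s j)) k div D ^ (l + h - k)))"
    for r s :: "nat \<Rightarrow> 'a poly" and k
  define \<Phi> where "\<Phi> = (\<lambda>(r, s). restrict (c r s) {..<l})"
  have V: "r j \<in> polys_below m" if "r \<in> V" "j < J" for r j
    using that by (auto simp: V_def)
  have c_in: "c r s k \<in> polys_below ?n" if rs: "r \<in> V" "s \<in> V" and k: "k < l" for r s k
  proof -
    have *: "(\<Sum>j<J. monom 1 j * (coeff (taylor (D ^ e * t j)) k div D ^ (e - k))) \<in> polys_below ?n"
      if "t \<in> V" "l \<le> e" for t e
      by (rule sum_monom_in_polys_below) (use that D k m V in \<open>auto intro!: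
        stepanov_coeff_in_polys_below\<close>)
    show ?thesis
      unfolding c_def using a *[OF rs(1) order.refl] *[OF rs(2), of "l + h"]
      by (auto simp: polys_below_def)
  qed
  have img: "\<Phi> ` (V \<times> V) \<subseteq> W"
    using c_in by (auto simp: \<Phi>_def W_def split: if_splits)
  have finW: "finite W" unfolding W_def by (intro finite_PiE) (auto simp: finite_polys_below)
  have cardV: "card V = CARD('a) ^ (m * J)"
    by (simp add: V_def card_PiE card_polys_below power_mult)
  have cardW: "card W = CARD('a) ^ (?n * l)"
    by (simp add: W_def card_PiE card_polys_below power_mult)
  have "card W < card (V \<times> V)"
    unfolding card_cartesian_product cardV cardW power_add[symmetric]
    using count card_field_gt_1[where ?'a = 'a]
    by (intro power_strict_increasing) (auto simp: algebra_simps)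
  have "\<not> inj_on \<Phi> (V \<times> V)"
    using card_inj_on_le[OF _ img finW] \<open>card W < card (V \<times> V)\<close> by auto
  then obtain r s r' s' where rs: "r \<in> V" "s \<in> V" "r' \<in> V" "s' \<in> V"
    and ne: "(r, s) \<noteq> (r', s')" and eq: "\<Phi> (r, s) = \<Phi> (r', s')"
    by (auto simp: inj_on_def)
  have ext: "r = r'" if "\<forall>j<J. r j = r' j" "r \<in> V" "r' \<in> V" for r r'
    using that unfolding V_def by (intro PiE_ext) auto
  show ?thesis
  proof (rule that[of "\<lambda>j. r j - r' j" "\<lambda>j. s j - s' j"])
    show "\<exists>j<J. r j - r' j \<noteq> 0 \<or> s j - s' j \<noteq> 0"
      using ne ext[of r r'] ext[of s s'] rs by auto
  next
    show "\<forall>k<l. (\<Sum>j<J. monom 1 j * (coeff (taylor (D ^ l * (r j - r' j))) k div D ^ (l - k))) +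
       a * (\<Sum>j<J. monom 1 j * (coeff (taylor (D ^ (l + h) * (s j - s' j))) k div D ^ (l + h - k))) = 0"
    proof (intro allI impI)
      fix k assume k: "k < l"
      have "c r s k = c r' s' k"
        using fun_cong[OF eq, of k] k by (simp add: \<Phi>_def)
      then have "c (\<lambda>j. r j - r' j) (\<lambda>j. s j - s' j) k = 0"
        by (simp add: c_def right_diff_distrib poly_div_diff_left sum_subtractf algebra_simps)
      then show "(\<Sum>j<J. monom 1 j * (coeff (taylor (D ^ l * (r j - r' j))) k div D ^ (l - k))) +
         a * (\<Sum>j<J. monom 1 j * (coeff (taylor (D ^ (l + h) * (s j - s' j))) k div D ^ (l + h - k)))
           = 0"
        by (simp add: c_def)
    qed
  qed (use rs V in \<open>auto intro: polys_below_diff\<close>)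
qed

lemma sum_degree_power_dvd_le:
  fixes R :: "'a::field poly"
  assumes R: "R \<noteq> 0" and l: "l > 0"
    and W: "\<And>P. P \<in> W \<Longrightarrow> monic_irreducible P" "\<And>P. P \<in> W \<Longrightarrow> P ^ l dvd R"
  shows "l * (\<Sum>P\<in>W. degree P) \<le> degree R"
proof -
  define R' where "R' = smult (inverse (lead_coeff R)) R"
  have R': "lead_coeff R' = 1" "degree R' = degree R" "R' \<noteq> 0" using R by (auto simp: R'_def)
  have dvd: "P ^ l dvd R'" if "P \<in> W" for P
    using W(2)[OF that] by (simp add: R'_def dvd_smult)
  have sub: "W \<subseteq> monic_factors R'"
    using dvd W(1) l dvd_power[of l] by (force simp: monic_factors_def intro: dvd_trans)
  have "l * (\<Sum>P\<in>W. degree P) = (\<Sum>P\<in>W. degree P * l)"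
    by (simp add: sum_distrib_left mult.commute)
  also have "\<dots> \<le> (\<Sum>P\<in>W. degree P * poly_multiplicity P R')"
    using dvd W(1) R'(3) by (intro sum_mono mult_left_mono) (auto simp:
      power_dvd_iff_le_poly_multiplicity)
  also have "\<dots> \<le> (\<Sum>P\<in>monic_factors R'. degree P * poly_multiplicity P R')"
    using sub finite_monic_factors[OF R'(1)] by (intro sum_mono2) auto
  also have "\<dots> = degree R"
    using degree_eq_sum_monic_factors[OF R'(1)] R'(2) by simp
  finally show ?thesis .
qed

text \<open>The factor D^l leaves D^(l-k) in every derivative of order k < l, so this power can be
  cancelled and only relations of low degree remain. They use \<open>a\<close> for D^h, which is
  right modulo the counted primes; hence \<open>R\<close> vanishes at these to order l, and its
  degree bounds their number.\<close>

lemma stepanov_bound: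
  fixes D a :: "'a::{field,finite} poly"
  assumes D: "lead_coeff D = 1" "odd (degree D)" and a: "a \<in> {1, -1}"
    and Q: "CARD('a) ^ n = 2 * h + 1" and l: "0 < l" "l \<le> CARD('a) ^ n"
    and m: "m > 0" "2 * m + degree D \<le> CARD('a) ^ n"
    and count: "l * (m + l * degree D + J) < 2 * J * m"
  shows "l * (\<Sum>P | P \<in> irreducibles_dividing n \<and> P dvd D ^ h - a. degree P)
    \<le> l * degree D + h * degree D + m + J * CARD('a) ^ n"
proof -
  let ?Q = "CARD('a) ^ n" and ?d = "degree D"
  have d: "degree D > 0" and D0: "D \<noteq> 0" using D by (auto intro: odd_pos)
  obtain r s :: "nat \<Rightarrow> 'a poly" where "\<forall>j<J. r j \<in> polys_below m" "\<forall>j<J. s j \<in> polys_below m"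
    and ne: "\<exists>j<J. r j \<noteq> 0 \<or> s j \<noteq> 0"
    and eq': "\<forall>k<l. (\<Sum>j<J. monom 1 j * (coeff (taylor (D ^ l * r j)) k div D ^ (l - k))) +
       a * (\<Sum>j<J. monom 1 j * (coeff (taylor (D ^ (l + h) * s j)) k div D ^ (l + h - k))) = 0"
    using stepanov_pigeonhole[OF D(1) d m(1) a count, where h = h] .
  then have rs: "\<And>j. j < J \<Longrightarrow> r j \<in> polys_below m" "\<And>j. j < J \<Longrightarrow> s j \<in> polys_below m" by auto
  note eq = eq'[rule_format]
  define G where "G j = D ^ l * r j + D ^ (l + h) * s j" for j
  \<comment> \<open>The factor x^j is left out of the Taylor expansion: in the relations it costs
    only degree j, whereas substituting x^Q into the coefficients turns it into x^(jQ) in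
    \<open>R\<close>.\<close>
  define U where "U = (\<Sum>j<J. smult (monom 1 j) (taylor (G j)))"
  define A where "A = (\<Sum>j<J. monom 1 (j * ?Q) * r j)"
  define B where "B = (\<Sum>j<J. monom 1 (j * ?Q) * s j)"
  define R where "R = D ^ l * (A + D ^ h * B)"
  have R0: "R \<noteq> 0"
  proof
    assume "R = 0"
    then have "A + D ^ h * B = 0" using D0 by (simp add: R_def)
    from stepanov_nonzero[OF D(2) Q m(2) rs this[unfolded A_def B_def]] ne show False by blast
  qed
  have "eval2 ([:0, 1:] ^ ?Q) ([:0, 1:] - [:0, 1:] ^ ?Q) U
      = (\<Sum>j<J. (monom 1 j \<circ>\<^sub>p [:0, 1:] ^ ?Q) * G j)"
    by (simp add: U_def eval2_sum eval2_taylor)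
  also have "\<dots> = (\<Sum>j<J. monom 1 (j * ?Q) * G j)"
  proof -
    have "monom 1 j \<circ>\<^sub>p y = y ^ j" for j and y :: "'a poly"
      by (induction j) (simp_all add: monom_0 monom_Suc pcompose_pCons pcompose_const)
    then show ?thesis by (simp add: monom_altdef mult.commute flip: power_mult)
  qed
  also have "\<dots> = R"
    by (simp add: R_def A_def B_def G_def distrib_left sum_distrib_left sum.distrib power_add mult_ac)
  finally have eval: "eval2 ([:0, 1:] ^ ?Q) ([:0, 1:] - [:0, 1:] ^ ?Q) U = R" .
  have coeff_U: "coeff U k = D ^ (l - k) * ((D ^ h - a) *
      (\<Sum>j<J. monom 1 j * (coeff (taylor (D ^ (l + h) * s j)) k div D ^ (l + h - k))))" if k: "k
        < l" for k
  proof -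
    let ?r = "\<lambda>j. coeff (taylor (D ^ l * r j)) k div D ^ (l - k)"
    let ?s = "\<lambda>j. coeff (taylor (D ^ (l + h) * s j)) k div D ^ (l + h - k)"
    have r: "coeff (taylor (D ^ l * r j)) k = D ^ (l - k) * ?r j" for j
      using power_dvd_coeff_taylor[of D l k "r j"] by simp
    have s: "coeff (taylor (D ^ (l + h) * s j)) k = D ^ (l - k) * (D ^ h * ?s j)" for j
    proof -
      have "coeff (taylor (D ^ (l + h) * s j)) k = D ^ (l + h - k) * ?s j"
        using power_dvd_coeff_taylor[of D "l + h" k "s j"] by simp
      moreover have "D ^ (l + h - k) = D ^ (l - k) * D ^ h"
        using k by (simp flip: power_add)
      ultimately show ?thesis by (metis mult.assoc)
    qed
    have "coeff U k = (\<Sum>j<J. monom 1 j * (coeff (taylor (D ^ l * r j)) k + coeff (taylor (D ^ (l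
        + h) * s j)) k))"
      by (simp only: U_def G_def coeff_sum coeff_smult taylor_add coeff_add)
    also have "\<dots> = (\<Sum>j<J. monom 1 j * (D ^ (l - k) * ?r j + D ^ (l - k) * (D ^ h * ?s j)))"
      by (simp only: r[symmetric] s[symmetric])
    also have "\<dots> = D ^ (l - k) * ((\<Sum>j<J. monom 1 j * ?r j) + D ^ h * (\<Sum>j<J. monom 1 j * ?s j))"
      by (simp add: sum_distrib_left sum.distrib algebra_simps)
    \<comment> \<open>The relation replaces the first sum by -a times the second, which makes D^h -
      a a factor.\<close>
    also have "(\<Sum>j<J. monom 1 j * ?r j) = - (a * (\<Sum>j<J. monom 1 j * ?s j))"
      using eq[OF k] by (simp add: eq_neg_iff_add_eq_0)
    finally show ?thesis by (simp add: algebra_simps)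
  qed
  have "l * (\<Sum>P | P \<in> irreducibles_dividing n \<and> P dvd D ^ h - a. degree P) \<le> degree R"
  proof (rule sum_degree_power_dvd_le[OF R0 l(1)])
    fix P assume "P \<in> {P. P \<in> irreducibles_dividing n \<and> P dvd D ^ h - a}"
    then have P: "monic_irreducible P" "degree P dvd n" "P dvd D ^ h - a"
      by (auto simp: irreducibles_dividing_def)
    then show "monic_irreducible P" by simp
    show "P ^ l dvd R"
      unfolding eval[symmetric]
      by (rule power_dvd_eval2_taylor[OF monic_irreducible_dvd_power_card[OF P(1,2)] _ l(2)])
         (use P(3) in \<open>simp add: coeff_U\<close>)
  qed
  also have "degree R \<le> l * ?d + (h * ?d + m + J * ?Q)"
  proof -
    have sum_deg: "degree (\<Sum>j<J. monom 1 (j * ?Q) * t j) \<le> m + J * ?Q"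
      if "\<And>j. j < J \<Longrightarrow> t j \<in> polys_below m" for t :: "nat \<Rightarrow> 'a poly"
    proof (rule degree_sum_le)
      fix j assume "j \<in> {..<J}"
      then have j: "j < J" by simp
      have "degree (monom 1 (j * ?Q) * t j) \<le> degree (monom (1::'a) (j * ?Q)) + degree (t j)"
        by (rule degree_mult_le)
      also have "\<dots> \<le> J * ?Q + m"
        using that[OF j] m(1) j by (intro add_mono) (auto simp: degree_monom_eq polys_below_iff_degree)
      finally show "degree (monom 1 (j * ?Q) * t j) \<le> m + J * ?Q" by simp
    qed simp
    have "degree (D ^ h * B) \<le> h * ?d + (m + J * ?Q)"
      using sum_deg[of s, OF rs(2)] by (intro order.trans[OF degree_mult_le] add_mono) (auto simp:
        B_def D0 degree_power_eq)
    moreover have "degree A \<le> h * ?d + (m + J * ?Q)"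
      using sum_deg[of r, OF rs(1)] by (simp add: A_def)
    ultimately have "degree (A + D ^ h * B) \<le> h * ?d + (m + J * ?Q)"
      by (intro degree_add_le)
    then show ?thesis
      unfolding R_def by (intro order.trans[OF degree_mult_le] add_mono) (auto simp: D0 degree_power_eq)
  qed
  finally show ?thesis by simp
qed

section \<open>From divisibility to character sums\<close>

text \<open>Put n = k deg P and Q = q^(deg P). Then (Q^k - 1)/2 is (Q - 1)/2 times a sum of k odd
  numbers, which has the parity of k. For a base in {-1, 0, 1} the exponent matters only through its
  parity, both exponents being positive.\<close>

lemma ac_eval_power_eq_quad_char:
  fixes P :: "'a::{field,finite} poly"
  assumes odd: "odd CARD('a)" and P: "P \<in> irreducibles_dividing n" and n: "n > 0"
    and \<alpha>: "ac_eval \<alpha> P = 0"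
  shows "ac_eval \<alpha> D ^ ((CARD('a) ^ n - 1) div 2) = of_int (quad_char D P ^ (n div degree P))"
proof -
  have Pi: "monic_irreducible P" and dvd: "degree P dvd n" using P
    by (auto simp: irreducibles_dividing_def)
  let ?Q = "CARD('a) ^ degree P"
  obtain k where k: "n = degree P * k" using dvd by (elim dvdE)
  have kd: "n div degree P = k" using monic_irreducible_degree_pos[OF Pi] by (simp add: k)
  have k0: "k > 0" using n k by (cases k) auto
  have "odd ?Q" using odd by simp
  then obtain h where h: "?Q = 2 * h + 1" by (elim oddE)
  have char: "quad_char D P = legendre_symbol D P"
  proof (rule of_int_alg_closure_eq_imp[OF odd])
    show "of_int (quad_char D P) = (of_int (legendre_symbol D P) :: 'a alg_closure)"
      using Pi ac_res_monic_irreducible[OF Pi odd, of D]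
      by (simp add: quad_char_eq_ac_res[OF odd] monic_irreducible_def)
  qed (auto simp: abs_quad_char_le legendre_symbol_def)
  have eul: "ac_eval \<alpha> D ^ h = of_int (quad_char D P)"
    using euler_criterion[OF Pi \<alpha> odd, of D] by (simp add: h char)
  let ?S = "\<Sum>i<k. ?Q ^ i"
  have "CARD('a) ^ n = Suc (2 * h) ^ k"
    by (simp only: k power_mult h) simp
  also have "\<dots> = 2 * (h * ?S) + 1"
    using geometric_sum_nat[of "2 * h" k] by (simp add: h mult_ac)
  finally have "(CARD('a) ^ n - 1) div 2 = h * ?S" by simp
  then have "ac_eval \<alpha> D ^ ((CARD('a) ^ n - 1) div 2) = of_int (quad_char D P ^ ?S)"
    by (simp add: power_mult eul)
  also have "quad_char D P ^ ?S = quad_char D P ^ k"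
  proof -
    have par: "even ?S \<longleftrightarrow> even k"
      using \<open>odd ?Q\<close> by (induction k) auto
    have "?S > 0" using k0 \<open>odd ?Q\<close> by (intro sum_pos) (auto simp: lessThan_empty_iff intro: odd_pos)
    have "quad_char D P \<in> {-1, 0, 1}" using abs_quad_char_le[of D P] by auto
    then show ?thesis using par \<open>?S > 0\<close> k0 by (auto simp: minus_one_power_iff zero_power)
  qed
  finally show ?thesis by (simp add: kd)
qed

lemma dvd_power_iff_quad_char:
  fixes P :: "'a::{field,finite} poly"
  assumes odd: "odd CARD('a)" and P: "P \<in> irreducibles_dividing n" and n: "n > 0"
  defines "h \<equiv> (CARD('a) ^ n - 1) div 2"
  shows "P dvd D ^ h - 1 \<longleftrightarrow> quad_char D P ^ (n div degree P) = 1"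
    and "P dvd D ^ h - (- 1) \<longleftrightarrow> quad_char D P ^ (n div degree P) = -1"
    and "quad_char D P ^ (n div degree P) = 0 \<Longrightarrow> P dvd D"
proof -
  have Pi: "monic_irreducible P" using P by (auto simp: irreducibles_dividing_def)
  obtain \<alpha> where \<alpha>: "ac_eval \<alpha> P = 0" using monic_irreducible_root_exists[OF Pi] .
  note eq = ac_eval_power_eq_quad_char[OF odd P n \<alpha>, of D, folded h_def]
  note dvd = ac_eval_eq_0_iff_dvd[OF Pi \<alpha>, symmetric]
  have small: "\<bar>quad_char D P ^ (n div degree P)\<bar> \<le> 1"
    by (simp add: power_abs power_le_one abs_quad_char_le)
  have "P dvd D ^ h - 1 \<longleftrightarrow> of_int (quad_char D P ^ (n div degree P)) = (of_int 1 :: 'a alg_closure)"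
    unfolding dvd by (simp only: ac_eval_diff ac_eval_power eq ac_eval_1 right_minus_eq of_int_1)
  then show "P dvd D ^ h - 1 \<longleftrightarrow> quad_char D P ^ (n div degree P) = 1"
    using of_int_alg_closure_eq_imp[OF odd _ small, of 1] by (auto simp del: of_int_power of_int_1)
  have "P dvd D ^ h - (- 1) \<longleftrightarrow> of_int (quad_char D P ^ (n div degree P))
      = (of_int (-1) :: 'a alg_closure)"
    unfolding dvd
    by (simp only: ac_eval_diff ac_eval_power eq ac_eval_minus ac_eval_1 right_minus_eq of_int_1
      of_int_minus)
  then show "P dvd D ^ h - (- 1) \<longleftrightarrow> quad_char D P ^ (n div degree P) = -1"
    using of_int_alg_closure_eq_imp[OF odd _ small, of "-1"]
    by (auto simp del: of_int_power of_int_1 of_int_minus diff_minus_eq_add)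
  show "P dvd D" if "quad_char D P ^ (n div degree P) = 0"
    using eq that unfolding dvd by simp
qed

text \<open>Primes with character value 0 divide \<open>D\<close>, so their degrees add up to at
  most deg D. The second conclusion converts an upper bound for either count into a lower bound for
  the other.\<close>

lemma prime_power_sum_eq_diff:
  fixes D :: "'a::{field,finite} poly" and n :: nat
  assumes odd: "odd CARD('a)" and n: "n > 0" and D: "D \<noteq> 0"
  defines "h \<equiv> (CARD('a) ^ n - 1) div 2"
  defines "N \<equiv> \<lambda>a. \<Sum>P | P \<in> irreducibles_dividing n \<and> P dvd D ^ h - a. degree P"
  shows "prime_power_sum D n = int (N 1) - int (N (- 1))"
    and "CARD('a) ^ n \<le> N 1 + N (- 1) + degree D"
proof -
  let ?I = "irreducibles_dividing n :: 'a poly set"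
  let ?c = "\<lambda>P. quad_char D P ^ (n div degree P)"
  note fin = finite_irreducibles_dividing[OF n, where ?'a = 'a]
  note dvd = dvd_power_iff_quad_char[OF odd _ n, of _ D, folded h_def]
  define Z where "Z a = {P\<in>?I. ?c P = a}" for a
  have N: "N 1 = (\<Sum>P\<in>Z 1. degree P)" "N (- 1) = (\<Sum>P\<in>Z (-1). degree P)"
    unfolding N_def Z_def by (auto intro!: sum.cong simp: dvd simp del: diff_minus_eq_add)
  have "?c P \<in> {-1, 0, 1}" for P
  proof -
    have "b \<in> {-1, 0, 1}" if "\<bar>b\<bar> \<le> 1" for b :: int using that by auto
    then show ?thesis by (simp only: power_abs power_le_one abs_quad_char_le abs_ge_zero)
  qed
  then have I: "?I = Z 1 \<union> Z (-1) \<union> Z 0" by (auto simp: Z_def)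
  have finZ: "finite (Z a)" for a using fin by (simp add: Z_def)
  have split: "(\<Sum>P\<in>?I. g P) = (\<Sum>P\<in>Z 1. g P) + (\<Sum>P\<in>Z (-1). g P) + (\<Sum>P\<in>Z 0. g P)"
    for g :: "'a poly \<Rightarrow> 'b::comm_monoid_add"
  proof -
    have "sum g (Z 1 \<union> Z (-1) \<union> Z 0) = sum g (Z 1 \<union> Z (-1)) + sum g (Z 0)"
      by (rule sum.union_disjoint) (auto simp: Z_def fin simp del: power_eq_0_iff)
    also have "sum g (Z 1 \<union> Z (-1)) = sum g (Z 1) + sum g (Z (-1))"
      by (rule sum.union_disjoint) (auto simp: Z_def fin simp del: power_eq_0_iff)
    finally show ?thesis by (simp only: I)
  qed
  have "prime_power_sum D n = (\<Sum>P\<in>Z 1. int (degree P) * ?c P) + (\<Sum>P\<in>Z (-1). int (degree P) * ?c P)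
      + (\<Sum>P\<in>Z 0. int (degree P) * ?c P)"
    unfolding prime_power_sum_def by (rule split)
  also have "\<dots> = (\<Sum>P\<in>Z 1. int (degree P)) + (\<Sum>P\<in>Z (-1). - int (degree P)) + (\<Sum>P\<in>Z 0. 0)"
    by (intro arg_cong2[of _ _ _ _ "(+)"] sum.cong) (auto simp: Z_def)
  finally show "prime_power_sum D n = int (N 1) - int (N (- 1))"
    by (simp add: N sum_negf)
  have "1 * (\<Sum>P\<in>Z 0. degree P) \<le> degree D"
    by (rule sum_degree_power_dvd_le[OF D]) (auto simp: Z_def irreducibles_dividing_def dvd(3))
  then show "CARD('a) ^ n \<le> N 1 + N (- 1) + degree D"
    using split[of degree] sum_degree_irreducibles_dividing[OF n, where ?'a = 'a] by (simp add: N)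
qed

text \<open>With l about the square root of Q and J about l/2, the main term J Q / l is Q/2; all
  other terms are of order d q l. Here m is the largest value compatible with 2m + d \<le> Q. The
  divisions by 2 are exact because Q, l and d are odd.\<close>

lemma stepanov_count:
  fixes D a :: "'a::{field,finite} poly"
  assumes odd: "odd CARD('a)" and D: "lead_coeff D = 1" "odd (degree D)" and a: "a \<in> {1, -1}"
    and n: "n > 0" and Q: "2 * degree D \<le> CARD('a) ^ n" and l4: "4 \<le> CARD('a) ^ (n div 2)"
  shows "2 * (\<Sum>P | P \<in> irreducibles_dividing n \<and> P dvd D ^ ((CARD('a) ^ n - 1) div 2) - a. degree P)
    \<le> CARD('a) ^ n + 2 * degree D + (9 * degree D + 6) * (CARD('a) * CARD('a) ^ (n div 2))"
proof -
  define Q where "Q = CARD('a) ^ n"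
  define l where "l = CARD('a) ^ (n div 2)"
  define d where "d = degree D"
  define q where "q = CARD('a)"
  define h where "h = (Q - 1) div 2"
  define m where "m = (Q - d) div 2"
  \<comment> \<open>The excess 8 d + 5 reduces the counting condition to l^2 d + l J < (8 d + 5) m.
    From l^2 \<le> Q and 4 l \<le> Q the left side is at most (2 d + 9/8) Q; from m \<ge> Q/4 the
    right side is at least (2 d + 5/4) Q.\<close>
  define J where "J = (l + 8 * d + 5) div 2"
  define N where "N = (\<Sum>P | P \<in> irreducibles_dividing n \<and> P dvd D ^ h - a. degree P)"
  have oddQ: "odd Q" "odd l" using odd by (simp_all add: Q_def l_def)
  have d1: "d \<ge> 1" "odd d" using D by (auto simp: d_def intro: Suc_leI odd_pos)
  have Qd: "2 * d \<le> Q" using Q by (simp add: Q_def d_def)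
  have h: "Q = 2 * h + 1" using oddQ by (simp add: h_def)
  have m: "2 * m + d = Q" using oddQ d1 Qd by (simp add: m_def)
  have J: "2 * J = l + 8 * d + 5" using oddQ by (simp add: J_def)
  have l: "l \<ge> 4" using l4 by (simp add: l_def)
  have ll: "l * l \<le> Q"
    unfolding l_def Q_def power_add[symmetric] using card_field_gt_1[where ?'a = 'a]
    by (intro power_increasing) auto
  have Ql: "Q \<le> q * l * l"
  proof -
    have "q * l * l = q ^ Suc (n div 2 + n div 2)" by (simp add: q_def l_def power_add)
    moreover have "Q \<le> q ^ Suc (n div 2 + n div 2)"
      unfolding Q_def q_def using card_field_gt_1[where ?'a = 'a] by (intro power_increasing) auto
    ultimately show ?thesis by (simp only:)
  qed
  have m0: "m > 0" using m Qd d1 by auto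
  have l4': "4 * l \<le> Q" using ll l by (meson mult_le_mono1 order.trans)
  have count: "l * (m + l * d + J) < 2 * J * m"
  proof -
    have "l * l * d \<le> Q * d" using ll by simp
    moreover have "8 * (l * J) = 4 * (l * l) + (8 * d + 5) * (4 * l)"
      using arg_cong[OF J, of "\<lambda>x. 4 * l * x"] by (simp add: algebra_simps)
    moreover have "(8 * d + 5) * (4 * l) \<le> (8 * d + 5) * Q" using l4' by (rule mult_left_mono) simp
    moreover have "(8 * d + 5) * (2 * Q) \<le> (8 * d + 5) * (8 * m)"
      using m Qd by (intro mult_left_mono) auto
    moreover have "Q > 0" using h by simp
    ultimately have "8 * (l * l * d + l * J) < 8 * ((8 * d + 5) * m)"
      using ll by (simp only: algebra_simps)
    then have "l * l * d + l * J < (8 * d + 5) * m" by simp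
    moreover have "2 * J * m = l * m + (8 * d + 5) * m" by (simp add: J distrib_right)
    ultimately show ?thesis by (simp only: distrib_left mult.assoc mult.left_commute)
  qed
  have "l \<le> Q" using l4' by simp
  then have "l * N \<le> l * d + h * d + m + J * Q"
    using stepanov_bound[OF D a, of n h l m J] oddQ h l m0 m count
    by (simp add: N_def Q_def[symmetric] d_def)
  then have "l * (2 * N) \<le> 2 * (l * d) + 2 * h * d + 2 * m + 2 * J * Q"
    by simp
  also have "\<dots> \<le> 2 * (l * d) + Q * d + Q + (l + 8 * d + 5) * Q"
    using h m by (intro add_mono) (simp_all add: J)
  also have "\<dots> = l * (Q + 2 * d) + (9 * d + 6) * Q"
    by (simp add: algebra_simps)
  also have "\<dots> \<le> l * (Q + 2 * d) + (9 * d + 6) * (q * l * l)"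
    using Ql by simp
  also have "\<dots> = l * (Q + 2 * d + (9 * d + 6) * (q * l))"
    by (simp add: algebra_simps)
  finally have "2 * N \<le> Q + 2 * d + (9 * d + 6) * (q * l)"
    using l by simp
  then show ?thesis by (simp only: N_def h_def Q_def d_def q_def l_def)
qed

text \<open>Both counts are at most Q/2 plus an error and together at least Q - d, so they differ by
  at most 3 d plus twice that error without its 2 d share; 12 d + 6 is 9 d + 6 with these 3 d
  absorbed.\<close>

lemma abs_prime_power_sum_le_sqrt:
  fixes D :: "'a::{field,finite} poly"
  assumes odd: "odd CARD('a)" and D: "lead_coeff D = 1" "odd (degree D)" and n: "n > 0"
  shows "\<bar>real_of_int (prime_power_sum D n)\<bar>
    \<le> real ((12 * degree D + 6) * CARD('a)) * sqrt (real CARD('a)) ^ n"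
proof -
  define q where "q = CARD('a)"
  define l where "l = q ^ (n div 2)"
  define d where "d = degree D"
  have q1: "q > 1" unfolding q_def by (rule card_field_gt_1)
  have l1: "l \<ge> 1" using q1 by (simp add: l_def)
  have d1: "d \<ge> 1" using D by (auto simp: d_def intro: Suc_leI odd_pos)
  have "\<bar>prime_power_sum D n\<bar> \<le> int ((12 * d + 6) * (q * l))"
  proof (cases "4 + 2 * d \<le> l")
    case True
    define N where "N a = (\<Sum>P | P \<in> irreducibles_dividing n
        \<and> P dvd D ^ ((CARD('a) ^ n - 1) div 2) - a. degree P)" for a
    have D0: "D \<noteq> 0" using D by auto
    have "l \<le> q ^ n" unfolding l_def using q1 by (intro power_increasing) auto
    then have cond: "2 * degree D \<le> CARD('a) ^ n" "4 \<le> CARD('a) ^ (n div 2)"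
      using True by (simp_all add: q_def[symmetric] d_def[symmetric] l_def)
    have N: "2 * N a \<le> q ^ n + 2 * d + (9 * d + 6) * (q * l)" if "a \<in> {1, -1}" for a
      using stepanov_count[OF odd D that n cond] by (simp only: N_def q_def d_def l_def)
    note eq = prime_power_sum_eq_diff[OF odd n D0, folded N_def]
    have ql: "d \<le> d * (q * l)" using q1 l1 by simp
    define U where "U = (9 * d + 6) * (q * l)"
    define V where "V = d * (q * l)"
    have "2 * N 1 \<le> q ^ n + 2 * d + U" "2 * N (- 1) \<le> q ^ n + 2 * d + U" "d \<le> V"
      using N[OF insertI1] N[OF insertI2[OF insertI1]] ql by (simp_all only: U_def V_def)
    moreover have "q ^ n \<le> N 1 + N (- 1) + d"
      using eq(2) by (simp only: q_def d_def)
    ultimately have "\<bar>int (N 1) - int (N (- 1))\<bar> \<le> int (U + 3 * V)"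
      by linarith
    also have "U + 3 * V = (12 * d + 6) * (q * l)"
      by (simp add: U_def V_def algebra_simps)
    finally show ?thesis unfolding eq(1) .
  next
    case False
    \<comment> \<open>For small l the conditions of the count may fail, but then q^n \<le> q l l and
      l < 4 + 2 d, so the trivial bound gives the same constant.\<close>
    have "\<bar>prime_power_sum D n\<bar> \<le> int (q ^ n)"
      using abs_prime_power_sum_le[OF n, of D] by (simp add: q_def)
    also have "q ^ n \<le> q ^ Suc (n div 2 + n div 2)" using q1 by (intro power_increasing) auto
    also have "\<dots> = q * l * l" by (simp add: l_def power_add)
    also have "q * l * l \<le> (12 * d + 6) * (q * l)"
      using False by (simp add: mult.commute mult_le_mono)
    finally show ?thesis by simp
  qed
  then have "\<bar>real_of_int (prime_power_sum D n)\<bar> \<le> real ((12 * d + 6) * (q * l))"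
    by (metis of_int_abs of_int_le_iff of_int_of_nat_eq)
  also have "\<dots> = real ((12 * d + 6) * q) * real l" by simp
  also have "real l \<le> sqrt (real q) ^ n"
  proof -
    have "real l = sqrt (real q) ^ (2 * (n div 2))"
      using q1 by (simp add: l_def power_mult)
    also have "\<dots> \<le> sqrt (real q) ^ n"
      using q1 by (intro power_increasing) auto
    finally show ?thesis .
  qed
  finally show ?thesis by (simp add: q_def d_def mult_left_mono)
qed

section \<open>A trigonometric majorant of the sawtooth function\<close>

lemma t_cos_le_sin: "t * cos t \<le> sin t" if "0 \<le> t" "t \<le> pi"
proof -
  have "sin 0 - 0 * cos 0 \<le> sin t - t * cos t"
  proof (rule DERIV_nonneg_imp_nondecreasing[OF that(1)])
    fix x assume x: "0 \<le> x" "x \<le> t"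
    have "((\<lambda>x. sin x - x * cos x) has_real_derivative x * sin x) (at x)"
      by (auto intro!: derivative_eq_intros)
    moreover have "x * sin x \<ge> 0" using x that by (intro mult_nonneg_nonneg sin_ge_zero) auto
    ultimately show "\<exists>y. ((\<lambda>x. sin x - x * cos x) has_real_derivative y) (at x) \<and> 0 \<le> y" by blast
  qed
  then show ?thesis by simp
qed

text \<open>The function t cot t is even and concave on (-pi, pi) once filled in by 1 at 0. To avoid
  that point, concavity is used on (0, pi) only. If \<open>a\<close> and \<open>b\<close> have
  opposite signs, say a < 0 < b, then a cot a \<le> 1, while the tangent at \<open>b\<close> has the
  value b^2 / sin^2 b \<ge> 1 at 0 and increases to the left.\<close>

lemma mult_cot_tangent:
  fixes a b :: real
  assumes a: "\<bar>a\<bar> < pi" "a \<noteq> 0" and b: "\<bar>b\<bar> < pi" "b \<noteq> 0"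
  shows "a * cot a \<le> b * cot b + (a - b) * (cot b - b / (sin b)\<^sup>2)"
proof -
  have main: "a * cot a \<le> b * cot b + (a - b) * (cot b - b / (sin b)\<^sup>2)"
    if a: "\<bar>a\<bar> < pi" "a \<noteq> 0" and b: "0 < b" "b < pi" for a b :: real
  proof (cases "a > 0")
    case True
    have sin: "sin x > 0" if "x \<in> {0<..<pi}" for x using that by (simp add: sin_gt_zero)
    have "convex_on {0<..<pi} (\<lambda>t. - (t * cot t))"
    proof (rule f''_ge0_imp_convex[where f' = "\<lambda>t. t / (sin t)\<^sup>2 - cot t"
          and f'' = "\<lambda>t. 2 * (sin t - t * cos t) / (sin t) ^ 3"])
      fix t :: real assume t: "t \<in> {0<..<pi}"
      note s = sin[OF t]
      show "((\<lambda>t. - (t * cot t)) has_real_derivative t / (sin t)\<^sup>2 - cot t) (at t)"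
        using s by (auto intro!: derivative_eq_intros DERIV_cot simp: field_simps)
      show "((\<lambda>t. t / (sin t)\<^sup>2 - cot t) has_real_derivative 2 * (sin t
          - t * cos t) / (sin t) ^ 3) (at t)"
      proof -
        have "((\<lambda>t. t / (sin t)\<^sup>2 - cot t) has_real_derivative
            (1 * (sin t)\<^sup>2 - t * (2 * sin t * cos t)) / ((sin t)\<^sup>2 * (sin t)\<^sup>2)
              - - inverse ((sin t)\<^sup>2)) (at t)"
          using s by (auto intro!: derivative_eq_intros DERIV_cot)
        also have "(1 * (sin t)\<^sup>2 - t * (2 * sin t * cos t)) / ((sin t)\<^sup>2 * (sin t)\<^sup>2)
            - - inverse ((sin t)\<^sup>2)
            = 2 * (sin t - t * cos t) / (sin t) ^ 3"
          using s by (simp add: field_simps power2_eq_square power3_eq_cube)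
        finally show ?thesis .
      qed
      show "0 \<le> 2 * (sin t - t * cos t) / (sin t) ^ 3"
        using s t t_cos_le_sin[of t] by (auto intro!: divide_nonneg_pos)
    qed simp
    then have "(b / (sin b)\<^sup>2 - cot b) * (a - b) \<le> - (a * cot a) - - (b * cot b)"
    proof (rule convex_on_imp_above_tangent)
      show "connected {0<..<pi::real}" by simp
      show "b \<in> interior {0<..<pi}" using b by (simp add: interior_open)
      show "((\<lambda>t. - (t * cot t)) has_real_derivative b / (sin b)\<^sup>2 - cot b) (at b within {0<..<pi})"
        using sin[of b] b by (auto intro!: derivative_eq_intros DERIV_subset[OF DERIV_cot] simp:
          field_simps)
      show "a \<in> {0<..<pi}" using True a by auto
    qed
    then show ?thesis by (simp add: algebra_simps)
  next
    case False
    then have a0: "a < 0" using a by simp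
    have s: "sin b > 0" using b by (simp add: sin_gt_zero)
    have "a * cot a \<le> 1"
    proof -
      have "- a * cos (- a) \<le> sin (- a)" using a a0 by (intro t_cos_le_sin) auto
      moreover have "sin (- a) > 0" using a a0 by (intro sin_gt_zero) auto
      ultimately show ?thesis by (simp add: cot_def field_simps)
    qed
    also have "1 \<le> b\<^sup>2 / (sin b)\<^sup>2"
    proof -
      have "sin b \<le> b" using b by (intro sin_x_le_x) auto
      then have "(sin b)\<^sup>2 \<le> b\<^sup>2" using s by (intro power_mono) auto
      then show ?thesis using s by (simp add: field_simps)
    qed
    also have "\<dots> \<le> b\<^sup>2 / (sin b)\<^sup>2 + (- a) * (b / (sin b)\<^sup>2 - cot b)"
    proof -
      have "cos b * sin b \<le> b"
      proof -
        have "cos b * sin b \<le> 1 * sin b" using s by (intro mult_right_mono) auto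
        also have "\<dots> \<le> b" using b sin_x_le_x[of b] by simp
        finally show ?thesis .
      qed
      then have "cot b \<le> b / (sin b)\<^sup>2"
        using s by (simp add: cot_def field_simps power2_eq_square)
      then show ?thesis using a0 by (auto simp: mult_nonpos_nonneg intro!: mult_nonpos_nonneg)
    qed
    also have "\<dots> = b * cot b + (a - b) * (cot b - b / (sin b)\<^sup>2)"
      by (simp add: algebra_simps power2_eq_square add_divide_distrib diff_divide_distrib)
    finally show ?thesis .
  qed
  show ?thesis
  proof (cases "b > 0")
    case True
    then show ?thesis using main[of a b] a b by auto
  next
    case False
    then show ?thesis using main[of "- a" "- b"] a b
      by (simp add: algebra_simps cot_def diff_divide_distrib)
  qed
qed

section \<open>Fejer kernel, conjugate kernel and their shifts\<close>

text \<open>This is sin^2(M t) / sin^2 t, or M times the Fejer kernel in the half-angle variable, as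
  a cosine polynomial that also makes sense where sin t = 0.\<close>

definition fejer :: "nat \<Rightarrow> real \<Rightarrow> real" where
  "fejer M t = real M + 2 * (\<Sum>j=1..<M. (real M - real j) * cos (2 * real j * t))"

lemma dirichlet_kernel:
  "(1 + 2 * (\<Sum>j=1..<Suc M. cos (2 * real j * t))) * sin t = sin (real (2 * M + 1) * t)"
proof (induction M)
  case (Suc M)
  have "2 * cos (2 * real (Suc M) * t) * sin t
      = sin (real (2 * Suc M + 1) * t) - sin (real (2 * M + 1) * t)"
    using sin_diff_sin[of "real (2 * Suc M + 1) * t" "real (2 * M + 1) * t"]
    by (simp add: algebra_simps add_divide_distrib diff_divide_distrib)
  with Suc show ?case by (simp add: algebra_simps)
qed simp

lemma sin_power2_diff: "(sin (x + y))\<^sup>2 - (sin x)\<^sup>2 = sin (2 * x + y) * sin y" for x y :: real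
proof -
  have "cos (2 * x) = 1 - 2 * (sin x)\<^sup>2" "cos (2 * (x + y)) = 1 - 2 * (sin (x + y))\<^sup>2"
    by (rule cos_double_sin)+
  moreover have "sin (2 * x + y) * sin y = (cos (2 * x) - cos (2 * (x + y))) / 2"
    using sin_times_sin[of "2 * x + y" y] by (simp add: algebra_simps)
  ultimately show ?thesis by simp
qed

lemma fejer_mult_sin: "fejer M t * (sin t)\<^sup>2 = (sin (real M * t))\<^sup>2"
proof (induction M)
  case (Suc M)
  have "fejer (Suc M) t = fejer M t + (1 + 2 * (\<Sum>j=1..<Suc M. cos (2 * real j * t)))"
  proof -
    have "(\<Sum>j=1..<Suc M. (real (Suc M) - real j) * cos (2 * real j * t))
        = (\<Sum>j=1..<Suc M. (real M - real j) * cos (2 * real j * t))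
          + (\<Sum>j=1..<Suc M. cos (2 * real j * t))"
      unfolding sum.distrib[symmetric] by (rule sum.cong) (auto simp: algebra_simps)
    also have "(\<Sum>j=1..<Suc M. (real M - real j) * cos (2 * real j * t))
        = (\<Sum>j=1..<M. (real M - real j) * cos (2 * real j * t))"
      by (cases "M = 0") auto
    finally show ?thesis by (simp add: fejer_def algebra_simps)
  qed
  then have "fejer (Suc M) t * (sin t)\<^sup>2 = (sin (real M * t))\<^sup>2 + sin (real (2 * M + 1) * t) * sin t"
    using dirichlet_kernel[of t M] Suc by (simp add: distrib_right power2_eq_square flip: mult.assoc)
  also have "sin (real (2 * M + 1) * t) * sin t = (sin (real (Suc M) * t))\<^sup>2 - (sin (real M * t))\<^sup>2"
    using sin_power2_diff[of "real M * t" t] by (simp add: algebra_simps)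
  finally show ?case by simp
qed (simp add: fejer_def)

text \<open>Divided by sin t, this says that the factor sin^2(M t) turns cot t into a sine
  polynomial up to a term depending on M t alone.\<close>

lemma conjugate_dirichlet_kernel:
  "(sin (real M * t))\<^sup>2 * cos t = sin t * ((\<Sum>j=1..<M. sin (2 * real j * t))
      + sin (real M * t) * cos (real M * t))"
proof (induction M)
  case (Suc M)
  define x where "x = real M * t"
  have "(\<Sum>j=1..<Suc M. sin (2 * real j * t)) = (\<Sum>j=1..<M. sin (2 * real j * t)) + sin (2 * x)"
    by (cases "M = 0") (simp_all add: x_def mult.assoc)
  moreover have "real (Suc M) * t = x + t" by (simp add: x_def algebra_simps)
  moreover have "(sin (x + t))\<^sup>2 * cos t - (sin x)\<^sup>2 * cos t
      = sin t * (sin (2 * x) + sin (x + t) * cos (x + t) - sin x * cos x)"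
  proof -
    note sin_power2_diff[of x t]
    moreover have "sin (2 * x) + sin (x + t) * cos (x + t) - sin x * cos x = sin (2 * x + t) * cos t"
    proof -
      have "2 * (sin (x + t) * cos (x + t)) = sin (2 * x + 2 * t)" "2 * (sin x * cos x) = sin (2 * x)"
        using sin_double[of "x + t"] sin_double[of x] by (simp_all add: algebra_simps)
      moreover have "2 * (sin (2 * x + t) * cos t) = sin (2 * x + 2 * t) + sin (2 * x)"
        using sin_times_cos[of "2 * x + t" t] by (simp add: algebra_simps)
      ultimately show ?thesis by linarith
    qed
    ultimately show ?thesis by (simp add: algebra_simps left_diff_distrib[symmetric])
  qed
  ultimately show ?case using Suc by (simp add: x_def[symmetric] algebra_simps)
qed simp

lemma sum_cis_shifts:
  assumes "0 < j" "j < M"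
  shows "(\<Sum>k<M. cis (2 * real j * (t - pi * real k / real M))) = 0"
proof -
  let ?w = "cis (- (2 * pi * real j / real M))"
  have M: "M > 0" using assms by simp
  have "cis (2 * real j * (t - pi * real k / real M)) = cis (2 * real j * t) * ?w ^ k" for k
    unfolding Complex.DeMoivre cis_mult by (rule arg_cong[of _ _ cis]) (simp add: algebra_simps)
  then have "(\<Sum>k<M. cis (2 * real j * (t - pi * real k / real M)))
      = cis (2 * real j * t) * (\<Sum>k<M. ?w ^ k)"
    by (simp add: sum_distrib_left)
  also have "(\<Sum>k<M. ?w ^ k) = 0"
  proof -
    have "?w ^ M = cis (- (2 * pi * real j))" using M by (simp add: Complex.DeMoivre)
    also have "\<dots> = 1"
      by (simp add: complex_eq_iff cos_eq_1 sin_times_pi_eq_0 mult.commute[of _ pi])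
         (metis cos_2pi_minus cos_int_2pin sin_int_2pin of_int_of_nat_eq mult.commute mult.assoc)
    finally have "?w ^ M = 1" .
    moreover have "?w \<noteq> 1"
    proof
      assume "?w = 1"
      then have "cos (2 * pi * real j / real M) = 1" by (simp add: complex_eq_iff)
      then obtain n where "2 * pi * real j / real M = of_int n * 2 * pi"
        using cos_one_2pi_int[of "2 * pi * real j / real M"] by auto
      then have "real j = of_int n * real M" using M by (simp add: field_simps)
      then have "int j = n * int M" by (metis of_int_eq_iff of_int_mult of_int_of_nat_eq)
      then have "M dvd j" by (metis dvd_triv_right int_dvd_int_iff)
      with assms show False by (auto dest: dvd_imp_le)
    qed
    ultimately show ?thesis by (simp add: sum_gp_strict)
  qed
  finally show ?thesis by simp
qed

lemma sum_fejer_shifts: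
  assumes M: "M > 0"
  shows "(\<Sum>k<M. fejer M (t - pi * real k / real M)) = (real M)\<^sup>2"
proof -
  have "(\<Sum>k<M. cos (2 * real j * (t - pi * real k / real M))) = 0" if "j \<in> {1..<M}" for j
    using arg_cong[OF sum_cis_shifts[of j M t], of Re] that by simp
  then have "(\<Sum>k<M. \<Sum>j=1..<M. (real M - real j) * cos (2 * real j * (t - pi * real k / real M))) = 0"
    by (subst sum.swap) (simp flip: sum_distrib_left)
  then show ?thesis
    by (simp add: fejer_def sum.distrib power2_eq_square flip: sum_distrib_left)
qed

text \<open>Sum the conjugate kernel identity over the shifts: the frequencies 0 < j < M cancel,
  while sin^2(M t) and the boundary term are the same at every shift.\<close>

lemma sum_cot_shifts:
  assumes M: "M > 0" and ne: "sin (real M * t) \<noteq> 0"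
  shows "(\<Sum>k<M. cot (t - pi * real k / real M)) = real M * cot (real M * t)"
proof -
  let ?t = "\<lambda>k. t - pi * real k / real M"
  have Mt: "real M * ?t k = real M * t - real k * pi" for k
    using M by (simp add: right_diff_distrib)
  have sq: "(sin (real M * ?t k))\<^sup>2 = (sin (real M * t))\<^sup>2" for k
    by (simp add: Mt sin_diff power_mult_distrib flip: power_mult)
  have sc: "sin (real M * ?t k) * cos (real M * ?t k) = sin (real M * t) * cos (real M * t)" for k
    by (simp add: Mt sin_diff cos_diff)
  have nz: "sin (?t k) \<noteq> 0" for k
  proof
    assume "sin (?t k) = 0"
    with fejer_mult_sin[of M "?t k"] sq[of k] ne show False by simp
  qed
  have zero: "(\<Sum>k<M. sin (2 * real j * ?t k)) = 0" if "j \<in> {1..<M}" for j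
    using arg_cong[OF sum_cis_shifts[of j M t], of Im] that by simp
  have "(sin (real M * t))\<^sup>2 * (\<Sum>k<M. cot (?t k))
      = (\<Sum>k<M. (\<Sum>j=1..<M. sin (2 * real j * ?t k)) + sin (real M * t) * cos (real M * t))"
    unfolding sum_distrib_left
  proof (rule sum.cong[OF refl])
    fix k
    show "(sin (real M * t))\<^sup>2 * cot (?t k)
        = (\<Sum>j=1..<M. sin (2 * real j * ?t k)) + sin (real M * t) * cos (real M * t)"
      using conjugate_dirichlet_kernel[of M "?t k"] nz[of k] unfolding sq sc
      by (simp add: cot_def field_simps)
  qed
  also have "\<dots> = (\<Sum>j=1..<M. \<Sum>k<M. sin (2 * real j * ?t k))
      + real M * (sin (real M * t) * cos (real M * t))"
    by (subst sum.swap) (simp add: sum.distrib)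
  also have "\<dots> = real M * (sin (real M * t) * cos (real M * t))"
    using zero by simp
  finally show ?thesis using ne by (simp add: cot_def field_simps power2_eq_square)
qed

text \<open>
  The trigonometric majorant of the sawtooth \<open>1/2 - x\<close> of degree \<open>M - 1\<close>: it interpolates the
  sawtooth at the points \<open>k/M\<close>, with value \<open>1/2\<close> at the jump, and to first order at the others.
\<close>
definition sawtooth_majorant :: "nat \<Rightarrow> real \<Rightarrow> real" where
  "sawtooth_majorant M x =
     (\<Sum>k<M. (1 / 2 - real k / real M) * fejer M (pi * x - pi * real k / real M)) / (real M)\<^sup>2 +
     (\<Sum>j=1..<M. sin (2 * real j * (pi * x))) / (pi * real M)"

text \<open>
  Up to a positive factor, the difference is a right Riemann sum of the increasing function
  \<open>- (t * cot t)'\<close>, minus the integral.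
\<close>
lemma sawtooth_le_majorant_generic:
  assumes M: "M > 0" and x: "0 < x" "x < 1" and ne: "sin (real M * (pi * x)) \<noteq> 0"
  shows "1 / 2 - x \<le> sawtooth_majorant M x"
proof -
  define t where "t k = pi * x - pi * real k / real M" for k
  define T where "T = (sin (real M * (pi * x)))\<^sup>2"
  have T0: "T > 0" using ne by (simp add: T_def)
  have Mt: "real M * t k = real M * (pi * x) - real k * pi" for k
    using M by (simp add: t_def right_diff_distrib)
  have nz: "sin (t k) \<noteq> 0" for k
  proof
    assume "sin (t k) = 0"
    then have "sin (real M * t k) = 0" using fejer_mult_sin[of M "t k"] by simp
    then show False using ne by (simp add: Mt sin_diff)
  qed
  have F: "fejer M (t k) = T / (sin (t k))\<^sup>2" for k
    using fejer_mult_sin[of M "t k"] nz[of k]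
    by (simp add: T_def Mt sin_diff power_mult_distrib field_simps flip: power_mult)
  have range: "\<bar>t k\<bar> < pi" "t k \<noteq> 0" if "k \<le> M" for k
  proof -
    have "t k = pi * (x - real k / real M)" by (simp add: t_def right_diff_distrib)
    moreover have "\<bar>x - real k / real M\<bar> < 1"
    proof -
      have "0 \<le> real k / real M" "real k / real M \<le> 1" using that M by auto
      with x show ?thesis by linarith
    qed
    ultimately show "\<bar>t k\<bar> < pi" by (simp add: abs_mult)
    show "t k \<noteq> 0" using nz[of k] by auto
  qed
  have step: "t (Suc k) * cot (t (Suc k)) - t k * cot (t k)
      \<le> (pi / real M) * (t k / (sin (t k))\<^sup>2 - cot (t k))"
    if k: "k < M" for k
  proof -
    have "t (Suc k) - t k = - (pi / real M)" by (simp add: t_def distrib_left add_divide_distrib)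
    moreover have "t (Suc k) * cot (t (Suc k))
        \<le> t k * cot (t k) + (t (Suc k) - t k) * (cot (t k) - t k / (sin (t k))\<^sup>2)"
      using k by (intro mult_cot_tangent range) auto
    ultimately show ?thesis by (simp only: right_diff_distrib mult_minus_left)
  qed
  have "t M * cot (t M) - t 0 * cot (t 0) = (\<Sum>k<M. t (Suc k) * cot (t (Suc k)) - t k * cot (t k))"
    by (rule sum_lessThan_telescope[of "\<lambda>k. t k * cot (t k)", symmetric])
  also have "\<dots> \<le> (\<Sum>k<M. (pi / real M) * (t k / (sin (t k))\<^sup>2 - cot (t k)))"
    using step by (intro sum_mono) auto
  also have "\<dots> = (pi / real M) * ((\<Sum>k<M. t k / (sin (t k))\<^sup>2) - (\<Sum>k<M. cot (t k)))"
    by (simp only: sum_distrib_left[symmetric] sum_subtractf)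
  also have "t M * cot (t M) - t 0 * cot (t 0) = - pi * cot (pi * x)"
  proof -
    have t: "t M = pi * x - pi" "t 0 = pi * x" using M by (simp_all add: t_def)
    have "cot (pi * x - pi) = cot (pi * x)" by (simp add: cot_def sin_diff cos_diff)
    then show ?thesis unfolding t by (simp add: algebra_simps)
  qed
  finally have "0 \<le> (pi / real M) * ((\<Sum>k<M. t k / (sin (t k))\<^sup>2) - (\<Sum>k<M. cot (t k))
      + real M * cot (pi * x))"
    using M by (simp add: algebra_simps)
  moreover have "pi / real M > 0" using M by simp
  ultimately have "0 \<le> (\<Sum>k<M. t k / (sin (t k))\<^sup>2) - (\<Sum>k<M. cot (t k)) + real M * cot (pi * x)"
    by (meson not_less zero_le_mult_iff)
  \<comment> \<open>Multiplying by T = sin^2(M pi x) clears the denominators: 1/sin^2 becomes the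
    Fejer kernel, and the boundary terms of the two cotangent expressions cancel.\<close>
  then have "0 \<le> T * ((\<Sum>k<M. t k / (sin (t k))\<^sup>2) - (\<Sum>k<M. cot (t k)) + real M * cot (pi * x))"
    using T0 by simp
  also have "\<dots> = (\<Sum>k<M. t k * fejer M (t k)) + real M * (\<Sum>j=1..<M. sin (2 * real j * (pi * x)))"
  proof -
    have "(\<Sum>k<M. t k * fejer M (t k)) = T * (\<Sum>k<M. t k / (sin (t k))\<^sup>2)"
      by (simp add: F sum_distrib_left mult.commute)
    moreover have "T * (\<Sum>k<M. cot (t k)) = real M * (sin (real M * (pi * x)) * cos (real M * (pi * x)))"
      using sum_cot_shifts[OF M ne] ne by (simp add: t_def T_def cot_def power2_eq_square)
    moreover have c: "T * cot (pi * x)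
        = (\<Sum>j=1..<M. sin (2 * real j * (pi * x))) + sin (real M * (pi * x)) * cos (real M * (pi * x))"
      using conjugate_dirichlet_kernel[of M "pi * x"] nz[of 0]
        by (simp add: T_def cot_def t_def field_simps)
    moreover have "T * (real M * cot (pi * x)) = real M * (T * cot (pi * x))" by simp
    ultimately show ?thesis
      by (simp only: distrib_left right_diff_distrib)
  qed
  also have "\<dots> = pi * (real M)\<^sup>2 * (sawtooth_majorant M x - (1 / 2 - x))"
  proof -
    have "t k * fejer M (t k) = pi * ((1 / 2 - real k / real M) * fejer M (t k)) - pi * (1 / 2
        - x) * fejer M (t k)" for k
      by (simp add: t_def algebra_simps)
    then have "(\<Sum>k<M. t k * fejer M (t k)) = pi * (\<Sum>k<M. (1 / 2 - real k / real M) * fejer M (t k))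
        - pi * (1 / 2 - x) * (\<Sum>k<M. fejer M (t k))"
      by (simp only: sum_subtractf sum_distrib_left)
    also have "(\<Sum>k<M. fejer M (t k)) = (real M)\<^sup>2"
      unfolding t_def by (rule sum_fejer_shifts[OF M])
    finally have 1: "(\<Sum>k<M. t k * fejer M (t k)) =
        pi * (\<Sum>k<M. (1 / 2 - real k / real M) * fejer M (t k)) - pi * (1 / 2 - x) * (real M)\<^sup>2" .
    have 2: "sawtooth_majorant M x = (\<Sum>k<M. (1 / 2 - real k / real M) * fejer M (t k)) / (real M)\<^sup>2 +
        (\<Sum>j=1..<M. sin (2 * real j * (pi * x))) / (pi * real M)"
      by (simp only: sawtooth_majorant_def t_def)
    have "(pi * u - pi * c * m\<^sup>2) + m * v = pi * m\<^sup>2 * (u / m\<^sup>2 + v / (pi * m) - c)"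
      if "m > 0" for u v c m :: real
    proof -
      have "pi * m\<^sup>2 * (u / m\<^sup>2) = pi * u" "pi * m\<^sup>2 * (v / (pi * m)) = m * v"
        using that by (simp_all add: power2_eq_square)
      then show ?thesis by (simp only: distrib_left right_diff_distrib) simp
    qed
    then show ?thesis unfolding 1 2 using M by simp
  qed
  finally have "0 \<le> pi * (real M)\<^sup>2 * (sawtooth_majorant M x - (1 / 2 - x))" .
  moreover have "pi * (real M)\<^sup>2 > 0" using M by simp
  ultimately have "0 \<le> sawtooth_majorant M x - (1 / 2 - x)"
    by (meson not_less zero_le_mult_iff)
  then show ?thesis by simp
qed

lemma continuous_sawtooth_majorant: "isCont (sawtooth_majorant M) x"
  unfolding sawtooth_majorant_def[abs_def] fejer_def[abs_def]
  by (cases "M = 0") (auto intro!: continuous_intros)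

text \<open>The excluded points are isolated, so they are reached as limits. Limits from the right
  are taken because 1/2 - x on [0, 1) is continuous from the right at the jump 0.\<close>

lemma sawtooth_le_majorant:
  assumes M: "M > 0" and x: "0 \<le> x" "x < 1"
  shows "1 / 2 - x \<le> sawtooth_majorant M x"
proof -
  have nonzero: "\<forall>\<^sub>F y in at_right x. sin (real M * (pi * y)) \<noteq> 0"
  proof -
    obtain n where n: "real M * x < n + 1" "real_of_int n \<le> real M * x"
      using floor_correct[of "real M * x"] by (metis of_int_1 of_int_add)
    have "x < (n + 1) / real M" using n M by (simp add: field_simps)
    then show ?thesis
      unfolding eventually_at_right_field
    proof (intro exI[of _ "(n + 1) / real M"] conjI allI impI)
      fix y assume y: "x < y" "y < (n + 1) / real M"
      have "real M * y < n + 1" using y M by (simp add: field_simps)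
      moreover have "n < real M * y" using n y M
        by (smt (verit) mult_less_cancel_left_pos of_nat_0_less_iff)
      ultimately have "real M * y \<noteq> of_int m" for m
        by (auto simp del: of_int_add)
      then show "sin (real M * (pi * y)) \<noteq> 0"
        using sin_zero_iff_int2[of "real M * (pi * y)"] by (auto simp: mult.left_commute)
    qed
  qed
  have "\<forall>\<^sub>F y in at_right x. 1 / 2 - y \<le> sawtooth_majorant M y"
    using nonzero eventually_at_right_less[of x]
      eventually_at_right_real[OF x(2)]
    by eventually_elim (use M x in \<open>auto intro!: sawtooth_le_majorant_generic\<close>)
  moreover have "((\<lambda>y. 1 / 2 - y) \<longlongrightarrow> 1 / 2 - x) (at_right x)"
    by (intro tendsto_intros)
  moreover have "(sawtooth_majorant M \<longlongrightarrow> sawtooth_majorant M x) (at_right x)"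
    using continuous_sawtooth_majorant[of x M] unfolding isCont_def
      by (rule filterlim_at_split[THEN iffD1, THEN conjunct2])
  ultimately show ?thesis
    by (intro tendsto_le[of "at_right x" "sawtooth_majorant M" _ "\<lambda>y. 1 / 2 - y"]) auto
qed

section \<open>The majorant as a harmonic function in the disc\<close>

text \<open>Chosen so that \<open>sawtooth_majorant\<close> is the real part of an analytic
  polynomial on the circle: the sum collects the cosines of the shifted Fejer kernels, and
  \<open>-\<i>\<close> yields the sines.\<close>

definition majorant_coeff :: "nat \<Rightarrow> nat \<Rightarrow> complex" where
  "majorant_coeff M j =
     (\<Sum>k<M. of_real ((1 / 2 - real k / real M) * (2 * (real M
       - real j)) / (real M)\<^sup>2) * cis (- (2 * pi * real j * real k / real M)))
     - \<i> / of_real (pi * real M)"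

lemma norm_majorant_coeff_le:
  assumes "j < M"
  shows "norm (majorant_coeff M j) \<le> 2"
proof -
  have M: "M > 0" using assms by simp
  have "norm (\<Sum>k<M. of_real ((1 / 2 - real k / real M) * (2 * (real M
      - real j)) / (real M)\<^sup>2) * cis (- (2 * pi * real j * real k / real M)))
      \<le> (\<Sum>k<M. 1 / real M)"
  proof (rule sum_norm_le)
    fix k assume k: "k \<in> {..<M}"
    have "\<bar>1 / 2 - real k / real M\<bar> \<le> 1 / 2"
      using k by (auto simp: abs_le_iff field_simps)
    then have "\<bar>1 / 2 - real k / real M\<bar> * (2 * (real M - real j)) \<le> 1 / 2 * (2 * real M)"
      using assms by (intro mult_mono) auto
    then have "\<bar>1 / 2 - real k / real M\<bar> * (2 * (real M - real j)) / (real M)\<^sup>2 \<le> real M / (real M)\<^sup>2"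
      by (intro divide_right_mono) auto
    also have "\<dots> = 1 / real M" by (simp add: power2_eq_square)
    finally show "norm (of_real ((1 / 2 - real k / real M) * (2 * (real M
        - real j)) / (real M)\<^sup>2) * cis (- (2 * pi * real j * real k / real M))) \<le> 1 / real M"
      using assms by (simp only: norm_mult norm_of_real norm_cis mult_1_right abs_mult abs_divide) simp
  qed
  also have "\<dots> = 1" using M by simp
  finally have 1: "norm (\<Sum>k<M. of_real ((1 / 2 - real k / real M) * (2 * (real M
      - real j)) / (real M)\<^sup>2) * cis (- (2 * pi * real j * real k / real M))) \<le> 1" .
  have "1 \<le> pi * real M"
    using pi_gt3 M mult_mono[of 1 pi 1 "real M"] by simp
  then have "norm (\<i> / complex_of_real (pi * real M)) \<le> 1"
    using M by (simp add: norm_divide norm_mult)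
  with 1 show ?thesis
    unfolding majorant_coeff_def by (intro order.trans[OF norm_triangle_ineq4]) simp
qed

text \<open>The constant term is the mean of the interpolated values 1/2 - k/M. Those with 0 < k < M
  cancel in pairs, so it comes entirely from the value 1/2 at the jump.\<close>

definition majorant_poly :: "nat \<Rightarrow> complex \<Rightarrow> complex" where
  "majorant_poly M z = of_real (1 / (2 * real M)) + (\<Sum>j=1..<M. majorant_coeff M j * z ^ j)"

lemma Re_majorant_poly_cis:
  assumes M: "M > 0"
  shows "Re (majorant_poly M (cis (2 * pi * x))) = sawtooth_majorant M x"
proof -
  let ?s = "\<lambda>k. 1 / 2 - real k / real M"
  have coeff: "Re (majorant_coeff M j * cis (2 * pi * x) ^ j) =
      (\<Sum>k<M. ?s k * (2 * (real M - real j)) / (real M)\<^sup>2 * cos (2 * real j * (pi * x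
        - pi * real k / real M)))
       + sin (2 * real j * (pi * x)) / (pi * real M)" for j
  proof -
    have "cis (2 * pi * x) ^ j = cis (2 * real j * (pi * x))"
      by (simp add: Complex.DeMoivre mult_ac)
    then have "majorant_coeff M j * cis (2 * pi * x) ^ j =
      (\<Sum>k<M. of_real (?s k * (2 * (real M - real j)) / (real M)\<^sup>2) * cis (2 * real j * (pi * x
        - pi * real k / real M)))
      - \<i> * cis (2 * real j * (pi * x)) / of_real (pi * real M)"
      unfolding majorant_coeff_def left_diff_distrib sum_distrib_right
      by (simp add: mult.assoc cis_mult) (simp add: algebra_simps)
    then show ?thesis
      by (simp add: Re_divide_of_real del: of_real_mult of_real_divide of_real_diff of_real_power)
  qed
  have fejer: "?s k * fejer M u / (real M)\<^sup>2 = ?s k * real M / (real M)\<^sup>2 +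
      (\<Sum>j=1..<M. ?s k * (2 * (real M - real j)) / (real M)\<^sup>2 * cos (2 * real j * u))" for k u
  proof -
    have "(\<Sum>j=1..<M. ?s k * (2 * (real M - real j)) / (real M)\<^sup>2 * cos (2 * real j * u)) =
        ?s k * 2 / (real M)\<^sup>2 * (\<Sum>j=1..<M. (real M - real j) * cos (2 * real j * u))"
    proof -
      have "a * (2 * b) / c * d = a * 2 / c * (b * d)" for a b c d :: real by simp
      then show ?thesis unfolding sum_distrib_left by (intro sum.cong refl)
    qed
    then show ?thesis by (simp add: fejer_def distrib_left add_divide_distrib)
  qed
  have "(\<Sum>k<M. ?s k * fejer M (pi * x - pi * real k / real M)) / (real M)\<^sup>2 =
      (\<Sum>k<M. ?s k) * real M / (real M)\<^sup>2 +
      (\<Sum>j=1..<M. \<Sum>k<M. ?s k * (2 * (real M - real j)) / (real M)\<^sup>2 * cos (2 * real j * (pi * x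
        - pi * real k / real M)))"
    unfolding sum_divide_distrib fejer sum.distrib
      by (subst sum.swap) (simp add: sum_distrib_right sum_divide_distrib)
  also have "(\<Sum>k<M. ?s k) * real M / (real M)\<^sup>2 = 1 / (2 * real M)"
  proof -
    have "(\<Sum>k<n. real k) = real n * (real n - 1) / 2" for n
      by (induction n) (auto simp: field_simps)
    moreover have "(\<Sum>k<M. ?s k) = real M / 2 - (\<Sum>k<M. real k) / real M"
      by (simp add: sum_subtractf sum_divide_distrib)
    ultimately have "(\<Sum>k<M. ?s k) = real M / 2 - (real M * (real M - 1) / 2) / real M"
      by (simp only:)
    also have "\<dots> = 1 / 2" using M by (simp add: field_simps)
    finally have "(\<Sum>k<M. ?s k) = 1 / 2" .
    then show ?thesis using M by (simp only:) (simp add: power2_eq_square)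
  qed
  finally have eq: "(\<Sum>k<M. ?s k * fejer M (pi * x - pi * real k / real M)) / (real M)\<^sup>2 =
      1 / (2 * real M) +
      (\<Sum>j=1..<M. \<Sum>k<M. ?s k * (2 * (real M - real j)) / (real M)\<^sup>2 * cos (2 * real j * (pi * x
        - pi * real k / real M)))" .
  have "Re (majorant_poly M (cis (2 * pi * x))) =
      1 / (2 * real M) + (\<Sum>j=1..<M. Re (majorant_coeff M j * cis (2 * pi * x) ^ j))"
    by (simp only: majorant_poly_def plus_complex.sel Re_complex_of_real Re_sum)
  also have "\<dots> = sawtooth_majorant M x"
    unfolding sawtooth_majorant_def eq by (simp only: coeff sum.distrib sum_divide_distrib add.assoc)
  finally show ?thesis .
qed

lemma Arg_one_minus_cis:
  assumes "0 < x" "x < 1"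
  shows "Arg (1 - cis (2 * pi * x)) = pi * (x - 1 / 2)"
proof (rule Arg_unique')
  show "2 * sin (pi * x) > 0" using assms by (simp add: sin_gt_zero)
  show "pi * (x - 1 / 2) \<in> {- pi<..pi}"
    using assms mult_strict_left_mono[of "-1" "x - 1 / 2" pi] mult_left_mono[of "x - 1 / 2" 1 pi]
      by auto
  have "cos (pi * (x - 1 / 2)) = sin (pi * x)" "sin (pi * (x - 1 / 2)) = - cos (pi * x)"
    by (simp_all add: right_diff_distrib sin_diff cos_diff)
  moreover have "cos (2 * pi * x) = 1 - 2 * (sin (pi * x))\<^sup>2" "sin (2 * pi * x)
      = 2 * sin (pi * x) * cos (pi * x)"
    using cos_double_sin[of "pi * x"] sin_double[of "pi * x"] by (simp_all add: mult.assoc)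
  ultimately show "1 - cis (2 * pi * x) = rcis (2 * sin (pi * x)) (pi * (x - 1 / 2))"
    by (simp add: complex_eq_iff rcis_def power2_eq_square)
qed

lemma neg_Arg_le_majorant_sphere:
  assumes M: "M > 0" and z: "norm z = 1"
  shows "- Arg (1 - z) / pi \<le> Re (majorant_poly M z)"
proof -
  define x where "x = Arg2pi z / (2 * pi)"
  have x: "0 \<le> x" "x < 1" using Arg2pi[of z] by (auto simp: x_def)
  have zx: "z = cis (2 * pi * x)"
    using Arg2pi[of z] z by (simp add: x_def is_Arg_def cis_conv_exp)
  show ?thesis
  proof (cases "x = 0")
    case True
    then have "z = 1" using zx by simp
    \<comment> \<open>At the jump \<open>Arg 0 = 0\<close>, so the left side is 0, whereas the
      majorant is at least 1/2.\<close>
    with sawtooth_le_majorant[OF M x] Re_majorant_poly_cis[OF M, of 0] True show ?thesis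
      by (simp add: Arg_zero)
  next
    case False
    then have "Arg (1 - z) = pi * (x - 1 / 2)"
      unfolding zx using x by (intro Arg_one_minus_cis) auto
    with sawtooth_le_majorant[OF M x] show ?thesis
      by (simp add: zx Re_majorant_poly_cis[OF M])
  qed
qed

lemma continuous_on_majorant_poly [continuous_intros]: "continuous_on A (majorant_poly M)"
  unfolding majorant_poly_def[abs_def] by (intro continuous_intros)

lemma holomorphic_majorant_poly [holomorphic_intros]: "majorant_poly M holomorphic_on A"
  unfolding majorant_poly_def[abs_def] by (intro holomorphic_intros)

lemma Re_one_minus_pos: "Re (1 - z) > 0" if "norm z \<le> 1" "z \<noteq> 1" for z :: complex
proof -
  have "Re z \<le> 1" using complex_Re_le_cmod[of z] that by simp
  moreover have "Re z \<noteq> 1"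
  proof
    assume "Re z = 1"
    then have "(Im z)\<^sup>2 \<le> 0" using that(1) by (simp add: cmod_def)
    then show False using \<open>Re z = 1\<close> that(2) by (simp add: complex_eq_iff)
  qed
  ultimately show ?thesis by simp
qed

text \<open>
  The maximum principle, applied to \<open>exp\<close> of a function with the left-hand side as real part.
  The factor \<open>((1 - z)/2)^\<eta>\<close> removes the discontinuity at \<open>z = 1\<close>.
\<close>
lemma neg_Arg_le_majorant_generic:
  assumes M: "M > 0" and w: "norm w \<le> 1" "w \<noteq> 1" and \<eta>: "\<eta> > 0"
  shows "- Arg (1 - w) / pi - Re (majorant_poly M w) + \<eta> * ln (norm (1 - w) / 2) \<le> 0"
proof -
  have "compact (majorant_poly M ` cball 0 1)"
    by (intro compact_continuous_image continuous_intros) auto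
  then obtain K where K: "\<And>z. norm z \<le> 1 \<Longrightarrow> norm (majorant_poly M z) \<le> K"
    using compact_imp_bounded[THEN bounded_iff[THEN iffD1]]
      by (metis (no_types, lifting) image_eqI mem_cball_0)
  \<comment> \<open>The first entry keeps \<open>w\<close> outside the removed ball. The second
    makes \<eta> ln(r/2) at most -(K + 1), which outweighs the bounds 1 for -Arg/pi and K for the
    majorant on the small arc.\<close>
  define r where "r = min (norm (1 - w)) (2 * exp (- (K + 1) / \<eta>))"
  have r: "r > 0" using w by (auto simp: r_def)
  define S where "S = cball 0 1 - ball (1 :: complex) r"
  have S1: "norm z \<le> 1" "z \<noteq> 1" if "z \<in> S" for z using that r by (auto simp: S_def)
  have slit: "1 - z \<notin> \<real>\<^sub>\<le>\<^sub>0" "(1 - z) / 2 \<notin> \<real>\<^sub>\<le>\<^sub>0" if "norm z \<le> 1" "z \<noteq> 1" for z :: complex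
    using Re_one_minus_pos[OF that] by (auto simp: complex_nonpos_Reals_iff)
  define f where "f z = exp (- majorant_poly M z + \<i> / of_real pi * Ln (1 - z) + of_real \<eta> * Ln ((1
      - z) / 2))" for z
  have norm_f: "norm (f z) = exp (- Arg (1 - z) / pi - Re (majorant_poly M z) + \<eta> * ln (norm (1
      - z) / 2))"
    if "z \<noteq> 1" for z
  proof -
    have "Re (\<i> / of_real pi * Ln (1 - z)) = - Arg (1 - z) / pi"
      using that by (simp add: Arg_eq_Im_Ln Re_divide Im_divide power2_eq_square)
    moreover have "Re (Ln ((1 - z) / 2)) = ln (norm (1 - z) / 2)"
      using that by (simp add: norm_divide)
    ultimately show ?thesis by (simp add: f_def)
  qed
  have "norm (f w) \<le> 1"
  proof (rule maximum_modulus_frontier[of f S])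
    have "interior S \<subseteq> S" by (rule interior_subset)
    then have "1 - z \<notin> \<real>\<^sub>\<le>\<^sub>0" "(1 - z) / 2 \<notin> \<real>\<^sub>\<le>\<^sub>0" if "z \<in> interior S" for z
      using that S1 slit by blast+
    then show "f holomorphic_on interior S"
      unfolding f_def[abs_def] by (intro holomorphic_intros) simp_all
    have "closed S" unfolding S_def by (intro closed_Diff) auto
    then show "continuous_on (closure S) f"
      unfolding f_def[abs_def] using S1 slit by (intro continuous_intros) auto
    show "bounded S" unfolding S_def by (rule bounded_subset[of "cball 0 1"]) auto
    show "w \<in> S" using w by (auto simp: S_def r_def dist_norm)
    fix z assume z: "z \<in> frontier S"
    then have zS: "z \<in> S" using \<open>closed S\<close> frontier_subset_eq by blast
    have int: "ball 0 1 - cball 1 r \<subseteq> interior S"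
      by (rule interior_maximal) (auto simp: S_def)
    have "z \<notin> interior S" using z by (simp add: frontier_def)
    have "norm z = 1 \<or> norm (1 - z) = r"
    proof (rule ccontr)
      assume "\<not> (norm z = 1 \<or> norm (1 - z) = r)"
      then have "norm z < 1" "r < norm (1 - z)" using zS by (auto simp: S_def dist_norm)
      then have "z \<in> ball 0 1 - cball 1 r" by (simp add: dist_norm)
      with int \<open>z \<notin> interior S\<close> show False by blast
    qed
    then show "norm (f z) \<le> 1"
    proof
      assume nz: "norm z = 1"
      have "norm (1 - z) / 2 \<le> 1" using norm_triangle_ineq4[of 1 z] nz by simp
      moreover have "norm (1 - z) / 2 > 0" using S1[OF zS] by simp
      ultimately have "\<eta> * ln (norm (1 - z) / 2) \<le> 0"
        using \<eta> by (intro mult_nonneg_nonpos) (auto simp: ln_le_zero_iff)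
      with neg_Arg_le_majorant_sphere[OF M nz] show ?thesis
        by (simp add: norm_f[OF S1(2)[OF zS]])
    next
      assume nr: "norm (1 - z) = r"
      have "- Arg (1 - z) / pi \<le> 1"
        using Arg_bounded[of "1 - z"] pi_gt_zero by (simp add: field_simps)
      moreover have "- Re (majorant_poly M z) \<le> K"
        using K[OF S1(1)[OF zS]] abs_Re_le_cmod[of "majorant_poly M z"] by linarith
      moreover have "\<eta> * ln (norm (1 - z) / 2) \<le> - (K + 1)"
      proof -
        have "ln (r / 2) \<le> ln (exp (- (K + 1) / \<eta>))"
          using r by (intro ln_mono) (auto simp: r_def)
        then have "\<eta> * ln (r / 2) \<le> \<eta> * (- (K + 1) / \<eta>)"
          using \<eta> by (intro mult_left_mono) auto
        then show ?thesis using \<eta> by (simp add: nr)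
      qed
      ultimately show ?thesis by (simp add: norm_f[OF S1(2)[OF zS]])
    qed
  qed
  then show ?thesis using norm_f[OF w(2)] by simp
qed

lemma neg_Arg_le_majorant:
  assumes M: "M > 0" and w: "norm w \<le> 1"
  shows "- Arg (1 - w) / pi \<le> Re (majorant_poly M w)"
proof (cases "w = 1")
  case True
  then show ?thesis using neg_Arg_le_majorant_sphere[OF M, of w] by simp
next
  case False
  let ?c = "- Arg (1 - w) / pi - Re (majorant_poly M w)"
  have "((\<lambda>\<eta>. ?c + \<eta> * ln (norm (1 - w) / 2)) \<longlongrightarrow> ?c + 0 * ln (norm (1 - w) / 2)) (at_right 0)"
    by (intro tendsto_intros)
  moreover have "\<forall>\<^sub>F \<eta> in at_right 0. ?c + \<eta> * ln (norm (1 - w) / 2) \<le> 0"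
    using eventually_at_right_less[of 0]
    by eventually_elim (rule neg_Arg_le_majorant_generic[OF M w False])
  ultimately have "?c + 0 * ln (norm (1 - w) / 2) \<le> 0"
    by (rule tendsto_upperbound) simp
  then show ?thesis by simp
qed

section \<open>Zeros of polynomials and power sums\<close>

text \<open>Factor the reflected polynomial, which is monic because the constant term of
  \<open>p\<close> is 1, and reflect back. The \<alpha> are thus the inverses of the roots of
  \<open>p\<close>.\<close>

lemma polynomial_linear_factors:
  fixes p :: "complex poly"
  assumes p: "coeff p 0 = 1"
  obtains \<alpha> :: "nat \<Rightarrow> complex" where "p = (\<Prod>i<degree p. [:1, - \<alpha> i:])"
proof -
  let ?r = "reflect_poly p"
  have r: "lead_coeff ?r = 1" "degree ?r = degree p" "?r \<noteq> 0"
    using p by (auto simp: coeff_reflect_poly)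
  obtain A where A: "size A = degree p" "?r = (\<Prod>x\<in>#A. [:-x, 1:])"
    using alg_closed_imp_factorization[OF r(3)] r(1,2) by auto
  obtain xs where xs: "mset xs = A" using ex_mset by blast
  have r_prod: "?r = (\<Prod>i<degree p. [:- (xs ! i), 1:])"
    unfolding A(2) xs[symmetric] using A(1) xs
    by (auto simp: prod_mset_prod_list prod.list_conv_set_nth atLeast0LessThan simp flip: mset_map)
  have "p = reflect_poly ?r" using p by simp
  also have "\<dots> = (\<Prod>i<degree p. reflect_poly [:- (xs ! i), 1:])"
    by (subst r_prod) (rule reflect_poly_prod)
  also have "\<dots> = (\<Prod>i<degree p. [:1, - (xs ! i):])"
    by (simp add: reflect_poly_def)
  finally show ?thesis by (rule that)
qed

text \<open>X times the logarithmic derivative of 1 - a X is -a X / (1 - a X), whose expansion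
  starts at X; hence the entry 0 for k = 0.\<close>

lemma log_derivative_linear_factors:
  fixes \<alpha> :: "nat \<Rightarrow> complex"
  shows "fps_X * fps_deriv (\<Prod>i<N. 1 - fps_const (\<alpha> i) * fps_X) =
    - Abs_fps (\<lambda>k. if k = 0 then 0 else (\<Sum>i<N. \<alpha> i ^ k)) * (\<Prod>i<N. 1 - fps_const (\<alpha> i) * fps_X)"
proof (induction N)
  case (Suc N)
  let ?S = "\<lambda>N. Abs_fps (\<lambda>k. if k = 0 then 0 else (\<Sum>i<N. \<alpha> i ^ k))"
  let ?P = "\<Prod>i<N. 1 - fps_const (\<alpha> i) * fps_X"
  let ?f = "1 - fps_const (\<alpha> N) * fps_X"
  let ?G = "Abs_fps (\<lambda>k. if k = 0 then 0 else \<alpha> N ^ k)"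
  have S: "?S (Suc N) = ?S N + ?G" by (rule fps_ext) simp
  have G: "?G * ?f = fps_const (\<alpha> N) * fps_X"
  proof (rule fps_ext)
    fix n
    have "?G * ?f = ?G - fps_const (\<alpha> N) * (fps_X * ?G)"
      by (simp add: algebra_simps)
    then show "fps_nth (?G * ?f) n = fps_nth (fps_const (\<alpha> N) * fps_X) n"
      by (cases n; cases "n - 1") (simp_all add: fps_X_mult_nth)
  qed
  have "fps_X * fps_deriv (?P * ?f) = fps_X * fps_deriv ?P * ?f - ?P * (fps_const (\<alpha> N) * fps_X)"
    by (simp add: algebra_simps)
  also have "\<dots> = - ?S N * ?P * ?f - ?P * (?G * ?f)"
    by (simp only: Suc.IH G)
  also have "\<dots> = - ?S (Suc N) * (?P * ?f)"
    by (simp only: S) (simp add: algebra_simps)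
  finally show ?case by simp
qed (simp add: fps_eq_iff)

text \<open>The recurrence and the factorization both describe X P'/P as a formal power series; P is
  nonzero and can be cancelled.\<close>

lemma power_sums_eq:
  fixes a c :: "nat \<Rightarrow> complex" and \<alpha> :: "nat \<Rightarrow> complex"
  assumes p: "p = (\<Prod>i<N. [:1, - \<alpha> i:])"
    and rec: "\<And>n. of_nat n * coeff p n = (\<Sum>k=1..n. c k * coeff p (n - k))"
    and k: "k > 0"
  shows "(\<Sum>i<N. \<alpha> i ^ k) = - c k"
proof -
  let ?P = "\<Prod>i<N. 1 - fps_const (\<alpha> i) * fps_X"
  let ?C = "Abs_fps (\<lambda>k. if k = 0 then 0 else c k)"
  let ?S = "Abs_fps (\<lambda>k. if k = 0 then 0 else (\<Sum>i<N. \<alpha> i ^ k))"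
  have P: "fps_of_poly p = ?P"
    unfolding p by (simp add: fps_of_poly_prod fps_of_poly_pCons mult.commute flip: fps_const_neg)
  have "fps_X * fps_deriv ?P = ?C * ?P"
    unfolding P[symmetric]
  proof (rule fps_ext)
    fix n
    have "fps_nth (fps_X * fps_deriv (fps_of_poly p)) n = of_nat n * coeff p n"
      by (cases n) (simp_all add: fps_X_mult_nth)
    also have "\<dots> = (\<Sum>k=0..n. fps_nth ?C k * coeff p (n - k))"
      unfolding rec by (rule sum.mono_neutral_cong_left) auto
    finally show "fps_nth (fps_X * fps_deriv (fps_of_poly p)) n = fps_nth (?C * fps_of_poly p) n"
      by (simp add: fps_mult_nth)
  qed
  then have "?C * ?P = - ?S * ?P"
    using log_derivative_linear_factors[of \<alpha> N] by simp
  then have "(?C + ?S) * ?P = 0"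
    by (simp only: distrib_right) simp
  moreover have "?P \<noteq> 0"
  proof -
    have "1 - fps_const a * fps_X \<noteq> 0" for a :: complex
    proof
      assume "1 - fps_const a * fps_X = 0"
      from arg_cong[OF this, of "\<lambda>f. fps_nth f 0"] show False by simp
    qed
    then show ?thesis by simp
  qed
  ultimately have "?C + ?S = 0" by simp
  from arg_cong[OF this, of "\<lambda>f. fps_nth f k"] k show ?thesis
    by (simp add: eq_neg_iff_add_eq_0 add.commute)
qed

text \<open>The power series \<open>\<Sum> c\<^sub>k u\<^sup>k / k\<close> is a logarithm of \<open>p\<close> inside its disc of convergence.\<close>
lemma poly_nonzero_of_log_coeffs:
  fixes p :: "complex poly"
  assumes p0: "coeff p 0 = 1"
    and rec: "\<And>n. of_nat n * coeff p n = (\<Sum>k=1..n. c k * coeff p (n - k))"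
    and c: "\<And>k. k > 0 \<Longrightarrow> norm (c k) \<le> C * r ^ k" and r: "r > 0" and u: "norm u * r < 1"
  shows "poly p u \<noteq> 0"
proof -
  define E where "E = Abs_fps (\<lambda>k. c k / of_nat k)"
  have rad: "fps_conv_radius E \<ge> ereal (1 / r)"
    unfolding fps_conv_radius_def
  proof (rule conv_radius_geI_ex')
    fix s :: real assume s: "0 < s" "ereal s < ereal (1 / r)"
    have C: "C \<ge> 0" using order.trans[OF norm_ge_zero c[of 1]] r by (simp add: zero_le_mult_iff)
    have "summable (\<lambda>n. C * (s * r) ^ n)"
      using s r by (intro summable_mult summable_geometric) (simp add: field_simps)
    then show "summable (\<lambda>n. fps_nth E n * of_real s ^ n)"
    proof (rule summable_comparison_test')
      fix n :: nat assume "0 \<le> n"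
      show "norm (fps_nth E n * of_real s ^ n) \<le> C * (s * r) ^ n"
      proof (cases "n = 0")
        case True
        then show ?thesis using C by (simp add: E_def)
      next
        case False
        have "norm (c n) / real n \<le> norm (c n)"
          using False mult_right_mono[of 1 "real n" "norm (c n)"] by (simp add: field_simps)
        also have "\<dots> \<le> C * r ^ n" using c[of n] False by simp
        finally have "norm (c n) / real n * s ^ n \<le> C * r ^ n * s ^ n"
          using s by (intro mult_right_mono) auto
        then show ?thesis
          using s by (simp add: E_def norm_mult norm_divide norm_power power_mult_distrib mult_ac)
      qed
    qed
  qed
  have deriv: "fps_of_poly (pderiv p) = fps_deriv E * fps_of_poly p"
  proof (rule fps_ext)
    fix n
    have "fps_nth (fps_of_poly (pderiv p)) n = of_nat (Suc n) * coeff p (Suc n)"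
      by (simp add: coeff_pderiv)
    also have "\<dots> = (\<Sum>k=1..Suc n. c k * coeff p (Suc n - k))" by (rule rec)
    also have "\<dots> = (\<Sum>k=0..n. c (Suc k) * coeff p (n - k))"
      using sum.shift_bounds_cl_Suc_ivl[of "\<lambda>k. c k * coeff p (Suc n - k)" 0 n] by simp
    also have "\<dots> = fps_nth (fps_deriv E * fps_of_poly p) n"
      by (simp add: fps_mult_nth E_def del: of_nat_Suc)
    finally show "fps_nth (fps_of_poly (pderiv p)) n = fps_nth (fps_deriv E * fps_of_poly p) n" .
  qed
  have inr: "ereal (norm z) < fps_conv_radius E" if "z \<in> ball 0 (1 / r)" for z
  proof -
    have "ereal (norm z) < ereal (1 / r)" using that by simp
    then show ?thesis using rad by (rule order.strict_trans2)
  qed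
  have der: "((\<lambda>z. poly p z * exp (- eval_fps E z)) has_field_derivative 0) (at z within ball 0 (1
      / r))"
    if z: "z \<in> ball 0 (1 / r)" for z
  proof -
    have "poly (pderiv p) z = eval_fps (fps_deriv E) z * poly p z"
    proof -
      have "poly (pderiv p) z = eval_fps (fps_deriv E * fps_of_poly p) z"
        by (simp flip: deriv)
      also have "\<dots> = eval_fps (fps_deriv E) z * eval_fps (fps_of_poly p) z"
        using inr[OF z] order.strict_trans2[OF inr[OF z] fps_conv_radius_deriv[of E]]
        by (intro eval_fps_mult) auto
      finally show ?thesis by simp
    qed
    moreover have "((\<lambda>z. poly p z * exp (- eval_fps E z)) has_field_derivative
        poly (pderiv p) z * exp (- eval_fps E z)
          + exp (- eval_fps E z) * (- eval_fps (fps_deriv E) z) * poly p z) (at z within ball 0 (1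
            / r))"
      by (auto intro!: derivative_eq_intros has_field_derivative_eval_fps inr z)
    ultimately show ?thesis by (simp add: algebra_simps)
  qed
  obtain k where k: "\<And>z. z \<in> ball 0 (1 / r) \<Longrightarrow> poly p z * exp (- eval_fps E z) = k"
    using has_field_derivative_zero_constant[OF convex_ball der] by blast
  have "k = 1"
    using k[of 0] r by (simp add: eval_fps_at_0 E_def poly_0_coeff_0 p0)
  moreover have "u \<in> ball 0 (1 / r)" using u r by (simp add: field_simps)
  ultimately have "poly p u * exp (- eval_fps E u) = 1" using k[of u] by simp
  then show ?thesis by auto
qed

section \<open>Variation of the argument\<close>

lemma continuous_int_multiple_const:
  fixes f :: "real \<Rightarrow> real"
  assumes S: "connected S" "continuous_on S f" and c: "c > 0"
    and f: "\<And>x. x \<in> S \<Longrightarrow> \<exists>n::int. f x = of_int n * c" and xy: "x \<in> S" "y \<in> S"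
  shows "f x = f y"
proof -
  have "f constant_on S"
  proof (rule continuous_discrete_range_constant[OF S])
    fix x assume x: "x \<in> S"
    show "\<exists>e>0. \<forall>y. y \<in> S \<and> f y \<noteq> f x \<longrightarrow> e \<le> norm (f y - f x)"
    proof (intro exI[of _ c] conjI allI impI c)
      fix y assume y: "y \<in> S \<and> f y \<noteq> f x"
      obtain m n where mn: "f x = of_int m * c" "f y = of_int n * c" using f x y by blast
      have "f y - f x = of_int (n - m) * c" by (simp add: mn algebra_simps)
      moreover have "\<bar>real_of_int (n - m)\<bar> \<ge> 1"
      proof -
        have "n \<noteq> m" using mn y by auto
        then have "1 \<le> \<bar>n - m\<bar>" by simp
        then show ?thesis by linarith
      qed
      ultimately show "c \<le> norm (f y - f x)" using c by (simp add: abs_mult)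
    qed
  qed
  then show ?thesis using xy by (auto simp: constant_on_def)
qed

text \<open>Two continuous arguments differ by a continuous function with values in the multiples of
  2 pi, so the increment is unique.\<close>

lemma arg_variation_eq:
  assumes \<phi>: "continuous_on {0..1} \<phi>"
    and w: "\<And>t. t \<in> {0..1} \<Longrightarrow> w t = of_real (cmod (w t)) * cis (\<phi> t)"
    and nz: "\<And>t. t \<in> {0..1} \<Longrightarrow> w t \<noteq> 0"
  shows "arg_variation w = \<phi> 1 - \<phi> 0"
  unfolding arg_variation_def
proof (rule the_equality)
  show "\<exists>\<psi>. continuous_on {0..1} \<psi> \<and> (\<forall>t\<in>{0..1}. w t = of_real (cmod (w t)) * cis (\<psi> t)) \<and> \<phi> 1 - \<phi> 0
      = \<psi> 1 - \<psi> 0"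
    using \<phi> w by blast
next
  fix v assume "\<exists>\<psi>. continuous_on {0..1} \<psi> \<and> (\<forall>t\<in>{0..1}. w t = of_real (cmod (w t)) * cis (\<psi> t)) \<and> v
      = \<psi> 1 - \<psi> 0"
  then obtain \<psi> where \<psi>: "continuous_on {0..1} \<psi>" "\<And>t. t \<in> {0..1} \<Longrightarrow> w t
      = of_real (cmod (w t)) * cis (\<psi> t)"
    and v: "v = \<psi> 1 - \<psi> 0" by blast
  have "\<psi> 1 - \<phi> 1 = \<psi> 0 - \<phi> 0"
  proof (rule continuous_int_multiple_const[of "{0..1}" "\<lambda>t. \<psi> t - \<phi> t" "2 * pi"])
    fix t :: real assume t: "t \<in> {0..1}"
    have "cis (\<psi> t) = cis (\<phi> t)"
    proof -
      have "of_real (cmod (w t)) * cis (\<psi> t) = of_real (cmod (w t)) * cis (\<phi> t)"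
        using w[OF t] \<psi>(2)[OF t] by simp
      then show ?thesis using nz[OF t] by simp
    qed
    then have "cis (\<psi> t - \<phi> t) = 1" by (simp flip: cis_divide)
    then have "cos (\<psi> t - \<phi> t) = 1" by (simp add: complex_eq_iff)
    then show "\<exists>n::int. \<psi> t - \<phi> t = of_int n * (2 * pi)"
      using cos_one_2pi_int[of "\<psi> t - \<phi> t"] by (auto simp: mult.assoc)
  qed (use \<phi> \<psi> in \<open>auto intro!: continuous_intros\<close>)
  then show "v = \<phi> 1 - \<phi> 0" by (simp add: v)
qed

lemma prod_eq_norm_cis_sum_Arg:
  fixes z :: "'i \<Rightarrow> complex"
  shows "(\<Prod>i\<in>A. z i) = of_real (norm (\<Prod>i\<in>A. z i)) * cis (\<Sum>i\<in>A. Arg (z i))"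
proof (induction A rule: infinite_finite_induct)
  case (insert x A)
  have "(\<Prod>i\<in>insert x A. z i) = z x * (\<Prod>i\<in>A. z i)" using insert by simp
  also have "\<dots> = (of_real (norm (z x)) * cis (Arg (z x))) * (of_real (norm (\<Prod>i\<in>A. z i))
      * cis (\<Sum>i\<in>A. Arg (z i)))"
    using insert.IH rcis_cmod_Arg[of "z x"] by (simp add: rcis_def)
  also have "\<dots> = of_real (norm (\<Prod>i\<in>insert x A. z i)) * cis (\<Sum>i\<in>insert x A. Arg (z i))"
    using insert by (simp add: norm_mult cis_mult[symmetric])
  finally show ?case .
qed simp_all

lemma continuous_Arg_one_minus:
  assumes "continuous (at t within S) f" "norm (f t) \<le> 1" "f t \<noteq> 1"
  shows "continuous (at t within S) (\<lambda>t. Arg (1 - f t))"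
proof (rule continuous_within_compose3[where g = Arg and f = "\<lambda>t. 1 - f t"])
  have "1 - f t \<notin> \<real>\<^sub>\<le>\<^sub>0"
    using Re_one_minus_pos[OF assms(2,3)] by (auto simp: complex_nonpos_Reals_iff)
  then show "isCont Arg (1 - f t)" by (rule continuous_at_Arg)
qed (use assms in \<open>auto intro!: continuous_intros\<close>)

section \<open>The path in the definition of S\<close>

lemma unit_exp_eq_cis: "unit_exp \<theta> = cis (2 * pi * \<theta>)"
  by (simp add: unit_exp_def cis_conv_exp mult_ac)

lemma unit_exp_frac: "cis (2 * pi * frac \<theta>) = unit_exp \<theta>"
proof -
  have "cis (2 * pi * frac \<theta>) = cis (2 * pi * \<theta>) / cis (2 * pi * of_int \<lfloor>\<theta>\<rfloor>)"
    by (simp only: frac_def cis_divide right_diff_distrib)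
  also have "cis (2 * pi * of_int \<lfloor>\<theta>\<rfloor>) = 1"
    by (simp add: complex_eq_iff)
  finally show ?thesis by (simp add: unit_exp_eq_cis)
qed

lemma arc_then_ray_props:
  assumes q: "q > 1"
  shows path_arc_then_ray: "path (arc_then_ray q \<theta>)"
    and arc_then_ray_0: "arc_then_ray q \<theta> 0 = of_real (q powr (-2))"
    and arc_then_ray_1: "arc_then_ray q \<theta> 1 = of_real (q powr (-1/2)) * unit_exp \<theta>"
    and norm_arc_then_ray: "t \<in> {0..1} \<Longrightarrow> norm (arc_then_ray q \<theta> t) < q powr (-1/2) \<or> t = 1"
proof -
  let ?r = "q powr (-2)" and ?R = "q powr (-1/2)"
  have r: "0 < ?r" "?r < ?R" using q by auto
  have fin: "pathfinish (part_circlepath 0 ?r 0 (2 * pi * frac \<theta>)) = of_real ?r * unit_exp \<theta>"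
    by (simp add: unit_exp_frac[symmetric] cis_conv_exp mult_ac)
  show "path (arc_then_ray q \<theta>)"
    unfolding arc_then_ray_def using fin by (intro path_join_imp) auto
  show "arc_then_ray q \<theta> 0 = of_real ?r"
    by (simp add: arc_then_ray_def joinpaths_def part_circlepath_def linepath_def)
  show "arc_then_ray q \<theta> 1 = of_real ?R * unit_exp \<theta>"
    by (simp add: arc_then_ray_def joinpaths_def linepath_def)
  show "norm (arc_then_ray q \<theta> t) < ?R \<or> t = 1" if t: "t \<in> {0..1}"
  proof (cases "t \<le> 1 / 2")
    case True
    then have "norm (arc_then_ray q \<theta> t) = ?r"
      by (simp add: arc_then_ray_def joinpaths_def part_circlepath_def norm_mult linepath_def flip:
        of_real_mult of_real_add)
    then show ?thesis using r by simp
  next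
    case False
    let ?x = "2 * t - 1"
    have "arc_then_ray q \<theta> t = of_real ((1 - ?x) * ?r + ?x * ?R) * unit_exp \<theta>"
      using False by (simp add: arc_then_ray_def joinpaths_def linepath_def scaleR_conv_of_real
        algebra_simps)
    moreover have "(1 - ?x) * ?r + ?x * ?R \<ge> 0" using t False r
      by (intro add_nonneg_nonneg mult_nonneg_nonneg) auto
    ultimately have n: "norm (arc_then_ray q \<theta> t) = (1 - ?x) * ?r + ?x * ?R"
      by (simp only: norm_mult norm_of_real) (simp add: unit_exp_eq_cis)
    show ?thesis
    proof (cases "t = 1")
      case False
      then have "(1 - ?x) * ?r < (1 - ?x) * ?R" using r t by (intro mult_strict_left_mono) auto
      then show ?thesis unfolding n by (simp add: algebra_simps)
    qed simp
  qed
qed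

text \<open>Every factor 1 - \<alpha> u stays in the open right half-plane along the path, including
  the end point since L does not vanish there. So the sum of the principal arguments is a continuous
  argument of L.\<close>

lemma arg_variation_arc_then_ray:
  fixes \<alpha> :: "nat \<Rightarrow> complex"
  assumes q: "q > 1" and L: "\<And>u. L u = (\<Prod>i<N. 1 - \<alpha> i * u)"
    and \<alpha>: "\<And>i. i < N \<Longrightarrow> norm (\<alpha> i) * q powr (-1/2) \<le> 1"
    and real: "\<And>x. L (of_real x) \<in> \<real>"
    and nz: "L (of_real (q powr (-1/2)) * unit_exp \<theta>) \<noteq> 0"
  shows "arg_variation (L \<circ> arc_then_ray q \<theta>) =
    (\<Sum>i<N. Arg (1 - \<alpha> i * (of_real (q powr (-1/2)) * unit_exp \<theta>)))"
proof -
  let ?\<gamma> = "arc_then_ray q \<theta>" and ?R = "q powr (-1/2)"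
  have small: "norm (\<alpha> i * u) < 1" if i: "i < N" and u: "norm u < ?R" for i u
  proof (cases "\<alpha> i = 0")
    case False
    then have "norm (\<alpha> i) * norm u < norm (\<alpha> i) * ?R" using u by simp
    then show ?thesis using \<alpha>[OF i] by (simp add: norm_mult)
  qed simp
  have on_path: "norm (\<alpha> i * ?\<gamma> t) \<le> 1 \<and> \<alpha> i * ?\<gamma> t \<noteq> 1" if t: "t \<in> {0..1}" and i: "i < N" for t i
  proof (cases "t = 1")
    case True
    have "norm (\<alpha> i * ?\<gamma> 1) \<le> 1"
      using \<alpha>[OF i] by (simp add: arc_then_ray_1[OF q] norm_mult unit_exp_eq_cis)
    moreover have "\<alpha> i * ?\<gamma> 1 \<noteq> 1"
      using nz i by (auto simp: arc_then_ray_1[OF q] L)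
    ultimately show ?thesis using True by simp
  next
    case False
    then have "norm (\<alpha> i * ?\<gamma> t) < 1" using norm_arc_then_ray[OF q t] i by (intro small) auto
    then show ?thesis by auto
  qed
  have cont: "continuous_on {0..1} (\<lambda>t. \<Sum>i<N. Arg (1 - \<alpha> i * ?\<gamma> t))"
  proof (intro continuous_on_sum)
    fix i assume i: "i \<in> {..<N}"
    have "continuous_on {0..1} ?\<gamma>" using path_arc_then_ray[OF q] by (simp add: path_def)
    then show "continuous_on {0..1} (\<lambda>t. Arg (1 - \<alpha> i * ?\<gamma> t))"
      using on_path i unfolding continuous_on_eq_continuous_within
      by (intro ballI continuous_Arg_one_minus continuous_intros) auto
  qed
  have "arg_variation (L \<circ> ?\<gamma>) = (\<Sum>i<N. Arg (1 - \<alpha> i * ?\<gamma> 1)) - (\<Sum>i<N. Arg (1 - \<alpha> i * ?\<gamma> 0))"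
  proof (rule arg_variation_eq[OF cont])
    fix t :: real assume t: "t \<in> {0..1}"
    show "(L \<circ> ?\<gamma>) t = of_real (cmod ((L \<circ> ?\<gamma>) t)) * cis (\<Sum>i<N. Arg (1 - \<alpha> i * ?\<gamma> t))"
      unfolding o_def L by (rule prod_eq_norm_cis_sum_Arg)
    show "(L \<circ> ?\<gamma>) t \<noteq> 0" using on_path[OF t] by (auto simp: L)
  qed
  \<comment> \<open>The single terms need not vanish at q^(-2). But L is real and nonzero on the
    segment from 0 to q^(-2), so the sum is a continuous multiple of pi there, and it is 0 at the
    origin.\<close>
  also have "(\<Sum>i<N. Arg (1 - \<alpha> i * ?\<gamma> 0)) = 0"
  proof -
    let ?r = "q powr (-2)"
    define h where "h x = (\<Sum>i<N. Arg (1 - \<alpha> i * of_real x))" for x :: real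
    have inner: "norm (\<alpha> i * of_real x) < 1" if "x \<in> {0..?r}" "i < N" for x i
    proof (rule small[OF that(2)])
      have "?r < ?R" using q by simp
      with that show "norm (complex_of_real x) < ?R" by simp
    qed
    have "h ?r = h 0"
    proof (rule continuous_int_multiple_const[of "{0..?r}" h pi])
      show "continuous_on {0..?r} h"
        unfolding h_def continuous_on_eq_continuous_within
        by (intro ballI continuous_sum continuous_Arg_one_minus continuous_intros) (use inner in force)+
      fix x assume x: "x \<in> {0..?r}"
      have "L (of_real x) = of_real (cmod (L (of_real x))) * cis (h x)"
        unfolding L h_def by (rule prod_eq_norm_cis_sum_Arg)
      then have "Im (of_real (cmod (L (of_real x))) * cis (h x)) = 0"
        using real[of x] by (metis complex_is_Real_iff)
      moreover have "L (of_real x) \<noteq> 0" using inner[OF x] by (force simp: L)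
      ultimately have "sin (h x) = 0" by simp
      then show "\<exists>n::int. h x = of_int n * pi" by (simp add: sin_zero_iff_int2)
    qed auto
    also have "h 0 = 0" by (simp add: h_def)
    finally show ?thesis by (simp add: h_def arc_then_ray_0[OF q])
  qed
  finally show ?thesis by (simp add: arc_then_ray_1[OF q] o_def)
qed

section \<open>The upper bound\<close>

lemma L_function_zeros:
  fixes D :: "'a::{field,finite} poly"
  assumes odd: "odd CARD('a)" and D: "lead_coeff D = 1" "odd (degree D)"
  obtains N :: nat and \<alpha> :: "nat \<Rightarrow> complex"
  where "N < degree D" "\<And>u. L_function D u = (\<Prod>i<N. 1 - \<alpha> i * u)"
    "\<And>i. i < N \<Longrightarrow> norm (\<alpha> i) \<le> sqrt (real CARD('a))"
    "\<And>k. k > 0 \<Longrightarrow> (\<Sum>i<N. \<alpha> i ^ k) = - of_int (prime_power_sum D k)"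
proof -
  let ?q = "real CARD('a)" and ?d = "degree D"
  have q1: "?q > 1" using card_field_gt_1[where ?'a = 'a] by simp
  have d0: "?d > 0" using D by (auto intro: odd_pos)
  define p where "p = (\<Sum>n<?d. monom (of_int (L_coeff D n) :: complex) n)"
  have coeff: "coeff p n = of_int (L_coeff D n)" for n
    using L_coeff_eq_0[OF odd D, of n] by (auto simp: p_def coeff_sum)
  have L: "L_function D u = poly p u" for u
  proof -
    have "L_function D u = (\<Sum>n<?d. of_int (L_coeff D n) * u ^ n)"
      unfolding L_function_def by (rule suminf_finite) (auto simp: L_coeff_eq_0[OF odd D])
    then show ?thesis by (simp add: p_def poly_sum poly_monom)
  qed
  have "degree p < ?d"
    using d0 by (intro degree_lessI) (auto simp: coeff L_coeff_eq_0[OF odd D])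
  have p0: "coeff p 0 = 1" by (simp add: coeff)
  have rec: "of_nat n * coeff p n = (\<Sum>k=1..n. of_int (prime_power_sum D k) * coeff p (n - k))" for n
    using arg_cong[OF L_coeff_recurrence[OF odd, of n D], of "of_int :: int \<Rightarrow> complex"]
    by (simp add: coeff)
  obtain \<alpha> where \<alpha>: "p = (\<Prod>i<degree p. [:1, - \<alpha> i:])"
    using polynomial_linear_factors[OF p0] .
  have prod: "poly p u = (\<Prod>i<degree p. 1 - \<alpha> i * u)" for u
    by (subst \<alpha>) (simp add: poly_prod mult.commute)
  show ?thesis
  proof (rule that[of "degree p" \<alpha>])
    show "degree p < ?d" by fact
    show "L_function D u = (\<Prod>i<degree p. 1 - \<alpha> i * u)" for u
      by (simp only: L prod)
    show "(\<Sum>i<degree p. \<alpha> i ^ k) = - of_int (prime_power_sum D k)" if "k > 0" for k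
      by (rule power_sums_eq[OF \<alpha> rec that])
    show "norm (\<alpha> i) \<le> sqrt ?q" if i: "i < degree p" for i
    proof (rule ccontr)
      assume large: "\<not> norm (\<alpha> i) \<le> sqrt ?q"
      have sq: "sqrt ?q > 0" using q1 by simp
      have a0: "\<alpha> i \<noteq> 0" using large sq by auto
      \<comment> \<open>The point 1/\<alpha> lies in the disc of radius q^(-1/2), where the
        square-root bound makes the logarithm of L converge, whatever its constant.\<close>
      have "poly p (1 / \<alpha> i) \<noteq> 0"
      proof (rule poly_nonzero_of_log_coeffs[OF p0 rec])
        show "norm (of_int (prime_power_sum D k) :: complex)
            \<le> real ((12 * degree D + 6) * CARD('a)) * sqrt ?q ^ k" if "k > 0" for k
          using abs_prime_power_sum_le_sqrt[OF odd D that] by simp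
        show "norm (1 / \<alpha> i) * sqrt ?q < 1"
          using large a0 by (simp add: norm_divide field_simps)
      qed fact
      moreover have "poly p (1 / \<alpha> i) = 0"
        using i a0 by (auto simp: prod)
      ultimately show False by simp
    qed
  qed
qed

text \<open>Only z = 1 is not a matter of continuity: there the sawtooth takes opposite values at
  \<epsilon> and -\<epsilon>, so the sum is 0 near 0, in agreement with
  \<open>Arg 0 = 0\<close>.\<close>

lemma tendsto_Arg_symmetric:
  fixes z :: complex
  assumes z: "norm z \<le> 1"
  shows "((\<lambda>\<epsilon>. Arg (1 - z * cis (2 * pi * - \<epsilon>)) + Arg (1 - z * cis (2 * pi * \<epsilon>)))
      \<longlongrightarrow> 2 * Arg (1 - z)) (at 0)"
proof (cases "z = 1")
  case False
  have *: "((\<lambda>\<epsilon>. Arg (1 - z * cis (2 * pi * (s * \<epsilon>)))) \<longlongrightarrow> Arg (1 - z)) (at 0)" for s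
  proof -
    have "isCont (\<lambda>\<epsilon>. Arg (1 - z * cis (2 * pi * (s * \<epsilon>)))) 0"
      using z False
      by (intro continuous_Arg_one_minus) (auto simp: cis_conv_exp intro!: continuous_intros)
    then show ?thesis by (simp add: isCont_def)
  qed
  show ?thesis using tendsto_add[OF *[of "-1"] *[of 1]] by simp
next
  case True
  have pos: "Arg (1 - cis (2 * pi * - x)) + Arg (1 - cis (2 * pi * x)) = 0" if x: "0 < x" "x < 1" for x
  proof -
    have "cis (2 * pi * - x) = cis (2 * pi * (1 - x))"
      by (simp add: complex_eq_iff right_diff_distrib cos_diff sin_diff)
    then show ?thesis
      using x Arg_one_minus_cis[of x] Arg_one_minus_cis[of "1 - x"] by (simp add: algebra_simps)
  qed
  have "\<forall>\<^sub>F \<epsilon>::real in at 0. \<epsilon> \<noteq> 0 \<and> \<bar>\<epsilon>\<bar> < 1"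
    unfolding eventually_at by (intro exI[of _ 1]) auto
  then have "\<forall>\<^sub>F \<epsilon> in at 0. 0 = Arg (1 - z * cis (2 * pi * - \<epsilon>)) + Arg (1 - z * cis (2 * pi * \<epsilon>))"
  proof eventually_elim
    case (elim \<epsilon>)
    then show ?case
      using pos[of \<epsilon>] pos[of "- \<epsilon>"] by (cases "\<epsilon> > 0") (auto simp: True)
  qed
  then show ?thesis
    by (rule Lim_transform_eventually[rotated]) (simp add: True Arg_zero)
qed

lemma eventually_mult_cis_neq_1:
  fixes z :: complex
  assumes s: "s \<in> {1, -1 :: real}"
  shows "\<forall>\<^sub>F \<epsilon> in at 0. z * cis (2 * pi * (s * \<epsilon>)) \<noteq> 1"
proof (cases "z = 1")
  case False
  have "((\<lambda>\<epsilon>. z * cis (2 * pi * (s * \<epsilon>))) \<longlongrightarrow> z * cis (2 * pi * (s * 0))) (at 0)"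
    by (intro tendsto_intros)
  then show ?thesis using False by (intro tendsto_imp_eventually_ne) auto
next
  case True
  have "\<forall>\<^sub>F \<epsilon>::real in at 0. \<epsilon> \<noteq> 0 \<and> \<bar>\<epsilon>\<bar> < 1"
    unfolding eventually_at by (intro exI[of _ 1]) auto
  then show ?thesis
  proof eventually_elim
    case (elim \<epsilon>)
    show ?case
    proof
      assume "z * cis (2 * pi * (s * \<epsilon>)) = 1"
      then have "cos (2 * pi * (s * \<epsilon>)) = 1" using True by (simp add: complex_eq_iff)
      then obtain n :: int where "2 * pi * (s * \<epsilon>) = of_int n * 2 * pi"
        using cos_one_2pi_int by blast
      then have "s * \<epsilon> = of_int n" by simp
      then have "\<bar>\<epsilon>\<bar> = of_int \<bar>n\<bar>" using s by auto
      with elim have "0 < \<bar>n\<bar>" "\<bar>n\<bar> < 1" by (simp_all flip: of_int_abs)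
      then show False by simp
    qed
  qed
qed

text \<open>
  If \<open>w\<close> is a zero, the two one-sided limits of the vanishing terms cancel, in accordance with the
  convention \<open>Arg 0 = 0\<close>.
\<close>
lemma S_chi_eq_sum_Arg:
  fixes D :: "'a::{field,finite} poly" and \<theta> :: real and \<alpha> :: "nat \<Rightarrow> complex"
  defines "w \<equiv> of_real (real CARD('a) powr (-1/2)) * unit_exp \<theta>"
  assumes L: "\<And>u. L_function D u = (\<Prod>i<N. 1 - \<alpha> i * u)"
    and \<alpha>: "\<And>i. i < N \<Longrightarrow> norm (\<alpha> i) \<le> sqrt (real CARD('a))"
    and real: "\<And>x. L_function D (of_real x) \<in> \<real>"
  shows "S_chi \<theta> D = (\<Sum>i<N. - Arg (1 - \<alpha> i * w) / pi)"
proof -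
  let ?q = "real CARD('a)"
  let ?R = "?q powr (-1/2)"
  have q1: "?q > 1" using card_field_gt_1[where ?'a = 'a] by simp
  have small: "norm (\<alpha> i) * ?R \<le> 1" if "i < N" for i
  proof -
    have "norm (\<alpha> i) * ?R \<le> sqrt ?q * ?R" using \<alpha>[OF that] by (intro mult_right_mono) auto
    also have "\<dots> = 1" using q1 by (simp add: powr_half_sqrt[symmetric] flip: powr_add)
    finally show ?thesis .
  qed
  have reg: "S_regular \<tau> D = - (1 / pi) * (\<Sum>i<N. Arg (1 - \<alpha> i * (of_real ?R * unit_exp \<tau>)))"
    if "L_function D (of_real ?R * unit_exp \<tau>) \<noteq> 0" for \<tau>
    using arg_variation_arc_then_ray[where L = "L_function D" and \<alpha> = \<alpha> and N
      = N, OF q1 L small real that] by (simp add: S_regular_def)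
  have sum: "- (1 / pi) * (\<Sum>i<N. Arg (1 - \<alpha> i * w)) = (\<Sum>i<N. - Arg (1 - \<alpha> i * w) / pi)"
    by (simp add: sum_distrib_left sum_divide_distrib)
  show ?thesis
  proof (cases "L_function D w = 0")
    case False
    then show ?thesis using reg[of \<theta>] sum by (simp add: S_chi_def w_def)
  next
    case True
    have shift: "of_real ?R * unit_exp (\<theta> + \<epsilon>) = w * cis (2 * pi * \<epsilon>)" for \<epsilon>
      by (simp add: w_def unit_exp_eq_cis cis_mult distrib_left)
    have ev: "\<forall>\<^sub>F \<epsilon> in at 0. L_function D (of_real ?R * unit_exp (\<theta> + s * \<epsilon>)) \<noteq> 0"
      if s: "s \<in> {1, -1}" for s
    proof -
      have "\<forall>\<^sub>F \<epsilon> in at 0. \<forall>i\<in>{..<N}. \<alpha> i * w * cis (2 * pi * (s * \<epsilon>)) \<noteq> 1"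
        by (intro eventually_ball_finite ballI eventually_mult_cis_neq_1[OF s]) auto
      then show ?thesis
        unfolding shift L by eventually_elim (auto simp: mult.assoc)
    qed
    have norm_z: "norm (\<alpha> i * w) \<le> 1" if "i < N" for i
      using small[OF that] by (simp add: w_def norm_mult unit_exp_eq_cis)
    have "((\<lambda>\<epsilon>. - (1 / pi) * (\<Sum>i<N. Arg (1 - (\<alpha> i * w) * cis (2 * pi * - \<epsilon>)) + Arg (1
        - (\<alpha> i * w) * cis (2 * pi * \<epsilon>))))
        \<longlongrightarrow> - (1 / pi) * (\<Sum>i<N. 2 * Arg (1 - \<alpha> i * w))) (at 0)"
      by (intro tendsto_mult tendsto_const tendsto_sum tendsto_Arg_symmetric norm_z) auto
    moreover have "\<forall>\<^sub>F \<epsilon> in at 0. - (1 / pi) * (\<Sum>i<N. Arg (1 - (\<alpha> i * w) * cis (2 * pi * - \<epsilon>))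
        + Arg (1 - (\<alpha> i * w) * cis (2 * pi * \<epsilon>)))
        = S_regular (\<theta> - \<epsilon>) D + S_regular (\<theta> + \<epsilon>) D"
      using ev[OF insertI1] ev[OF insertI2[OF insertI1]]
    proof eventually_elim
      case (elim \<epsilon>)
      then have "S_regular (\<theta> + \<epsilon>) D = - (1 / pi) * (\<Sum>i<N. Arg (1 - \<alpha> i * (w * cis (2 * pi * \<epsilon>))))"
        "S_regular (\<theta> - \<epsilon>) D = - (1 / pi) * (\<Sum>i<N. Arg (1 - \<alpha> i * (w * cis (2 * pi * - \<epsilon>))))"
        using reg[of "\<theta> + \<epsilon>"] reg[of "\<theta> - \<epsilon>"] shift[of \<epsilon>] shift[of "- \<epsilon>"] by simp_all
      then show ?case by (simp only: sum.distrib distrib_left mult.assoc)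
    qed
    ultimately have "((\<lambda>\<epsilon>. S_regular (\<theta> - \<epsilon>) D + S_regular (\<theta> + \<epsilon>) D)
        \<longlongrightarrow> - (1 / pi) * (\<Sum>i<N. 2 * Arg (1 - \<alpha> i * w))) (at 0)"
      by (rule Lim_transform_eventually)
    then have "Lim (at 0) (\<lambda>\<epsilon>. S_regular (\<theta> - \<epsilon>) D + S_regular (\<theta> + \<epsilon>) D)
        = - (1 / pi) * (\<Sum>i<N. 2 * Arg (1 - \<alpha> i * w))"
      by (intro tendsto_Lim) auto
    then have "S_chi \<theta> D = - (1 / pi) * (\<Sum>i<N. Arg (1 - \<alpha> i * w))"
      using True by (simp add: S_chi_def w_def flip: sum_distrib_left)
    then show ?thesis by (simp only: sum)
  qed
qed

text \<open>The mean 1/(2M) is counted once for each of the at most d - 1 inverse zeros. At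
  frequency j the trivial bound leaves q^(-j/2) q^j = q^(j/2) \<le> q^(M/2). Degree 1, where L = 1
  and S = 0, is kept apart for the sake of the theorem at d = 1.\<close>

lemma S_chi_bound:
  fixes D :: "'a::{field,finite} poly" and \<theta> :: real
  assumes odd: "odd CARD('a)" and D: "lead_coeff D = 1" "odd (degree D)" and M: "M > 0"
  shows "S_chi \<theta> D \<le> real (degree D - 1) / (2 * real M) + (if degree D
      = 1 then 0 else 2 * real M * sqrt (real CARD('a)) ^ M)"
proof -
  let ?q = "real CARD('a)"
  let ?R = "?q powr (-1/2)"
  have q1: "?q > 1" using card_field_gt_1[where ?'a = 'a] by simp
  obtain N \<alpha> where N: "N < degree D" and L: "\<And>u. L_function D u = (\<Prod>i<N. 1 - \<alpha> i * u)"
    and \<alpha>: "\<And>i. i < N \<Longrightarrow> norm (\<alpha> i) \<le> sqrt ?q"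
    and pow: "\<And>k. k > 0 \<Longrightarrow> (\<Sum>i<N. \<alpha> i ^ k) = - of_int (prime_power_sum D k)"
    using L_function_zeros[OF odd D] by blast
  define w where "w = of_real ?R * unit_exp \<theta>"
  have norm_w: "norm w = ?R" by (simp add: w_def norm_mult unit_exp_eq_cis)
  have Rs: "?R * sqrt ?q = 1" using q1 by (simp add: powr_half_sqrt[symmetric] flip: powr_add)
  have real: "L_function D (of_real x) \<in> \<real>" for x
  proof -
    have "L_function D (of_real x) = (\<Sum>n<degree D. of_int (L_coeff D n) * of_real x ^ n)"
      unfolding L_function_def by (rule suminf_finite) (auto simp: L_coeff_eq_0[OF odd D])
    then show ?thesis by (auto intro!: Reals_mult Reals_power sum_in_Reals)
  qed
  have S: "S_chi \<theta> D = (\<Sum>i<N. - Arg (1 - \<alpha> i * w) / pi)"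
    unfolding w_def by (rule S_chi_eq_sum_Arg[OF L \<alpha> real])
  show ?thesis
  proof (cases "degree D = 1")
    case True
    then show ?thesis using N by (simp add: S)
  next
    case False
    have "S_chi \<theta> D \<le> (\<Sum>i<N. Re (majorant_poly M (\<alpha> i * w)))"
      unfolding S
    proof (intro sum_mono neg_Arg_le_majorant[OF M])
      fix i assume "i \<in> {..<N}"
      then have "norm (\<alpha> i) * ?R \<le> sqrt ?q * ?R" using \<alpha> by (intro mult_right_mono) auto
      then show "norm (\<alpha> i * w) \<le> 1" using Rs by (metis mult.commute norm_mult norm_w)
    qed
    also have "\<dots> = Re (\<Sum>i<N. majorant_poly M (\<alpha> i * w))" by simp
    also have "(\<Sum>i<N. majorant_poly M (\<alpha> i * w)) =
        of_real (real N / (2 * real M)) + (\<Sum>j=1..<M. majorant_coeff M j * (w ^ j * (\<Sum>i<N. \<alpha> i ^ j)))"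
      unfolding majorant_poly_def sum.distrib
      by (subst sum.swap) (simp add: sum_distrib_left power_mult_distrib mult_ac)
    also have "Re \<dots> \<le> real N / (2 * real M)
        + norm (\<Sum>j=1..<M. majorant_coeff M j * (w ^ j * (\<Sum>i<N. \<alpha> i ^ j)))"
      by (simp only: plus_complex.sel Re_complex_of_real add_left_mono complex_Re_le_cmod)
    also have "norm (\<Sum>j=1..<M. majorant_coeff M j * (w ^ j * (\<Sum>i<N. \<alpha> i ^ j)))
        \<le> (\<Sum>j=1..<M. 2 * sqrt ?q ^ M)"
    proof (rule sum_norm_le)
      fix j assume j: "j \<in> {1..<M}"
      have "norm (\<Sum>i<N. \<alpha> i ^ j) \<le> ?q ^ j"
      proof -
        have "norm (\<Sum>i<N. \<alpha> i ^ j) = \<bar>real_of_int (prime_power_sum D j)\<bar>" using j by (simp add: pow)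
        also have "\<dots> = real_of_int \<bar>prime_power_sum D j\<bar>" by simp
        also have "\<dots> \<le> real_of_int (int CARD('a) ^ j)"
          using abs_prime_power_sum_le[of j D] j by (simp only: of_int_le_iff) auto
        finally show ?thesis by simp
      qed
      then have "norm (w ^ j * (\<Sum>i<N. \<alpha> i ^ j)) \<le> ?R ^ j * ?q ^ j"
        by (simp add: norm_mult norm_power norm_w mult_left_mono)
      also have "\<dots> = (?R * sqrt ?q * sqrt ?q) ^ j"
        using q1 by (simp add: mult.assoc flip: power_mult_distrib)
      also have "\<dots> = sqrt ?q ^ j" by (simp only: Rs mult_1_left)
      also have "\<dots> \<le> sqrt ?q ^ M" using q1 j by (intro power_increasing) auto
      finally show "norm (majorant_coeff M j * (w ^ j * (\<Sum>i<N. \<alpha> i ^ j))) \<le> 2 * sqrt ?q ^ M"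
        unfolding norm_mult[of "majorant_coeff M j"]
        using j by (intro mult_mono norm_majorant_coeff_le) auto
    qed
    also have "\<dots> \<le> 2 * real M * sqrt ?q ^ M"
      using q1 by (simp add: mult_right_mono)
    also have "real N / (2 * real M) \<le> real (degree D - 1) / (2 * real M)"
      using N by (intro divide_right_mono) auto
    finally show ?thesis using False by simp
  qed
qed

theorem theorem2:
  assumes "odd CARD('a::{field,finite})"
  shows "\<exists>\<epsilon> :: nat \<Rightarrow> real.
           \<epsilon> \<longlonglongrightarrow> 0 \<and>
           (\<forall>d. odd d \<longrightarrow>
             (\<forall>D \<in> (hyperelliptic_ensemble d :: 'a poly set). \<forall>\<theta>::real.
                S_chi \<theta> D \<le> (1 / 4 + \<epsilon> d) * (real d / log (real CARD('a)) (real d))))"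
proof -
  define q where "q = real CARD('a)"
  have q1: "q > 1" using card_field_gt_1[where ?'a = 'a] by (simp add: q_def)
  \<comment> \<open>With x = log_q d this makes y(x) = 2 x - 6 log_q x and q^(y/2) = d / x^3.
    Relative to d / x the error is then at most 2 y / x^2, which tends to 0, while y/x still tends
    to 2. The maximum with 1 in \<open>M\<close> only guards small d.\<close>
  define c where "c = 6 / ln q"
  define y where "y x = 2 * x - c * ln x" for x
  define M where "M d = max 1 (nat \<lfloor>y (log q (real d))\<rfloor>)" for d :: nat
  \<comment> \<open>Solved from the bound: for d > 1, (1/4 + \<epsilon>) d / log_q d is exactly the
    upper bound with d - 1 enlarged to d. What remains is that \<epsilon> tends to 0.\<close>
  define \<epsilon> where "\<epsilon> d = (real d / (2 * real (M d)) + 2 * real (M d) * sqrt q ^ M d) *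
      (log q (real d) / real d) - 1 / 4" for d
  have lim: "filterlim (\<lambda>d. log q (real d)) at_top sequentially"
    using q1 by real_asymp
  have y_top: "filterlim y at_top at_top" unfolding y_def by real_asymp
  have ev: "\<forall>\<^sub>F d in sequentially. 1 < log q (real d) \<and> 2 < y (log q (real d)) \<and> 0 < d"
    using eventually_compose_filterlim[OF eventually_gt_at_top[of 1] lim]
      eventually_compose_filterlim[OF eventually_compose_filterlim[OF eventually_gt_at_top[of 2]
        y_top] lim]
      eventually_gt_at_top[of 0]
    by eventually_elim simp
  have M_bounds: "y (log q (real d)) - 1 \<le> real (M d)" "real (M d) \<le> y (log q (real d))"
    if "2 < y (log q (real d))" for d
    using that by (simp_all add: M_def)
  have main: "(\<lambda>d. log q (real d) / (2 * real (M d))) \<longlonglongrightarrow> 1 / 4"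
  proof (rule tendsto_sandwich)
    show "\<forall>\<^sub>F d in sequentially. log q (real d) / (2 * y (log q (real d)))
        \<le> log q (real d) / (2 * real (M d))"
      using ev by eventually_elim (use M_bounds in \<open>force intro!: divide_left_mono mult_pos_pos\<close>)
    show "\<forall>\<^sub>F d in sequentially. log q (real d) / (2 * real (M d))
        \<le> log q (real d) / (2 * (y (log q (real d)) - 1))"
      using ev by eventually_elim (use M_bounds in \<open>force intro!: divide_left_mono mult_pos_pos\<close>)
    have "((\<lambda>x. x / (2 * y x)) \<longlongrightarrow> 1 / 4) at_top" unfolding y_def by real_asymp
    then show "(\<lambda>d. log q (real d) / (2 * y (log q (real d)))) \<longlonglongrightarrow> 1 / 4"
      by (rule filterlim_compose[OF _ lim])
    have "((\<lambda>x. x / (2 * (y x - 1))) \<longlongrightarrow> 1 / 4) at_top" unfolding y_def by real_asymp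
    then show "(\<lambda>d. log q (real d) / (2 * (y (log q (real d)) - 1))) \<longlonglongrightarrow> 1 / 4"
      by (rule filterlim_compose[OF _ lim])
  qed
  have error: "(\<lambda>d. 2 * real (M d) * sqrt q ^ M d * (log q (real d) / real d)) \<longlonglongrightarrow> 0"
  proof (rule tendsto_sandwich)
    show "\<forall>\<^sub>F d in sequentially. 0 \<le> 2 * real (M d) * sqrt q ^ M d * (log q (real d) / real d)"
      using ev by eventually_elim (use q1 in auto)
    show "\<forall>\<^sub>F d in sequentially. 2 * real (M d) * sqrt q ^ M d * (log q (real d) / real d)
        \<le> 2 * y (log q (real d)) / (log q (real d))\<^sup>2"
      using ev
    proof eventually_elim
      case (elim d)
      define x where "x = log q (real d)"
      have x: "x > 1" "y x > 2" and d: "real d = q powr x" using elim q1 by (auto simp: x_def)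
      have "sqrt q ^ M d = q powr (real (M d) / 2)"
        using q1 by (simp add: powr_half_sqrt[symmetric] powr_powr flip: powr_realpow)
      also have "\<dots> \<le> q powr (y x / 2)"
        using M_bounds(2)[of d] x q1 by (intro powr_mono) (auto simp: x_def)
      also have "y x / 2 = x - 3 * log q x"
        by (simp add: y_def c_def log_def field_simps)
      also have "q powr (x - 3 * log q x) = real d / x ^ 3"
        using q1 x by (simp add: powr_diff d mult.commute[of 3] powr_powr[symmetric])
      finally have "2 * real (M d) * sqrt q ^ M d \<le> 2 * y x * (real d / x ^ 3)"
        using M_bounds(2)[of d] x q1 by (intro mult_mono) (auto simp: x_def)
      then have "2 * real (M d) * sqrt q ^ M d * (x / real d)
          \<le> 2 * y x * (real d / x ^ 3) * (x / real d)"
        using x by (intro mult_right_mono) auto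
      also have "\<dots> = 2 * y x / x\<^sup>2"
        using x elim by (simp add: field_simps power2_eq_square power3_eq_cube)
      finally show ?case by (simp add: x_def)
    qed
    have "((\<lambda>x. 2 * y x / x\<^sup>2) \<longlongrightarrow> 0) at_top" unfolding y_def by real_asymp
    then show "(\<lambda>d. 2 * y (log q (real d)) / (log q (real d))\<^sup>2) \<longlonglongrightarrow> 0"
      by (rule filterlim_compose[OF _ lim])
  qed simp
  have "(\<lambda>d. log q (real d) / (2 * real (M d))
      + 2 * real (M d) * sqrt q ^ M d * (log q (real d) / real d) - 1 / 4)
      \<longlonglongrightarrow> 1 / 4 + 0 - 1 / 4"
    by (intro tendsto_diff tendsto_add main error tendsto_const)
  moreover have "\<forall>\<^sub>F d in sequentially. log q (real d) / (2 * real (M d))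
      + 2 * real (M d) * sqrt q ^ M d * (log q (real d) / real d) - 1 / 4 = \<epsilon> d"
    using eventually_gt_at_top[of 0]
  proof eventually_elim
    case (elim d)
    then have "real d / (2 * real (M d)) * (log q (real d) / real d)
        = log q (real d) / (2 * real (M d))" by simp
    then show ?case by (simp only: \<epsilon>_def distrib_right)
  qed
  ultimately have "\<epsilon> \<longlonglongrightarrow> 0"
    using Lim_transform_eventually by fastforce
  moreover have "S_chi \<theta> D \<le> (1 / 4 + \<epsilon> d) * (real d / log q (real d))"
    if d: "odd d" and D: "D \<in> (hyperelliptic_ensemble d :: 'a poly set)" for d D \<theta>
  proof -
    have D': "lead_coeff D = 1" "odd (degree D)" "degree D = d"
      using D d by (auto simp: hyperelliptic_ensemble_def)
    have M: "M d > 0" by (simp add: M_def)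
    note bound = S_chi_bound[OF assms D'(1,2) M, of \<theta>]
    show ?thesis
    proof (cases "d = 1")
      case True
      \<comment> \<open>Since \<open>log q 1 = 0\<close> and division by zero gives 0, the claim
        here is \<open>S_chi \<theta> D \<le> 0\<close>.\<close>
      then show ?thesis using bound D'(3) by simp
    next
      case False
      then have d1: "d > 1" using d by (cases d) auto
      then have "log q (real d) > 0" using q1 by simp
      then have "(1 / 4 + \<epsilon> d) * (real d / log q (real d))
          = real d / (2 * real (M d)) + 2 * real (M d) * sqrt q ^ M d"
        using d1 by (simp add: \<epsilon>_def)
      moreover have "real (d - 1) / (2 * real (M d)) \<le> real d / (2 * real (M d))"
        by (intro divide_right_mono) auto
      ultimately show ?thesis using bound D'(3) False by (simp add: q_def)
    qed
  qed
  ultimately show ?thesis unfolding q_def by blast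
qed

end
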